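(* Consider the renewal risk model with 2-order phase-type interclaim times and exponential claim sizes described in the context. Let $(b_1^*,b_2^* )$ be optimal phase-wise barriers. If $0<b_1^*<b_2^*$, then $\lambda_{23}>\lambda_{13}$.
   Context: **Model.** Here $n=2$. Fix $c>0$, $\beta>0$, $\delta>0$, and $\pi_1,\pi_2\ge0$ with $\pi_1+\pi_2=1$. For $i\in\{1,2\}$ and $j\in\{1,2,3\}$, $j\ne i$, let $\lambda_{ij}\ge 0$ be transition intensities, and put $\lambda_i=\sum_{j=1,j\ne i}^{3}\lambda_{ij}>0$. A continuous-time Markov process $\bar J$ on $\{1,2,3\}$ has these intensities; $3$ is absorbing and the states $1,2$ (the phases) are transient. So $\lambda_{i3}$ is the intensity, in phase $i$, to the next claim. The observed phase process $J$ moves like $\bar J$ on $\{1,2\}$; each time state $3$ is entered a claim occurs and the process immediately restarts in phase $i$ with probability $\pi_i$, independently of the past. $N_t$ is the number of claims up to time $t$. Claim sizes $Y_1,Y_2,\dots$ are i.i.d. with distribution function $1-e^{-\beta y}$, $y\ge 0$, and independent of $J$. With cumulative dividends $D_t$ and initial capital $x\ge 0$ the surplus is $X_t^D=x+ct-\sum_{k=1}^{N_t}Y_k-D_t$, with ruin time $\tau=\inf\{t: X_t^D<0\}$. No dividends are paid after ruin. **Phase-wise barrier strategy.** For $b=(b_1,b_2)\in[0,\infty)^2$, the phase-wise barrier strategy with barriers $b$ is: whenever the current phase is $i$, all capital above $b_i$ is immediately paid as dividend; while the surplus equals $b_i$ in phase $i$ all incoming premium is paid as dividend (at rate $c$) until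 the next jump of the phase process; while the surplus is below $b_i$ no dividend is paid. Its value is $$f_i^b(x)=\mathbb E\Big[\int_{0-}^{\tau-}e^{-\delta t}\,\mathrm dD_t\,\Big|\,J_0=i,\ X_{0-}^D=x\Big],\quad x\ge 0,$$ where the integral includes an immediate lump sum at time $0$. **Optimal phase-wise barriers.** A vector $b^*=(b_1^*,b_2^* )\in[0,\infty)^2$ is called a vector of optimal phase-wise barriers if for every $i$ and every $x\in[0,b_i^*]$, $f_i^{b^*}(x)=\sup_{b\in[0,\infty)^2}f_i^{b}(x)$. *)

theory Defs
  imports "HOL-Probability.Probability"
begin

section \<open>The jump chain of the unobserved process on the states 1, 2, 3\<close>

text \<open>
  Phases are the numbers 1 and 2, the absorbing state is 3, and \<^term>\<open>lam i j\<close> is the intensity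
  from phase \<^term>\<open>i\<close> to state \<^term>\<open>j\<close>.  Values of \<^term>\<open>lam\<close> for \<^term>\<open>i = j\<close> or outside
  this range are never used.
\<close>

definition total_intensity :: "(nat \<Rightarrow> nat \<Rightarrow> real) \<Rightarrow> nat \<Rightarrow> real" where
  "total_intensity lam i = (\<Sum>j\<in>{1,2,3} - {i}. lam i j)"

definition jump_prob :: "(nat \<Rightarrow> nat \<Rightarrow> real) \<Rightarrow> nat \<Rightarrow> nat \<Rightarrow> real" where
  "jump_prob lam i j =
     (if i = 3 then (if j = 3 then 1 else 0)
      else if j = i then 0
      else lam i j / total_intensity lam i)"

primrec jump_prob_n :: "(nat \<Rightarrow> nat \<Rightarrow> real) \<Rightarrow> nat \<Rightarrow> nat \<Rightarrow> nat \<Rightarrow> real" where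
  "jump_prob_n lam 0 i j = (if i = j then 1 else 0)"
| "jump_prob_n lam (Suc n) i j = (\<Sum>k\<in>{1,2,3}. jump_prob lam i k * jump_prob_n lam n k j)"

text \<open>Transience in the usual sense: the expected number of visits is finite.\<close>

definition transient_state :: "(nat \<Rightarrow> nat \<Rightarrow> real) \<Rightarrow> nat \<Rightarrow> bool" where
  "transient_state lam i \<longleftrightarrow> summable (\<lambda>n. jump_prob_n lam n i i)"

section \<open>The stochastic model\<close>

text \<open>
  The continuous-time Markov process is described by its jump chain and its holding times.  The
  \<^term>\<open>n\<close>-th sojourn is spent in phase \<^term>\<open>Z n\<close> and lasts \<^term>\<open>T n\<close>; at its end the
  unobserved process enters \<^term>\<open>K n \<in> {1,2,3}\<close>.  If \<^term>\<open>K n = 3\<close> a claim occurs and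
  \<^term>\<open>Z (Suc n)\<close> is the phase of restart, otherwise \<^term>\<open>Z (Suc n) = K n\<close>.  A restart may
  hit the phase just left, so consecutive sojourns can be in the same phase.  Claim sizes are
  numbered from 0, i.e. \<^term>\<open>Y k\<close> is the size of claim number \<^term>\<open>k + 1\<close>.

  The assumption \<open>path_law\<close> is the law of a Markov chain of jumps with, given the chain,
  independent exponential holding times.  The assumption on \<^term>\<open>Z 0\<close> makes the conditioning on
  either initial phase elementary.
\<close>

definition restart_prob :: "(nat \<Rightarrow> real) \<Rightarrow> nat \<Rightarrow> nat \<Rightarrow> real" where
  "restart_prob \<pi> k i = (if k = 3 then \<pi> i else if i = k then 1 else 0)"

locale phase_type_risk_model = prob_space M for M :: "'a measure" +
  fixes c \<beta> \<delta> :: real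
    and \<pi> :: "nat \<Rightarrow> real"
    and lam :: "nat \<Rightarrow> nat \<Rightarrow> real"
    and Z K :: "nat \<Rightarrow> 'a \<Rightarrow> nat"
    and T Y :: "nat \<Rightarrow> 'a \<Rightarrow> real"
  assumes c_pos: "c > 0" and \<beta>_pos: "\<beta> > 0" and \<delta>_pos: "\<delta> > 0"
    and restart_nonneg: "\<pi> 1 \<ge> 0" "\<pi> 2 \<ge> 0"
    and restart_sum: "\<pi> 1 + \<pi> 2 = 1"
    and intensity_nonneg: "\<And>i j. i \<in> {1,2} \<Longrightarrow> j \<in> {1,2,3} \<Longrightarrow> j \<noteq> i \<Longrightarrow> lam i j \<ge> 0"
    and total_intensity_pos: "\<And>i. i \<in> {1,2} \<Longrightarrow> total_intensity lam i > 0"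
    and transient: "\<And>i. i \<in> {1,2} \<Longrightarrow> transient_state lam i"
    and Z_measurable: "\<And>n. Z n \<in> measurable M (count_space UNIV)"
    and K_measurable: "\<And>n. K n \<in> measurable M (count_space UNIV)"
    and T_measurable: "\<And>n. T n \<in> borel_measurable M"
    and initial_phase: "\<And>\<omega>. \<omega> \<in> space M \<Longrightarrow> Z 0 \<omega> \<in> {1,2}"
    and initial_phase_pos: "\<And>i. i \<in> {1,2} \<Longrightarrow> prob {\<omega> \<in> space M. Z 0 \<omega> = i} > 0"
    and path_law: "\<And>n z k t.
      (\<And>m. m \<le> n \<Longrightarrow> z m \<in> {1,2}) \<Longrightarrow> (\<And>m. m < n \<Longrightarrow> k m \<in> {1,2,3}) \<Longrightarrow>
      (\<And>m. m < n \<Longrightarrow> 0 \<le> t m) \<Longrightarrow>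
      prob {\<omega> \<in> space M. Z 0 \<omega> = z 0 \<and>
              (\<forall>m<n. T m \<omega> > t m \<and> K m \<omega> = k m \<and> Z (Suc m) \<omega> = z (Suc m))} =
      prob {\<omega> \<in> space M. Z 0 \<omega> = z 0} *
      (\<Prod>m<n. exp (- total_intensity lam (z m) * t m) * jump_prob lam (z m) (k m) *
              restart_prob \<pi> (k m) (z (Suc m)))"
    and claim_distr: "\<And>k. distributed M lborel (Y k) (exponential_density \<beta>)"
    and claims_indep: "indep_vars (\<lambda>_. borel) Y UNIV"
    and claims_indep_path:
      "indep_set
         {(\<lambda>\<omega> k. Y k \<omega>) -` A \<inter> space M |A. A \<in> sets (\<Pi>\<^sub>M k\<in>UNIV. borel)}
         {(\<lambda>\<omega> n. (Z n \<omega>, K n \<omega>, T n \<omega>)) -` B \<inter> space M |B.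
            B \<in> sets (\<Pi>\<^sub>M n\<in>UNIV. count_space UNIV \<Otimes>\<^sub>M count_space UNIV \<Otimes>\<^sub>M borel)}"

section \<open>Paths: phases, claims, dividends and surplus\<close>

text \<open>
  In this section \<^term>\<open>Z\<close>, \<^term>\<open>K\<close>, \<^term>\<open>T\<close>, \<^term>\<open>Y\<close> are the sequences for one outcome.
  On the null set where infinitely many transitions happen in finite time,
  \<^const>\<open>card\<close> returns 0 and the definitions carry no meaning.
\<close>

definition epoch :: "(nat \<Rightarrow> real) \<Rightarrow> nat \<Rightarrow> real" where
  "epoch T n = (\<Sum>m<n. T m)"

definition transitions :: "(nat \<Rightarrow> real) \<Rightarrow> real \<Rightarrow> nat" where
  "transitions T t = card {n. 1 \<le> n \<and> epoch T n \<le> t}"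

definition phase_at :: "(nat \<Rightarrow> nat) \<Rightarrow> (nat \<Rightarrow> real) \<Rightarrow> real \<Rightarrow> nat" where
  "phase_at Z T t = Z (transitions T t)"

definition claims_among :: "(nat \<Rightarrow> nat) \<Rightarrow> nat \<Rightarrow> nat" where
  "claims_among K n = card {m. m < n \<and> K m = 3}"

definition claim_count :: "(nat \<Rightarrow> nat) \<Rightarrow> (nat \<Rightarrow> real) \<Rightarrow> real \<Rightarrow> nat" where
  "claim_count K T t = claims_among K (transitions T t)"

text \<open>
  The phase-wise barrier strategy.  \<^term>\<open>A n\<close>, with \<open>A\<close> the function \<open>dividends_before\<close>, is what has
  been paid strictly before the \<^term>\<open>n\<close>-th transition (time 0 for \<^term>\<open>n = (0::nat)\<close>).  During the
  \<^term>\<open>n\<close>-th sojourn the surplus without further payments would be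
  \<open>x + c t - claims so far - A n\<close>, increasing at rate \<^term>\<open>c\<close>, and exactly its excess over the
  barrier of the current phase has been paid up to time \<^term>\<open>t\<close>: the initial excess as a lump sum
  at the start of the sojourn, nothing while the surplus is below the barrier, and the premium at
  rate \<^term>\<open>c\<close> once the barrier is reached.
\<close>

primrec dividends_before ::
    "real \<Rightarrow> (nat \<Rightarrow> nat) \<Rightarrow> (nat \<Rightarrow> nat) \<Rightarrow> (nat \<Rightarrow> real) \<Rightarrow> (nat \<Rightarrow> real) \<Rightarrow>
     (nat \<Rightarrow> real) \<Rightarrow> real \<Rightarrow> nat \<Rightarrow> real" where
  "dividends_before c Z K T Y b x 0 = 0"
| "dividends_before c Z K T Y b x (Suc n) =
     dividends_before c Z K T Y b x n +
     max 0 (x + c * epoch T (Suc n) - (\<Sum>k<claims_among K n. Y k)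
              - dividends_before c Z K T Y b x n - b (Z n))"

definition dividends ::
    "real \<Rightarrow> (nat \<Rightarrow> nat) \<Rightarrow> (nat \<Rightarrow> nat) \<Rightarrow> (nat \<Rightarrow> real) \<Rightarrow> (nat \<Rightarrow> real) \<Rightarrow>
     (nat \<Rightarrow> real) \<Rightarrow> real \<Rightarrow> real \<Rightarrow> real" where
  "dividends c Z K T Y b x t =
     (if t < 0 then 0 else
        let A = dividends_before c Z K T Y b x (transitions T t) in
        A + max 0 (x + c * t - (\<Sum>k<claim_count K T t. Y k) - A - b (phase_at Z T t)))"

definition surplus ::
    "real \<Rightarrow> (nat \<Rightarrow> nat) \<Rightarrow> (nat \<Rightarrow> real) \<Rightarrow> (nat \<Rightarrow> real) \<Rightarrow> (real \<Rightarrow> real) \<Rightarrow> real \<Rightarrow> real \<Rightarrow> real" where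
  "surplus c K T Y D x t = x + c * t - (\<Sum>k<claim_count K T t. Y k) - D t"

definition ruin_time ::
    "real \<Rightarrow> (nat \<Rightarrow> nat) \<Rightarrow> (nat \<Rightarrow> real) \<Rightarrow> (nat \<Rightarrow> real) \<Rightarrow> (real \<Rightarrow> real) \<Rightarrow> real \<Rightarrow> ereal" where
  "ruin_time c K T Y D x = Inf (ereal ` {t. 0 \<le> t \<and> surplus c K T Y D x t < 0})"

text \<open>
  The Stieltjes integral over \<open>[0, \<tau>)\<close>: since \<^term>\<open>D\<close> vanishes on the negative
  axis, a lump sum paid at time 0 is an atom of \<^term>\<open>interval_measure D\<close> at 0.
\<close>

definition discounted_dividends ::
    "real \<Rightarrow> real \<Rightarrow> (nat \<Rightarrow> nat) \<Rightarrow> (nat \<Rightarrow> real) \<Rightarrow> (nat \<Rightarrow> real) \<Rightarrow> (real \<Rightarrow> real) \<Rightarrow> real \<Rightarrow> ennreal" where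
  "discounted_dividends c \<delta> K T Y D x =
     (\<integral>\<^sup>+ t\<in>{t. 0 \<le> t \<and> ereal t < ruin_time c K T Y D x}. ennreal (exp (- \<delta> * t)) \<partial>interval_measure D)"

section \<open>Value and optimality of phase-wise barriers\<close>

text \<open>The expectation is conditional on the initial phase; dividends are nonnegative, so values
  are taken in \<^typ>\<open>ennreal\<close> and no integrability or boundedness issue arises.\<close>

definition barrier_value ::
    "'a measure \<Rightarrow> real \<Rightarrow> real \<Rightarrow> (nat \<Rightarrow> 'a \<Rightarrow> nat) \<Rightarrow> (nat \<Rightarrow> 'a \<Rightarrow> nat) \<Rightarrow>
     (nat \<Rightarrow> 'a \<Rightarrow> real) \<Rightarrow> (nat \<Rightarrow> 'a \<Rightarrow> real) \<Rightarrow> (nat \<Rightarrow> real) \<Rightarrow> nat \<Rightarrow> real \<Rightarrow> ennreal" where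
  "barrier_value M c \<delta> Z K T Y b i x =
     (\<integral>\<^sup>+ \<omega>.
        discounted_dividends c \<delta> (\<lambda>n. K n \<omega>) (\<lambda>n. T n \<omega>) (\<lambda>k. Y k \<omega>)
          (dividends c (\<lambda>n. Z n \<omega>) (\<lambda>n. K n \<omega>) (\<lambda>n. T n \<omega>) (\<lambda>k. Y k \<omega>) b x) x
      \<partial>uniform_measure M {\<omega> \<in> space M. Z 0 \<omega> = i})"

text \<open>Barrier vectors are functions on the phases; values outside \<open>{1,2}\<close> are irrelevant.\<close>

definition barriers :: "(nat \<Rightarrow> real) set" where
  "barriers = {b. \<forall>i\<in>{1,2}. 0 \<le> b i}"

definition optimal_barriers ::
    "'a measure \<Rightarrow> real \<Rightarrow> real \<Rightarrow> (nat \<Rightarrow> 'a \<Rightarrow> nat) \<Rightarrow> (nat \<Rightarrow> 'a \<Rightarrow> nat) \<Rightarrow>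
     (nat \<Rightarrow> 'a \<Rightarrow> real) \<Rightarrow> (nat \<Rightarrow> 'a \<Rightarrow> real) \<Rightarrow> (nat \<Rightarrow> real) \<Rightarrow> bool" where
  "optimal_barriers M c \<delta> Z K T Y bs \<longleftrightarrow>
     bs \<in> barriers \<and>
     (\<forall>i\<in>{1,2}. \<forall>x\<in>{0..bs i}.
        barrier_value M c \<delta> Z K T Y bs i x = (SUP b\<in>barriers. barrier_value M c \<delta> Z K T Y b i x))"

end

theory Submission
  imports Defs
begin

text \<open>
  At its transition epochs the model is a Markov chain in (phase, surplus), so the value \<open>V\<close> of a barrier
  vector is a Neumann series and solves a renewal equation: \<open>V\<^sub>i\<close> is the profile of one sojourn with barrier
  \<open>b\<^sub>i\<close> and continuation rate \<open>H\<^sub>i = \<lambda>\<^sub>i\<^sub>j V\<^sub>j + \<lambda>\<^sub>i\<^sub>3 G\<close>, where \<open>G\<close> is the mean value after a claim.  With \<open>V\<close> kept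
  as continuation, the derivative of that profile in the barrier has the sign of \<open>H\<^sub>i' - (\<lambda>\<^sub>i + \<delta>)\<close>
  at every surplus, and a change of barrier that improves all profiles improves the value (policy
  improvement).  Hence optimality gives \<open>H\<^sub>2'(b\<^sub>2) \<ge> \<lambda>\<^sub>2 + \<delta>\<close> (else lower \<open>b\<^sub>2\<close>) and
  \<open>H\<^sub>1'(b\<^sub>1) \<le> \<lambda>\<^sub>1 + \<delta>\<close> (else raise \<open>b\<^sub>1\<close>).  As \<open>V\<^sub>1' = 1\<close> on \<open>[b\<^sub>1, b\<^sub>2]\<close>, the first condition reads
  \<open>G'(b\<^sub>2) \<ge> 1 + \<delta> / \<lambda>\<^sub>2\<^sub>3\<close>.  The pair \<open>(V\<^sub>2', G')\<close> solves a linear system on \<open>[b\<^sub>1, b\<^sub>2]\<close> which forces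
  \<open>V\<^sub>2'(b\<^sub>1) \<ge> 1\<close> and \<open>G'(b\<^sub>1) > G'(b\<^sub>2)\<close>.  The second condition then gives
  \<open>\<lambda>\<^sub>1\<^sub>3 G'(b\<^sub>1) \<le> \<lambda>\<^sub>1\<^sub>3 + \<delta>\<close>, so \<open>\<delta> / \<lambda>\<^sub>1\<^sub>3 > \<delta> / \<lambda>\<^sub>2\<^sub>3\<close> unless \<open>\<lambda>\<^sub>1\<^sub>3 = 0\<close>.
\<close>

section \<open>Dividends along a path\<close>

text \<open>Strategies are compared only through one-step profiles, so the value is never
  differentiated in the barriers. As the sign of the barrier derivative is the same at every
  surplus, a small shift of one barrier raises a profile everywhere at once, and the new value is
  strictly larger at surplus 0, which belongs to each interval in the definition of optimality. Both
  shifts stay in \<open>[b1, b2]\<close>, where V1 is affine and V2 solves the profile equation, so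
  H is differentiable there. Exponential claims give \<open>G' = \<beta> * (w - G)\<close>, w being
  the mean of V over the restart phase, and this closes the system of slopes. In H2' phase 1
  contributes \<open>lam 2 1\<close>, which cancels against the same summand of the total intensity.
  The remaining bound \<open>1 + \<delta> / lam 2 3\<close> is also the slope of G at which the
  equation of V2' is in equilibrium at V2' = 1. Two obstacles shape the rest: the model supplies
  only cylinder probabilities and path integrals, so the Markov property must be derived; and values
  grow linearly, so the contraction acts only after one sojourn, when the surplus is at most the
  larger barrier.\<close>

lemma emeasure_interval_measure_Ioo:
  fixes F :: "real \<Rightarrow> real"
  assumes "a < b" and mono: "\<And>x y. x \<le> y \<Longrightarrow> F x \<le> F y"
    and rc: "\<And>a. continuous (at_right a) F" and lim: "(F \<longlongrightarrow> l) (at_left b)"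
  shows "emeasure (interval_measure F) {a<..<b} = ennreal (l - F a)"
proof -
  define u where "u n = b - (b - a) / real (n + 2)" for n
  have u_gt: "a \<le> u n" for n
  proof -
    have "(b - a) / real (n + 2) \<le> (b - a) / 1"
      using \<open>a < b\<close> by (intro divide_left_mono) auto
    then show ?thesis by (simp add: u_def)
  qed
  have u_less: "u n < b" for n
    using \<open>a < b\<close> by (simp add: u_def)
  have "(\<lambda>n. b - (b - a) * inverse (real (n + 2))) \<longlonglongrightarrow> b - (b - a) * 0"
    by (intro tendsto_intros LIMSEQ_ignore_initial_segment[OF lim_inverse_n])
  then have u_lim: "u \<longlonglongrightarrow> b"
    by (simp add: u_def[abs_def] divide_inverse)
  have "filterlim u (at_left b) sequentially"
    by (rule tendsto_imp_filterlim_at_left[OF u_lim]) (simp add: u_less)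
  then have "(\<lambda>n. F (u n)) \<longlonglongrightarrow> l"
    by (rule filterlim_compose[OF lim])
  then have L: "(\<lambda>n. ennreal (F (u n) - F a)) \<longlonglongrightarrow> ennreal (l - F a)"
    by (intro tendsto_intros tendsto_ennrealI)
  have "incseq (\<lambda>n. {a<..u n})"
  proof (rule incseq_SucI)
    fix n
    have "(b - a) / real (Suc n + 2) \<le> (b - a) / real (n + 2)"
      using \<open>a < b\<close> by (intro divide_left_mono) auto
    then show "{a<..u n} \<subseteq> {a<..u (Suc n)}"
      by (auto simp: u_def)
  qed
  then have "(\<lambda>n. emeasure (interval_measure F) {a<..u n}) \<longlonglongrightarrow> emeasure (interval_measure F) (\<Union>n. {a<..u n})"
    by (intro Lim_emeasure_incseq) auto
  also have "(\<Union>n. {a<..u n}) = {a<..<b}"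
  proof (intro equalityI subsetI)
    fix y assume "y \<in> {a<..<b}"
    then have "eventually (\<lambda>n. y < u n) sequentially"
      using order_tendstoD(1)[OF u_lim, of y] by auto
    then obtain n where "y < u n"
      by (auto simp: eventually_sequentially)
    then show "y \<in> (\<Union>n. {a<..u n})"
      using \<open>y \<in> {a<..<b}\<close> by (auto intro!: exI[of _ n])
  qed (use u_less in \<open>auto intro: le_less_trans\<close>)
  finally have "(\<lambda>n. ennreal (F (u n) - F a)) \<longlonglongrightarrow> emeasure (interval_measure F) {a<..<b}"
    using emeasure_interval_measure_Ioc[OF u_gt mono rc] by simp
  then show ?thesis
    using L by (rule LIMSEQ_unique)
qed

text \<open>The atom is the difference between the half-open and the open interval ending at
  \<open>b\<close>. The left limit \<open>l\<close> is a parameter because for dividends it is known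
  explicitly.\<close>

lemma emeasure_interval_measure_singleton:
  fixes F :: "real \<Rightarrow> real"
  assumes mono: "\<And>x y. x \<le> y \<Longrightarrow> F x \<le> F y"
    and rc: "\<And>a. continuous (at_right a) F" and lim: "(F \<longlongrightarrow> l) (at_left b)"
  shows "emeasure (interval_measure F) {b} = ennreal (F b - l)"
proof -
  let ?M = "interval_measure F"
  have Ioo: "emeasure ?M {b - 1<..<b} = ennreal (l - F (b - 1))"
    by (rule emeasure_interval_measure_Ioo[OF _ mono rc lim]) auto
  have Ioc: "emeasure ?M {b - 1<..b} = ennreal (F b - F (b - 1))"
    by (rule emeasure_interval_measure_Ioc[OF _ mono rc]) auto
  have "eventually (\<lambda>y. F (b - 1) \<le> F y) (at_left b)"
    using eventually_at_left_real[of "b - 1" b] by (auto elim!: eventually_mono intro!: mono)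
  then have "F (b - 1) \<le> l"
    by (intro tendsto_lowerbound[OF lim]) auto
  moreover have "emeasure ?M ({b - 1<..b} - {b - 1<..<b}) = emeasure ?M {b - 1<..b} - emeasure ?M {b - 1<..<b}"
    by (rule emeasure_Diff) (auto simp: Ioo)
  moreover have "{b - 1<..b} - {b - 1<..<b} = {b}"
    by auto
  ultimately show ?thesis
    by (simp add: Ioo Ioc ennreal_minus)
qed

text \<open>Discounting starts afresh at the beginning of the sojourn, so that the factor up to that
  time can be split off. The condition on \<open>x + c * s\<close> ignores payments: premium is paid
  out exactly while this unreduced surplus is at or above the barrier.\<close>

definition sojourn_dividends :: "real \<Rightarrow> real \<Rightarrow> real \<Rightarrow> real \<Rightarrow> real \<Rightarrow> ennreal" where
  "sojourn_dividends c \<delta> \<eta> x t = ennreal (max 0 (x - \<eta>)) +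
     (\<integral>\<^sup>+s. ennreal (c * exp (- \<delta> * s)) * indicator {s. 0 \<le> s \<and> s \<le> t \<and> \<eta> \<le> x + c * s} s \<partial>lborel)"

text \<open>The surplus at the start of a sojourn, frozen at ruin so that its sign records survival so far.\<close>

primrec killed_surplus ::
    "real \<Rightarrow> (nat \<Rightarrow> nat) \<Rightarrow> (nat \<Rightarrow> nat) \<Rightarrow> (nat \<Rightarrow> real) \<Rightarrow> (nat \<Rightarrow> real) \<Rightarrow>
     (nat \<Rightarrow> real) \<Rightarrow> real \<Rightarrow> nat \<Rightarrow> real" where
  "killed_surplus c Z K T Y b x 0 = x"
| "killed_surplus c Z K T Y b x (Suc n) =
     (if killed_surplus c Z K T Y b x n < 0 then killed_surplus c Z K T Y b x n
      else min (killed_surplus c Z K T Y b x n + c * T n) (b (Z n)) -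
           (if K n = 3 then Y (claims_among K n) else 0))"

section \<open>Deterministic paths cut into sojourns\<close>

lemma claims_among_Suc: "claims_among K (Suc n) = claims_among K n + (if K n = 3 then 1 else 0)"
proof -
  have "{m. m < Suc n \<and> K m = 3} = {m. m < n \<and> K m = 3} \<union> (if K n = 3 then {n} else {})"
    by (auto simp: less_Suc_eq)
  then show ?thesis
    by (auto simp: claims_among_def)
qed

lemma epoch_0 [simp]: "epoch T 0 = 0"
  by (simp add: epoch_def)

lemma epoch_Suc: "epoch T (Suc n) = epoch T n + T n"
  by (simp add: epoch_def)

text \<open>These properties hold for almost every outcome once the barriers are nonnegative.
  \<open>epoch_at_top\<close> excludes explosion, where \<open>transitions\<close> would carry no
  meaning.\<close>

locale barrier_path =
  fixes c \<delta> :: real and Z K :: "nat \<Rightarrow> nat" and T Y b :: "nat \<Rightarrow> real" and x :: real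
  assumes c_pos: "0 < c"
    and T_pos: "\<And>n. 0 < T n"
    and epoch_at_top: "filterlim (epoch T) at_top sequentially"
    and barrier_nonneg: "\<And>n. 0 \<le> b (Z n)"
begin

abbreviation "S \<equiv> epoch T"
abbreviation "A \<equiv> dividends_before c Z K T Y b x"
abbreviation "D \<equiv> dividends c Z K T Y b x"
abbreviation "R \<equiv> killed_surplus c Z K T Y b x"

text \<open>Taken just after transition \<open>n\<close>, before the lump sum due there; unlike
  \<open>R\<close> it keeps running after ruin.\<close>

definition start_surplus :: "nat \<Rightarrow> real" where
  "start_surplus n = x + c * S n - (\<Sum>k<claims_among K n. Y k) - A n"

text \<open>The formula for \<open>D\<close> during sojourn \<open>n\<close>, extended continuously
  to all times. At the right end of the sojourn it gives the left limit of \<open>D\<close>, which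
  is \<open>A (Suc n)\<close>.\<close>

definition paid :: "nat \<Rightarrow> real \<Rightarrow> real" where
  "paid n t = A n + max 0 (start_surplus n + c * (t - S n) - b (Z n))"

lemma epoch_less: "S n < S (Suc n)"
  using T_pos by (simp add: epoch_Suc)

lemma epoch_strict_mono: "strict_mono S"
  by (rule strict_mono_Suc_iff[THEN iffD2]) (simp add: epoch_less)

lemma epoch_mono: "m \<le> n \<Longrightarrow> S m \<le> S n"
  using epoch_strict_mono by (simp add: strict_mono_less_eq)

lemma epoch_nonneg: "0 \<le> S n"
  using epoch_mono[of 0 n] by simp

lemma sojourn_unique: "S n \<le> t \<Longrightarrow> t < S (Suc n) \<Longrightarrow> S m \<le> t \<longleftrightarrow> m \<le> n"
  using epoch_mono[of m n] epoch_mono[of "Suc n" m] by (cases "m \<le> n") auto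

lemma transitions_eq:
  assumes "S n \<le> t" "t < S (Suc n)"
  shows "transitions T t = n"
proof -
  have "{m. 1 \<le> m \<and> S m \<le> t} = {1..n}"
    by (auto simp: sojourn_unique[OF assms])
  then show ?thesis by (simp add: transitions_def)
qed

lemma sojourn_exists:
  assumes "0 \<le> t"
  obtains n where "S n \<le> t" "t < S (Suc n)"
proof -
  have "eventually (\<lambda>n. t < S n) sequentially"
    using epoch_at_top by (simp add: filterlim_at_top_dense)
  then have ex: "\<exists>n. t < S n"
    by (auto simp: eventually_sequentially)
  define m where "m = (LEAST n. t < S n)"
  have "t < S m" unfolding m_def using ex by (rule LeastI_ex)
  moreover from this assms have "m \<noteq> 0" by (intro notI) auto
  then obtain n where "m = Suc n" by (cases m) auto
  moreover have "\<not> t < S n"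
    using not_less_Least[of n "\<lambda>n. t < S n"] \<open>m = Suc n\<close> by (simp add: m_def)
  ultimately show ?thesis using that[of n] by auto
qed

lemma surplus_before_payment:
  "x + c * t - (\<Sum>k<claims_among K n. Y k) - A n = start_surplus n + c * (t - S n)"
  by (simp add: start_surplus_def right_diff_distrib)

lemma A_Suc: "A (Suc n) = paid n (S (Suc n))"
  by (simp only: dividends_before.simps surplus_before_payment paid_def)

lemma dividends_sojourn:
  assumes "S n \<le> t" "t < S (Suc n)"
  shows "D t = paid n t"
proof -
  have "\<not> t < 0" using epoch_nonneg[of n] assms by simp
  then show ?thesis
    by (simp only: dividends_def claim_count_def phase_at_def transitions_eq[OF assms]
        surplus_before_payment paid_def Let_def if_False)
qed

lemma surplus_sojourn:
  assumes "S n \<le> t" "t < S (Suc n)"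
  shows "surplus c K T Y D x t = min (start_surplus n + c * (t - S n)) (b (Z n))"
proof -
  have "surplus c K T Y D x t = start_surplus n + c * (t - S n) -
      max 0 (start_surplus n + c * (t - S n) - b (Z n))"
    unfolding surplus_def dividends_sojourn[OF assms] surplus_before_payment[symmetric] paid_def
      claim_count_def transitions_eq[OF assms] by linarith
  then show ?thesis by linarith
qed

lemma paid_mono: "s \<le> t \<Longrightarrow> paid n s \<le> paid n t"
  unfolding paid_def using c_pos by (intro add_left_mono max.mono order_refl diff_right_mono mult_left_mono) auto

lemma A_mono: "m \<le> n \<Longrightarrow> A m \<le> A n"
  by (rule lift_Suc_mono_le[of A]) auto

lemma A_le_dividends: "S n \<le> t \<Longrightarrow> t < S (Suc n) \<Longrightarrow> A n \<le> D t"
  by (simp add: dividends_sojourn[of n] paid_def)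

lemma dividends_neg: "t < 0 \<Longrightarrow> D t = 0"
  by (simp add: dividends_def)

lemma dividends_mono:
  assumes "s \<le> t"
  shows "D s \<le> D t"
proof (cases "t < 0")
  case True
  then show ?thesis using assms by (simp add: dividends_neg)
next
  case False
  then obtain n where n: "S n \<le> t" "t < S (Suc n)"
    using sojourn_exists[of t] by auto
  show ?thesis
  proof (cases "s < 0")
    case True
    then show ?thesis
      using A_mono[of 0 n] A_le_dividends[OF n] by (simp add: dividends_neg)
  next
    case False
    then obtain m where m: "S m \<le> s" "s < S (Suc m)"
      using sojourn_exists[of s] by auto
    have "m \<le> n"
      using sojourn_unique[OF n, of m] m assms by auto
    show ?thesis
    proof (cases "m = n")
      case True
      then show ?thesis using m n assms by (simp add: dividends_sojourn[of n] paid_mono)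
    next
      case False
      then have "A (Suc m) \<le> A n" using \<open>m \<le> n\<close> by (intro A_mono) auto
      then have "paid m (S (Suc m)) \<le> D t"
        using A_le_dividends[OF n] by (simp only: A_Suc)
      moreover have "D s \<le> paid m (S (Suc m))"
        using m by (simp add: dividends_sojourn[of m] paid_mono)
      ultimately show ?thesis by simp
    qed
  qed
qed

lemma paid_continuous: "(paid n \<longlongrightarrow> paid n t) (at t within X)"
  unfolding paid_def by (intro tendsto_intros)

lemma dividends_right_continuous: "continuous (at_right t) D"
proof (cases "t < 0")
  case True
  have "eventually (\<lambda>s. D t = D s) (at_right t)"
    using eventually_at_right_less[of t] order_tendstoD(2)[OF tendsto_ident_at True]
    by eventually_elim (use True in \<open>simp add: dividends_neg\<close>)
  then have "(D \<longlongrightarrow> D t) (at_right t)"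
    by (rule tendsto_cong[THEN iffD1]) (rule tendsto_const)
  then show ?thesis
    by (simp add: continuous_within)
next
  case False
  then obtain n where n: "S n \<le> t" "t < S (Suc n)"
    using sojourn_exists[of t] by auto
  have "eventually (\<lambda>s. paid n s = D s) (at_right t)"
    using eventually_at_right_less[of t] order_tendstoD(2)[OF tendsto_ident_at n(2)]
    by eventually_elim (use n in \<open>simp add: dividends_sojourn[of n]\<close>)
  then have "(D \<longlongrightarrow> paid n t) (at_right t)"
    by (rule tendsto_cong[THEN iffD1]) (rule paid_continuous)
  then show ?thesis
    using n by (simp add: continuous_within dividends_sojourn[of n])
qed

lemma dividends_left_limit:
  assumes "S n < t" "t \<le> S (Suc n)"
  shows "(D \<longlongrightarrow> paid n t) (at_left t)"
proof -
  have "eventually (\<lambda>s. paid n s = D s) (at_left t)"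
    using eventually_at_left_real[OF assms(1)]
    by eventually_elim (use assms in \<open>simp add: dividends_sojourn[of n]\<close>)
  then show ?thesis
    by (rule tendsto_cong[THEN iffD1]) (rule paid_continuous)
qed

lemma dividends_left_limit_epoch: "(D \<longlongrightarrow> A n) (at_left (S n))"
proof (cases n)
  case 0
  \<comment> \<open>\<open>D\<close> vanishes before time 0, so an initial lump sum is an atom like
    every later one.\<close>
  have "eventually (\<lambda>s. 0 = D s) (at_left (0::real))"
    using eventually_at_left_real[of "-1" 0] by (auto simp: dividends_neg elim!: eventually_mono)
  then have "(D \<longlongrightarrow> 0) (at_left (0::real))"
    by (rule tendsto_cong[THEN iffD1]) (rule tendsto_const)
  then show ?thesis
    using 0 by simp
next
  case (Suc m)
  then show ?thesis
    using dividends_left_limit[of m "S (Suc m)"] epoch_less A_Suc by simp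
qed

abbreviation "\<mu> \<equiv> interval_measure D"

lemma emeasure_epoch: "emeasure \<mu> {S n} = ennreal (max 0 (start_surplus n - b (Z n)))"
  using emeasure_interval_measure_singleton[OF dividends_mono dividends_right_continuous
      dividends_left_limit_epoch[of n]] epoch_less[of n]
  by (simp add: dividends_sojourn[of n] paid_def)

text \<open>Inside a sojourn \<open>D\<close> has no jumps and grows at rate \<open>c\<close> from
  the moment the barrier is met. Both measures are finite on right half-lines, which determine
  them.\<close>

lemma density_sojourn:
  defines "I \<equiv> \<lambda>n. {S n<..<S (Suc n)}"
  shows "density \<mu> (\<lambda>t. indicator (I n) t) =
    density lborel (\<lambda>t. ennreal c * indicator (I n \<inter> {t. b (Z n) \<le> start_surplus n + c * (t - S n)}) t)"
    (is "?L = ?R")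
proof (rule measure_eqI_lessThan)
  \<comment> \<open>The time at which the unreduced surplus meets the barrier; it may lie before,
    inside or after the sojourn, whence the cases below.\<close>
  let ?s = "S n + (b (Z n) - start_surplus n) / c"
  have I[measurable]: "I n \<in> sets borel" by (simp add: I_def)
  have L: "emeasure ?L {a<..} = emeasure \<mu> (I n \<inter> {a<..})" for a
    by (subst emeasure_density) (simp_all add: indicator_inter_arith[symmetric])
  have R: "emeasure ?R {a<..} = ennreal c * emeasure lborel (I n \<inter> {?s..} \<inter> {a<..})" for a
  proof -
    have *: "I n \<inter> {t. b (Z n) \<le> start_surplus n + c * (t - S n)} = I n \<inter> {?s..}"
      using c_pos by (auto simp: field_simps)
    have "emeasure ?R {a<..} = (\<integral>\<^sup>+t. ennreal c * indicator (I n \<inter> {?s..} \<inter> {a<..}) t \<partial>lborel)"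
      unfolding * by (subst emeasure_density)
        (auto simp: indicator_inter_arith mult.assoc intro!: nn_integral_cong)
    also have "\<dots> = ennreal c * emeasure lborel (I n \<inter> {?s..} \<inter> {a<..})"
      by (subst nn_integral_cmult_indicator) auto
    finally show ?thesis .
  qed
  have eq: "emeasure ?L {a<..} = emeasure ?R {a<..} \<and> emeasure ?L {a<..} < \<infinity>" for a
  proof (cases "max a (S n) < S (Suc n)")
    case False
    then have "I n \<inter> {a<..} = {}" by (auto simp: I_def)
    moreover from this have "I n \<inter> {?s..} \<inter> {a<..} = {}" by blast
    ultimately show ?thesis
      unfolding L R by simp
  next
    case True
    define a' where "a' = max a (S n)"
    have a': "S n \<le> a'" "a' < S (Suc n)" using True by (auto simp: a'_def)
    define f where "f t = start_surplus n + c * (t - S n) - b (Z n)" for t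
    have f_eq: "f t = c * (t - ?s)" for t
      using c_pos by (simp add: f_def field_simps)
    have f_le: "f t \<le> 0 \<longleftrightarrow> t \<le> ?s" for t
      unfolding f_eq using c_pos by (simp add: mult_le_0_iff)
    have "emeasure ?L {a<..} = emeasure \<mu> {a'<..<S (Suc n)}"
      unfolding L by (rule arg_cong2[where f=emeasure, OF refl]) (auto simp: I_def a'_def)
    also have "\<dots> = ennreal (A (Suc n) - D a')"
      by (rule emeasure_interval_measure_Ioo[OF a'(2) dividends_mono dividends_right_continuous
            dividends_left_limit_epoch])
    also have "A (Suc n) - D a' = max 0 (f (S (Suc n))) - max 0 (f a')"
      using a' by (simp only: A_Suc dividends_sojourn[of n]) (simp add: paid_def f_def)
    finally have l: "emeasure ?L {a<..} = ennreal (max 0 (f (S (Suc n))) - max 0 (f a'))" .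
    have r: "emeasure ?R {a<..} = ennreal c * emeasure lborel (if a' < ?s then {?s..<S (Suc n)} else {a'<..<S (Suc n)})"
    proof -
      have "{S n<..<S (Suc n)} \<inter> {s..} \<inter> {a<..} = (if a' < s then {s..<S (Suc n)} else {a'<..<S (Suc n)})" for s
        by (auto simp: a'_def)
      then show ?thesis unfolding R by (simp add: I_def)
    qed
    have "ennreal (max 0 (f (S (Suc n))) - max 0 (f a')) = emeasure ?R {a<..}"
    proof (cases "a' < ?s")
      case as: True
      then have "f a' \<le> 0" unfolding f_le by simp
      show ?thesis
      proof (cases "?s \<le> S (Suc n)")
        case True
        then have "max 0 (f (S (Suc n))) = c * (S (Suc n) - ?s)"
          unfolding f_eq using c_pos by (intro max_absorb2) simp
        moreover have "emeasure lborel {?s..<S (Suc n)} = ennreal (S (Suc n) - ?s)"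
          using True by (rule emeasure_lborel_Ico)
        ultimately show ?thesis
          unfolding r using as \<open>f a' \<le> 0\<close> c_pos True
          by (simp add: ennreal_mult[symmetric] max_absorb1)
      next
        case False
        then have "f (S (Suc n)) \<le> 0" unfolding f_le by simp
        then show ?thesis
          unfolding r using as \<open>f a' \<le> 0\<close> False by (simp add: max_absorb1)
      qed
    next
      case as: False
      then have "0 \<le> f a'" "0 \<le> f (S (Suc n))"
        unfolding f_eq using c_pos a' by simp_all
      then have "max 0 (f (S (Suc n))) - max 0 (f a') = c * (S (Suc n) - a')"
        by (simp add: max_absorb2 f_eq right_diff_distrib)
      moreover have "emeasure lborel {a'<..<S (Suc n)} = ennreal (S (Suc n) - a')"
        using a' by (intro emeasure_lborel_Ioo) simp
      ultimately show ?thesis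
        unfolding r using as a' c_pos by (simp add: ennreal_mult[symmetric])
    qed
    then have "emeasure ?L {a<..} = emeasure ?R {a<..}"
      by (simp only: l)
    moreover have "emeasure ?L {a<..} < \<infinity>"
      unfolding l by simp
    ultimately show ?thesis ..
  qed
  show "emeasure ?L {a<..} < \<infinity>" "emeasure ?L {a<..} = emeasure ?R {a<..}" for a
    by (rule conjunct2[OF eq]) (rule conjunct1[OF eq])
qed simp_all

text \<open>The atom at \<open>S n\<close> is the lump sum, the density on the open interval is the
  premium, and a time shift by \<open>S n\<close> pulls out the discount factor.\<close>

lemma nn_integral_sojourn:
  "(\<integral>\<^sup>+t. ennreal (exp (- \<delta> * t)) * indicator {S n..<S (Suc n)} t \<partial>\<mu>) =
    ennreal (exp (- \<delta> * S n)) * sojourn_dividends c \<delta> (b (Z n)) (start_surplus n) (T n)"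
proof -
  let ?e = "\<lambda>t. ennreal (exp (- \<delta> * t))" and ?I = "{S n<..<S (Suc n)}"
  let ?B = "{t. b (Z n) \<le> start_surplus n + c * (t - S n)}"
  have B[measurable]: "?B \<in> sets borel" by measurable
  have "(\<integral>\<^sup>+t. ?e t * indicator {S n..<S (Suc n)} t \<partial>\<mu>) =
      (\<integral>\<^sup>+t. ?e t * indicator {S n} t + ?e t * indicator ?I t \<partial>\<mu>)"
    using epoch_less[of n] by (intro nn_integral_cong) (auto split: split_indicator)
  also have "\<dots> = (\<integral>\<^sup>+t. ?e t * indicator {S n} t \<partial>\<mu>) + (\<integral>\<^sup>+t. ?e t * indicator ?I t \<partial>\<mu>)"
    by (rule nn_integral_add) auto
  also have "(\<integral>\<^sup>+t. ?e t * indicator {S n} t \<partial>\<mu>) = ?e (S n) * ennreal (max 0 (start_surplus n - b (Z n)))"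
    by (subst nn_integral_indicator_singleton) (auto simp: emeasure_epoch)
  also have "(\<integral>\<^sup>+t. ?e t * indicator ?I t \<partial>\<mu>) = (\<integral>\<^sup>+t. ?e t \<partial>density \<mu> (\<lambda>t. indicator ?I t))"
    by (subst nn_integral_density) (auto simp: mult.commute)
  also have "\<dots> = (\<integral>\<^sup>+t. ennreal c * indicator (?I \<inter> ?B) t * ?e t \<partial>lborel)"
    unfolding density_sojourn by (subst nn_integral_density) auto
  also have "\<dots> = (\<integral>\<^sup>+s. ennreal c * indicator (?I \<inter> ?B) (S n + 1 * s) * ?e (S n + 1 * s) \<partial>lborel)"
    by (subst nn_integral_real_affine[where c=1 and t="S n"]) auto
  also have "\<dots> = (\<integral>\<^sup>+s. ?e (S n) * (ennreal (c * exp (- \<delta> * s)) *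
      indicator {s. 0 \<le> s \<and> s \<le> T n \<and> b (Z n) \<le> start_surplus n + c * s} s) \<partial>lborel)"
    (is "nn_integral _ ?lhs = nn_integral _ ?rhs")
  proof (rule nn_integral_cong_AE)
    show "AE s in lborel. ?lhs s = ?rhs s"
      using AE_lborel_singleton[of 0] AE_lborel_singleton[of "T n"]
    proof eventually_elim
      case (elim s)
      have "(S n + 1 * s \<in> ?I \<inter> ?B) = (s \<in> {s. 0 \<le> s \<and> s \<le> T n \<and> b (Z n) \<le> start_surplus n + c * s})"
        using elim by (auto simp: epoch_Suc)
      moreover have "ennreal c * ?e (S n + 1 * s) = ?e (S n) * ennreal (c * exp (- \<delta> * s))"
        using c_pos by (simp add: ennreal_mult[symmetric] exp_add distrib_left)
          (simp add: mult.commute exp_add[symmetric] algebra_simps)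
      ultimately show ?case
        by (simp add: indicator_def)
    qed
  qed
  also have "\<dots> = ?e (S n) * (\<integral>\<^sup>+s. ennreal (c * exp (- \<delta> * s)) *
      indicator {s. 0 \<le> s \<and> s \<le> T n \<and> b (Z n) \<le> start_surplus n + c * s} s \<partial>lborel)"
    by (rule nn_integral_cmult) measurable
  finally show ?thesis
    by (simp add: sojourn_dividends_def distrib_left)
qed

text \<open>Between transitions the surplus only rises or rests at a nonnegative barrier, so a
  negative surplus must show up at the start of a sojourn.\<close>

lemma before_ruin_iff:
  assumes "S n \<le> t" "t < S (Suc n)"
  shows "ereal t < ruin_time c K T Y D x \<longleftrightarrow> (\<forall>m\<le>n. 0 \<le> start_surplus m)"
proof
  assume less: "ereal t < ruin_time c K T Y D x"
  show "\<forall>m\<le>n. 0 \<le> start_surplus m"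
  proof (intro allI impI, rule ccontr)
    fix m assume m: "m \<le> n" "\<not> 0 \<le> start_surplus m"
    have "surplus c K T Y D x (S m) < 0"
      using surplus_sojourn[of m "S m"] epoch_less[of m] m by simp
    then have "ruin_time c K T Y D x \<le> ereal (S m)"
      unfolding ruin_time_def using epoch_nonneg[of m] by (intro Inf_lower) auto
    also have "\<dots> \<le> ereal t"
      using epoch_mono[OF m(1)] assms by simp
    finally show False using less by simp
  qed
next
  assume alive: "\<forall>m\<le>n. 0 \<le> start_surplus m"
  have "ereal (S (Suc n)) \<le> ruin_time c K T Y D x"
    unfolding ruin_time_def
  proof (rule Inf_greatest, safe)
    fix u assume u: "0 \<le> u" "surplus c K T Y D x u < 0"
    obtain k where k: "S k \<le> u" "u < S (Suc k)"
      using sojourn_exists[OF u(1)] by auto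
    have "0 \<le> c * (u - S k)" using c_pos k by simp
    then have "start_surplus k < 0"
      using u(2) barrier_nonneg[of k] unfolding surplus_sojourn[OF k] by (auto simp: min_def split: if_splits)
    then have "Suc n \<le> k" using alive by (meson leI not_less not_less_eq_eq)
    then show "ereal (S (Suc n)) \<le> ereal u"
      using epoch_mono[of "Suc n" k] k by simp
  qed
  then show "ereal t < ruin_time c K T Y D x"
    by (rule less_le_trans[rotated]) (simp add: assms)
qed

lemma start_surplus_Suc:
  "start_surplus (Suc n) = min (start_surplus n + c * T n) (b (Z n)) - (if K n = 3 then Y (claims_among K n) else 0)"
  by (auto simp: start_surplus_def claims_among_Suc epoch_Suc algebra_simps min_def max_def)

text \<open>\<open>start_surplus\<close> may recover after ruin, while \<open>R\<close> is frozen.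
  Freezing turns survival through all earlier transitions into a condition on one number, so that
  phase and surplus alone can form a Markov chain.\<close>

lemma killed_surplus_iff: "0 \<le> R n \<longleftrightarrow> (\<forall>m\<le>n. 0 \<le> start_surplus m)"
  and killed_surplus_eq: "0 \<le> R n \<Longrightarrow> R n = start_surplus n"
proof -
  have "(0 \<le> R n \<longleftrightarrow> (\<forall>m\<le>n. 0 \<le> start_surplus m)) \<and> (0 \<le> R n \<longrightarrow> R n = start_surplus n)"
  proof (induction n)
    case 0
    then show ?case by (simp add: start_surplus_def claims_among_def)
  next
    case (Suc n)
    then show ?case
      unfolding start_surplus_Suc all_simps
      by (cases "0 \<le> R n") (auto simp: le_Suc_eq start_surplus_Suc)
  qed
  then show "0 \<le> R n \<longleftrightarrow> (\<forall>m\<le>n. 0 \<le> start_surplus m)" "0 \<le> R n \<Longrightarrow> R n = start_surplus n"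
    by auto
qed

text \<open>The sojourns partition the half-line because there is no explosion, and by
  \<open>before_ruin_iff\<close> each lies before ruin either entirely or not at all.\<close>

theorem discounted_dividends_eq_suminf:
  "discounted_dividends c \<delta> K T Y D x =
    (\<Sum>n. ennreal (exp (- \<delta> * S n)) * (if 0 \<le> R n then sojourn_dividends c \<delta> (b (Z n)) (R n) (T n) else 0))"
proof -
  let ?e = "\<lambda>t. ennreal (exp (- \<delta> * t))"
  let ?f = "\<lambda>n t. if 0 \<le> R n then ?e t * indicator {S n..<S (Suc n)} t else 0"
  have *: "?e t * indicator {t. 0 \<le> t \<and> ereal t < ruin_time c K T Y D x} t = (\<Sum>n. ?f n t)" for t
  proof (cases "0 \<le> t")
    case False
    then have "?f n t = 0" for n using epoch_nonneg[of n] by (auto simp: indicator_def)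
    then show ?thesis using False by simp
  next
    case True
    then obtain n where n: "S n \<le> t" "t < S (Suc n)"
      using sojourn_exists by auto
    have "?f m t = 0" if "m \<noteq> n" for m
      using that sojourn_unique[OF n, of m] sojourn_unique[OF n, of "Suc m"] by (auto simp: indicator_def)
    then have "(\<Sum>m. ?f m t) = (\<Sum>m\<in>{n}. ?f m t)"
      by (intro suminf_finite) auto
    then show ?thesis
      using True n before_ruin_iff[OF n] killed_surplus_iff[of n] by (simp add: indicator_def)
  qed
  have "discounted_dividends c \<delta> K T Y D x = (\<integral>\<^sup>+t. (\<Sum>n. ?f n t) \<partial>\<mu>)"
    unfolding discounted_dividends_def by (intro nn_integral_cong *)
  also have "\<dots> = (\<Sum>n. \<integral>\<^sup>+t. ?f n t \<partial>\<mu>)"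
    by (rule nn_integral_suminf) simp
  also have "\<dots> = (\<Sum>n. ?e (S n) * (if 0 \<le> R n then sojourn_dividends c \<delta> (b (Z n)) (R n) (T n) else 0))"
    by (intro suminf_cong) (use nn_integral_sojourn killed_surplus_eq in auto)
  finally show ?thesis .
qed

end

section \<open>The law of the jump chain\<close>

text \<open>For fixed \<open>A\<close> both sides are finite measures in the second coordinate that
  agree on right half-lines. Tail probabilities are exactly what \<open>path_law\<close>
  supplies.\<close>

lemma pair_measure_eqI_greaterThan:
  fixes M2 :: "real measure"
  assumes "finite_measure M1" "finite_measure M2" and sets2: "sets M2 = sets borel"
    and sets: "sets N = sets (M1 \<Otimes>\<^sub>M M2)" and a: "a < \<top>"
    and eq: "\<And>A u. A \<in> sets M1 \<Longrightarrow> emeasure N (A \<times> {u<..}) = a * (emeasure M1 A * emeasure M2 {u<..})"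
  shows "N = scale_measure a (M1 \<Otimes>\<^sub>M M2)"
proof -
  interpret M1: finite_measure M1 by fact
  interpret M2: finite_measure M2 by fact
  have space2: "space M2 = UNIV"
    using sets_eq_imp_space_eq[OF sets2] by simp
  note [measurable_cong] = sets sets2
  have eq': "emeasure N (A \<times> B) = a * (emeasure M1 A * emeasure M2 B)"
    if [measurable]: "A \<in> sets M1" and B: "B \<in> sets borel" for A B
  proof -
    \<comment> \<open>The second marginal of \<open>N\<close> after restricting the first coordinate
      to \<open>A\<close>.\<close>
    let ?N = "distr (density N (indicator (A \<times> UNIV))) borel snd"
    have N: "emeasure ?N B = emeasure N (A \<times> B)" if [measurable]: "B \<in> sets borel" for B
    proof -
      have *: "A \<times> B \<in> sets N" "A \<times> UNIV \<in> sets N" "snd -` B \<inter> space N \<in> sets N"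
        using space2 sets.top[of M2] by measurable
      have "emeasure ?N B = emeasure (density N (indicator (A \<times> UNIV))) (snd -` B \<inter> space N)"
        by (subst emeasure_distr) auto
      also have "\<dots> = (\<integral>\<^sup>+x. indicator (A \<times> UNIV) x * indicator (snd -` B \<inter> space N) x \<partial>N)"
        using * by (intro emeasure_density) auto
      also have "\<dots> = (\<integral>\<^sup>+x. indicator (A \<times> B) x \<partial>N)"
        by (rule nn_integral_cong) (auto split: split_indicator)
      finally show ?thesis using * by simp
    qed
    have "?N = scale_measure (a * emeasure M1 A) M2"
    proof (rule measure_eqI_lessThan)
      show "emeasure ?N {u<..} = emeasure (scale_measure (a * emeasure M1 A) M2) {u<..}" for u
        by (simp add: N eq mult.assoc)
      show "emeasure ?N {u<..} < \<infinity>" for u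
        using a by (simp add: N eq ennreal_mult_eq_top_iff less_top[symmetric])
    qed (simp_all add: sets2)
    then show ?thesis
      using N[OF B] by (simp add: mult.assoc)
  qed
  \<comment> \<open>The constant is absorbed into the first factor so that uniqueness of product
    measures applies.\<close>
  have "finite_measure (scale_measure a M1)"
    using a by (intro finite_measureI) (simp add: ennreal_mult_eq_top_iff less_top[symmetric] top_unique)
  then have scaled: "scale_measure a M1 \<Otimes>\<^sub>M M2 = N'" if "sets N' = sets (M1 \<Otimes>\<^sub>M M2)"
    "\<And>A B. A \<in> sets M1 \<Longrightarrow> B \<in> sets M2 \<Longrightarrow> emeasure N' (A \<times> B) = a * (emeasure M1 A * emeasure M2 B)" for N'
    using that by (intro pair_measure_eqI)
      (auto simp: finite_measure_def M2.sigma_finite_measure_axioms mult.assoc cong: sets_pair_measure_cong)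
  have "N = scale_measure a M1 \<Otimes>\<^sub>M M2"
    by (rule scaled[symmetric]) (auto simp: sets sets2 eq')
  also have "\<dots> = scale_measure a (M1 \<Otimes>\<^sub>M M2)"
    by (rule scaled) (auto simp: M2.emeasure_pair_measure_Times)
  finally show ?thesis .
qed

declare One_nat_def [simp del]

section \<open>Transition probabilities and almost sure regularity of the chain\<close>

context phase_type_risk_model
begin

text \<open>The entered state \<open>k\<close> is kept beside the next phase \<open>j\<close>, since
  the same \<open>j\<close> can follow a direct move or a claim.\<close>

definition step_prob :: "nat \<Rightarrow> nat \<Rightarrow> nat \<Rightarrow> real" where
  "step_prob z k j = jump_prob lam z k * restart_prob \<pi> k j"

lemma jump_prob_nonneg: "z \<in> {1,2} \<Longrightarrow> k \<in> {1,2,3} \<Longrightarrow> 0 \<le> jump_prob lam z k"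
  using intensity_nonneg[of z k] total_intensity_pos[of z] by (auto simp: jump_prob_def)

lemma restart_prob_nonneg: "j \<in> {1,2} \<Longrightarrow> 0 \<le> restart_prob \<pi> k j"
  using restart_nonneg by (auto simp: restart_prob_def)

lemma step_prob_nonneg: "z \<in> {1,2} \<Longrightarrow> k \<in> {1,2,3} \<Longrightarrow> j \<in> {1,2} \<Longrightarrow> 0 \<le> step_prob z k j"
  using jump_prob_nonneg restart_prob_nonneg by (simp add: step_prob_def)

lemma sum_restart_prob: "k \<in> {1,2,3} \<Longrightarrow> (\<Sum>j\<in>{1,2}. restart_prob \<pi> k j) = 1"
  using restart_sum by (auto simp: restart_prob_def)

lemma total_intensity_1: "total_intensity lam 1 = lam 1 2 + lam 1 3"
  and total_intensity_2: "total_intensity lam 2 = lam 2 1 + lam 2 3"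
proof -
  have *: "{1,2,3} - {1} = {2,3::nat}" "{1,2,3} - {2} = {1,3::nat}" by auto
  show "total_intensity lam 1 = lam 1 2 + lam 1 3" "total_intensity lam 2 = lam 2 1 + lam 2 3"
    unfolding total_intensity_def * by simp_all
qed

lemma sum_jump_prob:
  assumes "z \<in> {1,2}"
  shows "(\<Sum>k\<in>{1,2,3}. jump_prob lam z k) = 1"
proof -
  consider "z = 1" | "z = 2" using assms by auto
  then show ?thesis
  proof cases
    case 1
    have "lam 1 2 / total_intensity lam 1 + lam 1 3 / total_intensity lam 1 = 1"
      using total_intensity_pos[of 1] by (simp add: total_intensity_1 add_divide_distrib[symmetric])
    then show ?thesis using 1 by (simp add: jump_prob_def)
  next
    case 2
    have "lam 2 1 / total_intensity lam 2 + lam 2 3 / total_intensity lam 2 = 1"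
      using total_intensity_pos[of 2] by (simp add: total_intensity_2 add_divide_distrib[symmetric])
    then show ?thesis using 2 by (simp add: jump_prob_def)
  qed
qed

lemma sum_step_prob: "z \<in> {1,2} \<Longrightarrow> (\<Sum>k\<in>{1,2,3}. \<Sum>j\<in>{1,2}. step_prob z k j) = 1"
proof -
  assume z: "z \<in> {1,2}"
  have "(\<Sum>k\<in>{1,2,3}. \<Sum>j\<in>{1,2}. step_prob z k j) = (\<Sum>k\<in>{1,2,3}. jump_prob lam z k * 1)"
    unfolding step_prob_def sum_distrib_left[symmetric]
    by (rule sum.cong[OF refl]) (simp only: sum_restart_prob)
  then show ?thesis using sum_jump_prob[OF z] by simp
qed

declare Z_measurable[measurable] K_measurable[measurable] T_measurable[measurable]

lemma Y_measurable [measurable]: "Y n \<in> borel_measurable M"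
  using claim_distr[of n] by (simp add: distributed_def)

definition cylinder :: "nat \<Rightarrow> (nat \<Rightarrow> nat) \<Rightarrow> (nat \<Rightarrow> nat) \<Rightarrow> (nat \<Rightarrow> real) \<Rightarrow> 'a set" where
  "cylinder n z k t = {\<omega> \<in> space M. Z 0 \<omega> = z 0 \<and>
     (\<forall>m<n. T m \<omega> > t m \<and> K m \<omega> = k m \<and> Z (Suc m) \<omega> = z (Suc m))}"

lemma cylinder_sets [measurable]: "cylinder n z k t \<in> sets M"
  unfolding cylinder_def by measurable

lemma prob_cylinder:
  assumes "\<And>m. m \<le> n \<Longrightarrow> z m \<in> {1,2}" "\<And>m. m < n \<Longrightarrow> k m \<in> {1,2,3}" "\<And>m. m < n \<Longrightarrow> 0 \<le> t m"
  shows "prob (cylinder n z k t) = prob {\<omega> \<in> space M. Z 0 \<omega> = z 0} *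
    (\<Prod>m<n. exp (- total_intensity lam (z m) * t m) * step_prob (z m) (k m) (z (Suc m)))"
  unfolding cylinder_def step_prob_def using path_law[of n z k t, OF assms] by (simp add: mult.assoc)

text \<open>The six refinements of the cylinder by \<open>K n\<close> and \<open>Z (Suc n)\<close>,
  with threshold 0, have probabilities that add up to that of the cylinder, so the rest of it is
  null.\<close>

lemma AE_cylinder_step:
  assumes z: "\<And>m. m \<le> n \<Longrightarrow> z m \<in> {1,2}" and k: "\<And>m. m < n \<Longrightarrow> k m \<in> {1,2,3}"
  shows "AE \<omega> in M. \<omega> \<in> cylinder n z k (\<lambda>_. 0) \<longrightarrow> 0 < T n \<omega> \<and> K n \<omega> \<in> {1,2,3} \<and> Z (Suc n) \<omega> \<in> {1,2}"
proof -
  let ?C = "cylinder n z k (\<lambda>_. 0)"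
  define B where "B = (\<lambda>(k', j). cylinder (Suc n) (z(Suc n := j)) (k(n := k')) (\<lambda>_. 0))"
  let ?I = "{1,2,3} \<times> {1,2::nat} :: (nat \<times> nat) set"
  have B_eq: "B (k', j) = {\<omega> \<in> ?C. 0 < T n \<omega> \<and> K n \<omega> = k' \<and> Z (Suc n) \<omega> = j}" for k' j
    by (auto simp: B_def cylinder_def less_Suc_eq)
  have [measurable]: "B p \<in> sets M" for p
    by (cases p) (simp add: B_def)
  have "prob (B (k', j)) = prob ?C * step_prob (z n) k' j" if "k' \<in> {1,2,3}" "j \<in> {1,2}" for k' j
  proof -
    have "prob (B (k', j)) = prob {\<omega> \<in> space M. Z 0 \<omega> = z 0} *
      (\<Prod>m<Suc n. step_prob ((z(Suc n := j)) m) ((k(n := k')) m) ((z(Suc n := j)) (Suc m)))"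
      unfolding B_def prod.case using that z k by (subst prob_cylinder) auto
    also have "(\<Prod>m<Suc n. step_prob ((z(Suc n := j)) m) ((k(n := k')) m) ((z(Suc n := j)) (Suc m))) =
      (\<Prod>m<n. step_prob (z m) (k m) (z (Suc m))) * step_prob (z n) k' j"
      by simp
    finally show ?thesis
      using prob_cylinder[of n z k "\<lambda>_. 0"] z k by simp
  qed
  then have "(\<Sum>p\<in>?I. prob (B p)) = prob ?C * (\<Sum>k\<in>{1,2,3}. \<Sum>j\<in>{1,2}. step_prob (z n) k j)"
    unfolding sum_distrib_left sum.cartesian_product by (intro sum.cong) auto
  also have "\<dots> = prob ?C"
    using sum_step_prob[OF z[of n]] by simp
  finally have "prob (\<Union>p\<in>?I. B p) = prob ?C"
    by (subst finite_measure_finite_Union) (auto simp: disjoint_family_on_def B_eq)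
  moreover have sub: "(\<Union>p\<in>?I. B p) \<subseteq> ?C"
    by (auto simp: B_eq)
  ultimately have "prob (?C - (\<Union>p\<in>?I. B p)) = 0"
    by (subst finite_measure_Diff) auto
  then have "AE \<omega> in M. \<omega> \<notin> ?C - (\<Union>p\<in>?I. B p)"
    by (intro AE_not_in) (auto simp: null_sets_def emeasure_eq_measure)
  then show ?thesis
    by eventually_elim (auto simp: B_eq)
qed

text \<open>The model states only probabilities of regular histories; that irregular ones are null
  follows from total mass, one transition at a time.\<close>

lemma AE_regular: "AE \<omega> in M. \<forall>n. Z n \<omega> \<in> {1,2} \<and> K n \<omega> \<in> {1,2,3} \<and> 0 < T n \<omega>"
proof -
  have "AE \<omega> in M. Z 0 \<omega> \<in> {1,2} \<and> (\<forall>m<n. 0 < T m \<omega> \<and> K m \<omega> \<in> {1,2,3} \<and> Z (Suc m) \<omega> \<in> {1,2})" for n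
  proof (induction n)
    case 0
    then show ?case using initial_phase by (auto intro!: AE_I2)
  next
    case (Suc n)
    \<comment> \<open>Restricting histories to the indices in use makes them a finite set.\<close>
    let ?I = "({..n} \<rightarrow>\<^sub>E {1,2::nat}) \<times> ({..<n} \<rightarrow>\<^sub>E {1,2,3::nat})"
    have "AE \<omega> in M. \<forall>(z, k)\<in>?I. \<omega> \<in> cylinder n z k (\<lambda>_. 0) \<longrightarrow>
        0 < T n \<omega> \<and> K n \<omega> \<in> {1,2,3} \<and> Z (Suc n) \<omega> \<in> {1,2}"
      unfolding case_prod_beta
      by (intro AE_finite_allI finite_cartesian_product finite_PiE AE_cylinder_step) (auto simp: PiE_iff)
    with Suc AE_space show ?case
    proof eventually_elim
      case (elim \<omega>)
      let ?z = "restrict (\<lambda>m. Z m \<omega>) {..n}" and ?k = "restrict (\<lambda>m. K m \<omega>) {..<n}"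
      have "Z m \<omega> \<in> {1,2}" if "m \<le> n" for m
        using elim(1) that by (cases m) auto
      then have "(?z, ?k) \<in> ?I" using elim(1) by auto
      then have "\<omega> \<in> cylinder n ?z ?k (\<lambda>_. 0) \<longrightarrow>
        0 < T n \<omega> \<and> K n \<omega> \<in> {1,2,3} \<and> Z (Suc n) \<omega> \<in> {1,2}"
        using elim(3) by blast
      moreover have "\<omega> \<in> cylinder n ?z ?k (\<lambda>_. 0)"
        using elim(1,2) by (auto simp: cylinder_def)
      ultimately show ?case
        using elim(1) by (auto simp: less_Suc_eq)
    qed
  qed
  then have "AE \<omega> in M. \<forall>n. Z 0 \<omega> \<in> {1,2} \<and> (\<forall>m<n. 0 < T m \<omega> \<and> K m \<omega> \<in> {1,2,3} \<and> Z (Suc m) \<omega> \<in> {1,2})"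
    by (simp add: AE_all_countable)
  then show ?thesis
  proof eventually_elim
    case (elim \<omega>)
    then show ?case by (metis lessI not0_implies_Suc)
  qed
qed

end

section \<open>Independence of claim sizes and path\<close>

lemma claims_among_cong: "(\<And>l. l < m \<Longrightarrow> K l = K' l) \<Longrightarrow> claims_among K m = claims_among K' m"
  unfolding claims_among_def by (intro arg_cong[where f=card]) auto

text \<open>Different claim transitions use different entries of \<open>Y\<close>, so independence
  of \<open>Y\<close> applies to the claims along a fixed history.\<close>

lemma inj_on_claims_among: "inj_on (claims_among K) {m. K m = 3}"
proof (rule linorder_inj_onI)
  fix m n assume "m < n" "m \<in> {m. K m = 3}"
  have "claims_among K m < claims_among K (Suc m)"
    using \<open>m \<in> _\<close> by (simp add: claims_among_Suc)
  also have "\<dots> \<le> claims_among K n"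
    by (rule lift_Suc_mono_le[of "claims_among K" "Suc m" n]) (use \<open>m < n\<close> in \<open>simp_all add: claims_among_Suc\<close>)
  finally show "claims_among K m \<noteq> claims_among K n" by simp
qed auto

lemma emeasure_exponential_greaterThan:
  assumes "0 < l"
  shows "emeasure (density lborel (exponential_density l)) {t<..} = ennreal (exp (- l * max 0 t))"
proof -
  let ?N = "density lborel (exponential_density l)"
  interpret N: prob_space ?N
    using assms by (rule prob_space_exponential_density)
  have D: "distributed ?N lborel (\<lambda>x. x) (exponential_density l)"
    by (auto simp: distributed_def distr_id2 intro!: distr_id2)
  have pos: "N.prob {t<..} = exp (- l * t)" if "0 \<le> t" for t
    using N.exponential_distributedD_gt[OF D that assms] by (simp add: greaterThan_def mult.commute)
  have "N.prob {t<..} = exp (- l * max 0 t)"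
  proof (cases "0 \<le> t")
    case False
    then have "N.prob {0<..} \<le> N.prob {t<..}"
      by (intro N.finite_measure_mono) auto
    then show ?thesis
      using pos[of 0] False N.prob_le_1[of "{t<..}"] by simp
  qed (simp add: pos)
  then show ?thesis
    by (simp add: N.emeasure_eq_measure)
qed

context phase_type_risk_model
begin

definition sojourn_law :: "nat \<Rightarrow> real measure" where
  "sojourn_law z = density lborel (exponential_density (total_intensity lam z))"

text \<open>A transition without claim gets a claim of size 0, so that all transitions have the same
  form in the Markov property.\<close>

definition claim_law :: "nat \<Rightarrow> real measure" where
  "claim_law k = (if k = 3 then density lborel (exponential_density \<beta>) else return borel 0)"

definition claim_after :: "nat \<Rightarrow> 'a \<Rightarrow> real" where
  "claim_after n \<omega> = (if K n \<omega> = 3 then Y (claims_among (\<lambda>m. K m \<omega>) n) \<omega> else 0)"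

lemma sets_sojourn_law [simp, measurable_cong]: "sets (sojourn_law z) = sets borel"
  by (simp add: sojourn_law_def)

lemma sets_claim_law [simp, measurable_cong]: "sets (claim_law k) = sets borel"
  by (simp add: claim_law_def)

lemma space_sojourn_law [simp]: "space (sojourn_law z) = UNIV"
  by (simp add: sojourn_law_def)

lemma space_claim_law [simp]: "space (claim_law k) = UNIV"
  by (simp add: claim_law_def)

lemma prob_space_sojourn_law: "z \<in> {1,2} \<Longrightarrow> prob_space (sojourn_law z)"
  unfolding sojourn_law_def by (intro prob_space_exponential_density total_intensity_pos)

lemma prob_space_claim_law: "prob_space (claim_law k)"
  unfolding claim_law_def using \<beta>_pos by (auto intro: prob_space_exponential_density prob_space_return)

lemma claims_among_measurable [measurable]:
  "(\<lambda>\<omega>. claims_among (\<lambda>m. K m \<omega>) n) \<in> measurable M (count_space UNIV)"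
proof (induction n)
  case 0
  show ?case by (simp add: claims_among_def)
next
  case (Suc n)
  note [measurable] = Suc
  show ?case unfolding claims_among_Suc by measurable
qed

lemma claim_after_measurable [measurable]: "claim_after n \<in> borel_measurable M"
proof -
  have [measurable]: "(\<lambda>\<omega>. Y (claims_among (\<lambda>m. K m \<omega>) n) \<omega>) \<in> borel_measurable M"
    by (rule measurable_compose_countable[OF Y_measurable claims_among_measurable])
  show ?thesis unfolding claim_after_def[abs_def] by measurable
qed

definition step_weight :: "(nat \<Rightarrow> nat) \<Rightarrow> (nat \<Rightarrow> nat) \<Rightarrow> (nat \<Rightarrow> real) \<Rightarrow> (nat \<Rightarrow> real) \<Rightarrow> nat \<Rightarrow> ennreal" where
  "step_weight z k t y m = ennreal (step_prob (z m) (k m) (z (Suc m))) *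
     (emeasure (sojourn_law (z m)) {t m<..} * emeasure (claim_law (k m)) {y m<..})"

text \<open>Once the history \<open>k\<close> is fixed, the claim indices are deterministic and
  distinct, and independence of \<open>Y\<close> gives the product.\<close>

lemma prob_claims:
  "emeasure M {\<omega> \<in> space M. \<forall>m<N. y m < (if k m = 3 then Y (claims_among k m) \<omega> else 0)} =
    (\<Prod>m<N. emeasure (claim_law (k m)) {y m<..})" (is "emeasure M ?E = _")
\<comment> \<open>A nonnegative threshold at a transition without claim makes both sides 0;
  otherwise such transitions contribute the factor 1 and only \<open>I\<close> remains.\<close>
proof (cases "\<exists>m<N. k m \<noteq> 3 \<and> 0 \<le> y m")
  case True
  then obtain m where m: "m < N" "k m \<noteq> 3" "0 \<le> y m" by auto
  then have "?E = {}" by fastforce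
  moreover have "emeasure (claim_law (k m)) {y m<..} = 0"
    using m by (simp add: claim_law_def)
  then have "(\<Prod>m<N. emeasure (claim_law (k m)) {y m<..}) = 0"
    using m by (intro prod_zero) auto
  ultimately show ?thesis by (simp only: emeasure_empty)
next
  case False
  define I where "I = {m. m < N \<and> k m = 3}"
  have Y: "emeasure M (Y n -` {u<..} \<inter> space M) = emeasure (claim_law 3) {u<..}" for n u
    using distributed_distr_eq_density[OF claim_distr[of n]]
    by (subst emeasure_distr[symmetric, where N=lborel]) (auto simp: claim_law_def)
  have "(\<Prod>m<N. emeasure (claim_law (k m)) {y m<..}) = (\<Prod>m\<in>I. emeasure (claim_law (k m)) {y m<..})"
    using False by (intro prod.mono_neutral_right) (auto simp: I_def claim_law_def not_le)
  also have "\<dots> = (\<Prod>m\<in>I. emeasure M (Y (claims_among k m) -` {y m<..} \<inter> space M))"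
    by (intro prod.cong) (auto simp: Y I_def)
  also have "\<dots> = emeasure M ?E"
  proof (cases "I = {}")
    case True
    then have "?E = space M" using False by (fastforce simp: I_def not_le)
    then show ?thesis using True by (simp add: emeasure_space_1)
  next
    case I: False
    have fin: "finite I" by (simp add: I_def)
    have inj: "inj_on (claims_among k) I"
      by (rule inj_on_subset[OF inj_on_claims_among]) (auto simp: I_def)
    have "prob (\<Inter>j\<in>claims_among k ` I. Y j -` {y (inv_into I (claims_among k) j)<..} \<inter> space M) =
        (\<Prod>j\<in>claims_among k ` I. prob (Y j -` {y (inv_into I (claims_among k) j)<..} \<inter> space M))"
      using I fin by (intro indep_varsD[OF claims_indep]) auto
    moreover have "(\<Inter>j\<in>claims_among k ` I. Y j -` {y (inv_into I (claims_among k) j)<..} \<inter> space M) =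
        (\<Inter>m\<in>I. Y (claims_among k m) -` {y m<..} \<inter> space M)"
      using inv_into_f_f[OF inj] by (intro INF_cong_simp[THEN trans[OF INF_image]]) (simp_all add: simp_implies_def)
    moreover have "(\<Prod>j\<in>claims_among k ` I. prob (Y j -` {y (inv_into I (claims_among k) j)<..} \<inter> space M)) =
        (\<Prod>m\<in>I. prob (Y (claims_among k m) -` {y m<..} \<inter> space M))"
      by (simp add: prod.reindex[OF inj] inv_into_f_f[OF inj])
    ultimately have "prob (\<Inter>m\<in>I. Y (claims_among k m) -` {y m<..} \<inter> space M) =
        (\<Prod>m\<in>I. prob (Y (claims_among k m) -` {y m<..} \<inter> space M))"
      by (simp only:)
    moreover have "(\<Inter>m\<in>I. Y (claims_among k m) -` {y m<..} \<inter> space M) = ?E"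
    proof -
      have neg: "y m < 0" if "m < N" "k m \<noteq> 3" for m
        using False that by (meson not_le)
      have "(\<forall>m<N. y m < (if k m = 3 then Y (claims_among k m) \<omega> else 0)) \<longleftrightarrow>
          (\<forall>m\<in>I. y m < Y (claims_among k m) \<omega>)" for \<omega>
        by (simp add: I_def) (metis neg)
      then have "?E = {\<omega> \<in> space M. \<forall>m\<in>I. y m < Y (claims_among k m) \<omega>}"
        by (simp only:)
      also have "\<dots> = (\<Inter>m\<in>I. Y (claims_among k m) -` {y m<..} \<inter> space M)"
        using I by blast
      finally show ?thesis ..
    qed
    ultimately show ?thesis
      by (simp add: emeasure_eq_measure prod_ennreal)
  qed
  finally show ?thesis ..
qed

text \<open>On this event the random claim indices are those of the fixed history \<open>k\<close>,
  so it splits into an event of the path and an event of \<open>Y\<close>, which are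
  independent.\<close>

lemma emeasure_path:
  assumes z: "\<And>m. m \<le> N \<Longrightarrow> z m \<in> {1,2}" and k: "\<And>m. m < N \<Longrightarrow> k m \<in> {1,2,3}"
  shows "emeasure M {\<omega> \<in> space M. Z 0 \<omega> = z 0 \<and> (\<forall>m<N. t m < T m \<omega> \<and> K m \<omega> = k m \<and>
      Z (Suc m) \<omega> = z (Suc m) \<and> y m < claim_after m \<omega>)} =
    emeasure M {\<omega> \<in> space M. Z 0 \<omega> = z 0} * (\<Prod>m<N. step_weight z k t y m)"
    (is "emeasure M ?E = _")
proof -
  \<comment> \<open>\<open>path_law\<close> needs nonnegative thresholds; clipping changes only a
    null set because sojourns are almost surely positive.\<close>
  let ?E1 = "cylinder N z k (\<lambda>m. max 0 (t m))"
  let ?E2 = "{\<omega> \<in> space M. \<forall>m<N. y m < (if k m = 3 then Y (claims_among k m) \<omega> else 0)}"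
  have "emeasure M ?E = emeasure M (?E1 \<inter> ?E2)"
  proof (rule emeasure_eq_AE)
    show "AE \<omega> in M. \<omega> \<in> ?E \<longleftrightarrow> \<omega> \<in> ?E1 \<inter> ?E2"
      using AE_regular
    proof eventually_elim
      case (elim \<omega>)
      define P where "P m \<longleftrightarrow> y m < (if k m = 3 then Y (claims_among k m) \<omega> else 0)" for m
      have T: "t m < T m \<omega> \<longleftrightarrow> max 0 (t m) < T m \<omega>" for m
        using elim by simp
      have P: "y m < claim_after m \<omega> \<longleftrightarrow> P m"
        if "m < N" "\<forall>m<N. K m \<omega> = k m" for m
        using that claims_among_cong[of m "\<lambda>m. K m \<omega>" k] by (simp add: claim_after_def P_def)
      show ?case
        unfolding cylinder_def Int_iff mem_Collect_eq P_def[symmetric] T[symmetric] using P by blast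
    qed
  qed measurable
  also have "\<dots> = emeasure M ?E1 * emeasure M ?E2"
  proof -
    let ?P = "\<Pi>\<^sub>M n\<in>(UNIV::nat set). (count_space UNIV :: nat measure) \<Otimes>\<^sub>M (count_space UNIV :: nat measure) \<Otimes>\<^sub>M (borel :: real measure)"
    let ?Q = "\<Pi>\<^sub>M k\<in>(UNIV::nat set). (borel::real measure)"
    let ?B1 = "{s \<in> space ?P. fst (s 0) = z 0 \<and>
       (\<forall>m<N. snd (snd (s m)) > max 0 (t m) \<and> fst (snd (s m)) = k m \<and> fst (s (Suc m)) = z (Suc m))}"
    let ?B2 = "{s \<in> space ?Q.
        \<forall>m<N. y m < (if k m = 3 then s (claims_among k m) else 0)}"
    have [measurable]: "(\<lambda>s. s m) \<in> measurable ?P (count_space UNIV \<Otimes>\<^sub>M count_space UNIV \<Otimes>\<^sub>M borel)" for m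
      by (rule measurable_component_singleton) simp
    have [measurable]: "(\<lambda>s. s m) \<in> measurable ?Q borel" for m
      by (rule measurable_component_singleton) simp
    have "?E1 = (\<lambda>\<omega> n. (Z n \<omega>, K n \<omega>, T n \<omega>)) -` ?B1 \<inter> space M"
      by (auto simp: cylinder_def space_PiM space_pair_measure)
    moreover have "?B1 \<in> sets ?P"
      by measurable
    ultimately have 1: "?E1 \<in> {(\<lambda>\<omega> n. (Z n \<omega>, K n \<omega>, T n \<omega>)) -` B \<inter> space M |B. B \<in> sets ?P}"
      by blast
    have "?E2 = (\<lambda>\<omega> k. Y k \<omega>) -` ?B2 \<inter> space M"
      by (auto simp: space_PiM)
    moreover have "?B2 \<in> sets ?Q"
      by measurable
    ultimately have 2: "?E2 \<in> {(\<lambda>\<omega> k. Y k \<omega>) -` A \<inter> space M |A. A \<in> sets ?Q}"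
      by blast
    show ?thesis
      using indep_setD[OF claims_indep_path 2 1]
      by (simp add: emeasure_eq_measure ennreal_mult[symmetric] Int_commute mult.commute)
  qed
  also have "emeasure M ?E1 = emeasure M {\<omega> \<in> space M. Z 0 \<omega> = z 0} *
      (\<Prod>m<N. ennreal (step_prob (z m) (k m) (z (Suc m))) * emeasure (sojourn_law (z m)) {t m<..})"
  proof -
    have "(\<Prod>m<N. ennreal (step_prob (z m) (k m) (z (Suc m))) * emeasure (sojourn_law (z m)) {t m<..}) =
      (\<Prod>m<N. ennreal (exp (- total_intensity lam (z m) * max 0 (t m)) * step_prob (z m) (k m) (z (Suc m))))"
    proof (rule prod.cong[OF refl])
      fix m assume "m \<in> {..<N}"
      then have "z m \<in> {1,2}" "z (Suc m) \<in> {1,2}" "k m \<in> {1,2,3}" using z k by auto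
      then show "ennreal (step_prob (z m) (k m) (z (Suc m))) * emeasure (sojourn_law (z m)) {t m<..} =
        ennreal (exp (- total_intensity lam (z m) * max 0 (t m)) * step_prob (z m) (k m) (z (Suc m)))"
        unfolding sojourn_law_def
        by (subst emeasure_exponential_greaterThan[OF total_intensity_pos])
          (simp_all add: ennreal_mult step_prob_nonneg mult.commute)
    qed
    also have "\<dots> = ennreal (\<Prod>m<N. exp (- total_intensity lam (z m) * max 0 (t m)) * step_prob (z m) (k m) (z (Suc m)))"
      using z k by (intro prod_ennreal mult_nonneg_nonneg step_prob_nonneg) auto
    finally show ?thesis
      unfolding emeasure_eq_measure using prob_cylinder[of N z k "\<lambda>m. max 0 (t m)"] z k
      by (simp add: ennreal_mult')
  qed
  finally show ?thesis
    unfolding prob_claims by (simp add: step_weight_def prod.distrib mult_ac)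
qed

end

section \<open>The Markov property at the transition epochs\<close>

lemma prod_less_top_ennreal:
  fixes f :: "'i \<Rightarrow> ennreal"
  assumes "\<And>i. i \<in> I \<Longrightarrow> f i < \<top>"
  shows "(\<Prod>i\<in>I. f i) < \<top>"
  using assms by (induction I rule: infinite_finite_induct) (auto simp: ennreal_mult_less_top)

definition surplus_step :: "real \<Rightarrow> real \<Rightarrow> real \<Rightarrow> real \<Rightarrow> real \<Rightarrow> real" where
  "surplus_step c \<eta> r t y = (if r < 0 then r else min (r + c * t) \<eta> - y)"

lemma surplus_step_measurable [measurable]:
  assumes [measurable]: "r \<in> borel_measurable N" "t \<in> borel_measurable N" "y \<in> borel_measurable N"
  shows "(\<lambda>x. surplus_step c \<eta> (r x) (t x) (y x)) \<in> borel_measurable N"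
  unfolding surplus_step_def by measurable

context phase_type_risk_model
begin

definition killed :: "(nat \<Rightarrow> real) \<Rightarrow> real \<Rightarrow> nat \<Rightarrow> 'a \<Rightarrow> real" where
  "killed b x n \<omega> = killed_surplus c (\<lambda>n. Z n \<omega>) (\<lambda>n. K n \<omega>) (\<lambda>n. T n \<omega>) (\<lambda>k. Y k \<omega>) b x n"

abbreviation start_event :: "nat \<Rightarrow> 'a set" where
  "start_event i \<equiv> {\<omega> \<in> space M. Z 0 \<omega> = i}"

text \<open>The indicator of the initial phase travels with the discount factor, so all expectations
  are under \<open>M\<close> and the conditioning becomes one division at the end.\<close>

definition discount :: "nat \<Rightarrow> nat \<Rightarrow> 'a \<Rightarrow> ennreal" where
  "discount i n \<omega> = indicator {\<omega>. Z 0 \<omega> = i} \<omega> * ennreal (exp (- \<delta> * epoch (\<lambda>m. T m \<omega>) n))"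

lemma killed_0: "killed b x 0 \<omega> = x"
  by (simp add: killed_def)

lemma killed_Suc: "killed b x (Suc n) \<omega> = surplus_step c (b (Z n \<omega>)) (killed b x n \<omega>) (T n \<omega>) (claim_after n \<omega>)"
  by (simp add: killed_def surplus_step_def claim_after_def)

lemma discount_0: "discount i 0 \<omega> = indicator {\<omega>. Z 0 \<omega> = i} \<omega>"
  by (simp add: discount_def)

lemma discount_Suc: "discount i (Suc n) \<omega> = discount i n \<omega> * ennreal (exp (- \<delta> * T n \<omega>))"
proof -
  have "exp (- \<delta> * (epoch (\<lambda>m. T m \<omega>) n + T n \<omega>)) = exp (- \<delta> * epoch (\<lambda>m. T m \<omega>) n) * exp (- \<delta> * T n \<omega>)"
    by (simp add: exp_add[symmetric] distrib_left)
  then show ?thesis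
    by (simp only: discount_def epoch_Suc ennreal_mult exp_ge_zero mult.assoc)
qed

lemma killed_measurable [measurable]: "killed b x n \<in> borel_measurable M"
proof (induction n)
  case 0
  then show ?case by (simp add: killed_0[abs_def])
next
  case (Suc n)
  note [measurable] = Suc
  show ?case
    unfolding killed_Suc[abs_def] surplus_step_def by measurable
qed

lemma epoch_measurable [measurable]: "(\<lambda>\<omega>. epoch (\<lambda>m. T m \<omega>) n) \<in> borel_measurable M"
  unfolding epoch_def by measurable

lemma discount_measurable [measurable]: "discount i n \<in> borel_measurable M"
  unfolding discount_def by measurable

lemma AE_discount_le: "AE \<omega> in M. \<forall>n. discount i n \<omega> \<le> 1"
  using AE_regular
proof eventually_elim
  case (elim \<omega>)
  then have "0 \<le> epoch (\<lambda>m. T m \<omega>) n" for n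
    unfolding epoch_def by (intro sum_nonneg less_imp_le) auto
  then have "exp (- \<delta> * epoch (\<lambda>m. T m \<omega>) n) \<le> 1" for n
    using \<delta>_pos by simp
  then show ?case
    by (auto simp: discount_def indicator_def)
qed

text \<open>Deliberately not normalised: discount and phase events enter as weights, so transitions
  compose without conditional probabilities.\<close>

definition state_law :: "(nat \<Rightarrow> real) \<Rightarrow> real \<Rightarrow> nat \<Rightarrow> nat \<Rightarrow> nat \<Rightarrow> real measure" where
  "state_law b x i n z = distr (density M (\<lambda>\<omega>. discount i n \<omega> * indicator {\<omega>. Z n \<omega> = z} \<omega>)) borel (killed b x n)"

lemma sets_state_law [simp, measurable_cong]: "sets (state_law b x i n z) = sets borel"
  by (simp add: state_law_def)

lemma nn_integral_state_law:
  assumes [measurable]: "f \<in> borel_measurable borel"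
  shows "(\<integral>\<^sup>+r. f r \<partial>state_law b x i n z) =
    (\<integral>\<^sup>+\<omega>. discount i n \<omega> * indicator {\<omega>. Z n \<omega> = z} \<omega> * f (killed b x n \<omega>) \<partial>M)"
  unfolding state_law_def by (subst nn_integral_distr, simp_all, subst nn_integral_density) auto

lemma emeasure_state_law:
  assumes [measurable]: "A \<in> sets borel"
  shows "emeasure (state_law b x i n z) A =
    (\<integral>\<^sup>+\<omega>. discount i n \<omega> * indicator {\<omega>. Z n \<omega> = z} \<omega> * indicator A (killed b x n \<omega>) \<partial>M)"
  using nn_integral_state_law[of "indicator A"] by simp

lemma finite_measure_state_law: "finite_measure (state_law b x i n z)"
proof (rule finite_measureI)
  have "emeasure (state_law b x i n z) UNIV =
    (\<integral>\<^sup>+\<omega>. discount i n \<omega> * indicator {\<omega>. Z n \<omega> = z} \<omega> * indicator UNIV (killed b x n \<omega>) \<partial>M)"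
    by (rule emeasure_state_law) simp
  also have "\<dots> \<le> (\<integral>\<^sup>+\<omega>. 1 \<partial>M)"
    by (intro nn_integral_mono_AE) (use AE_discount_le[of i] in \<open>eventually_elim, auto simp: indicator_def\<close>)
  finally show "emeasure (state_law b x i n z) (space (state_law b x i n z)) \<noteq> \<infinity>"
    by (auto simp: state_law_def emeasure_space_1 top_unique)
qed

definition future :: "(nat \<Rightarrow> nat) \<Rightarrow> (nat \<Rightarrow> nat) \<Rightarrow> (nat \<Rightarrow> real) \<Rightarrow> (nat \<Rightarrow> real) \<Rightarrow> nat \<Rightarrow> nat \<Rightarrow> 'a set" where
  "future z k t y n N = {\<omega>. \<forall>m\<in>{n..<N}. t m < T m \<omega> \<and> K m \<omega> = k m \<and> Z (Suc m) \<omega> = z (Suc m) \<and>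
    y m < claim_after m \<omega>}"

lemma future_measurable [measurable]: "Measurable.pred M (\<lambda>\<omega>. \<omega> \<in> future z k t y n N)"
  unfolding future_def by measurable

text \<open>The Markov property of (phase, surplus, discount factor) at step \<open>n\<close>.  Carrying the whole
  cylinder of later steps along makes it provable by induction on \<open>n\<close>, without conditional laws of shifted paths.\<close>

definition markov_at :: "(nat \<Rightarrow> real) \<Rightarrow> real \<Rightarrow> nat \<Rightarrow> nat \<Rightarrow> bool" where
  "markov_at b x i n \<longleftrightarrow> (\<forall>z k t y N A. n \<le> N \<longrightarrow> (\<forall>m\<in>{n..N}. z m \<in> {1,2}) \<longrightarrow>
     (\<forall>m\<in>{n..<N}. k m \<in> {1,2,3}) \<longrightarrow> A \<in> sets borel \<longrightarrow>
     (\<integral>\<^sup>+\<omega>. discount i n \<omega> * indicator {\<omega>. Z n \<omega> = z n} \<omega> * indicator A (killed b x n \<omega>) *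
        indicator (future z k t y n N) \<omega> \<partial>M) =
     (\<Prod>m\<in>{n..<N}. step_weight z k t y m) * emeasure (state_law b x i n (z n)) A)"

lemma markov_at_0: "markov_at b x i 0"
  unfolding markov_at_def
proof (intro allI impI)
  fix z k :: "nat \<Rightarrow> nat" and t y :: "nat \<Rightarrow> real" and N and A :: "real set"
  assume z: "\<forall>m\<in>{0..N}. z m \<in> {1,2}" and k: "\<forall>m\<in>{0..<N}. k m \<in> {1,2,3::nat}"
    and [measurable]: "A \<in> sets borel"
  let ?L = "\<integral>\<^sup>+\<omega>. discount i 0 \<omega> * indicator {\<omega>. Z 0 \<omega> = z 0} \<omega> * indicator A (killed b x 0 \<omega>) *
        indicator (future z k t y 0 N) \<omega> \<partial>M"
  let ?a = "if i = z 0 then indicator A x else 0 :: ennreal"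
  let ?E = "{\<omega> \<in> space M. Z 0 \<omega> = z 0 \<and> (\<forall>m<N. t m < T m \<omega> \<and> K m \<omega> = k m \<and>
      Z (Suc m) \<omega> = z (Suc m) \<and> y m < claim_after m \<omega>)}"
  have "?L =
      (\<integral>\<^sup>+\<omega>. ?a * indicator ?E \<omega> \<partial>M)"
    by (rule nn_integral_cong) (auto simp: discount_0 killed_0 future_def indicator_def)
  also have "\<dots> = ?a * emeasure M ?E"
    by (rule nn_integral_cmult_indicator) measurable
  also have "emeasure M ?E = emeasure M (start_event (z 0)) * (\<Prod>m<N. step_weight z k t y m)"
    using z k by (intro emeasure_path) auto
  also have "?a * \<dots> =
      (\<Prod>m\<in>{0..<N}. step_weight z k t y m) * (?a * emeasure M (start_event (z 0)))"
    by (simp add: atLeast0LessThan mult_ac)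
  also have "?a * emeasure M (start_event (z 0)) =
      (\<integral>\<^sup>+\<omega>. ?a * indicator (start_event (z 0)) \<omega> \<partial>M)"
    by (rule nn_integral_cmult_indicator[symmetric]) measurable
  also have "\<dots> = emeasure (state_law b x i 0 (z 0)) A"
    unfolding emeasure_state_law[OF \<open>A \<in> sets borel\<close>]
    by (rule nn_integral_cong) (auto simp: discount_0 killed_0 indicator_def)
  finally show "?L =
     (\<Prod>m\<in>{0..<N}. step_weight z k t y m) * emeasure (state_law b x i 0 (z 0)) A" .
qed

text \<open>By \<open>markov_at\<close> the discounted mass of events given by a surplus set, a
  sojourn tail and a claim tail factorises, and such events determine the joint law.\<close>

lemma markov_at_step_law:
  fixes z k :: "nat \<Rightarrow> nat" and t y :: "nat \<Rightarrow> real"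
  assumes markov: "markov_at b x i n" and "z' \<in> {1,2}" "k' \<in> {1,2,3}" and N: "Suc n \<le> N"
    and z: "\<forall>m\<in>{Suc n..N}. z m \<in> {1,2}" and k: "\<forall>m\<in>{Suc n..<N}. k m \<in> {1,2,3}"
  defines "E \<equiv> {\<omega>. Z n \<omega> = z' \<and> K n \<omega> = k' \<and> Z (Suc n) \<omega> = z (Suc n) \<and> \<omega> \<in> future z k t y (Suc n) N}"
  defines "a \<equiv> ennreal (step_prob z' k' (z (Suc n))) * (\<Prod>m\<in>{Suc n..<N}. step_weight z k t y m)"
  shows "distr (density M (\<lambda>\<omega>. discount i n \<omega> * indicator E \<omega>)) ((borel \<Otimes>\<^sub>M borel) \<Otimes>\<^sub>M borel)
      (\<lambda>\<omega>. ((killed b x n \<omega>, T n \<omega>), claim_after n \<omega>)) =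
    scale_measure a ((state_law b x i n z' \<Otimes>\<^sub>M sojourn_law z') \<Otimes>\<^sub>M claim_law k')"
proof -
  note [measurable] = future_measurable
  interpret P: finite_measure "state_law b x i n z'" by (rule finite_measure_state_law)
  interpret S: prob_space "sojourn_law z'" using assms by (intro prob_space_sojourn_law) auto
  interpret C: prob_space "claim_law k'" by (rule prob_space_claim_law)
  interpret PS: pair_sigma_finite "state_law b x i n z'" "sojourn_law z'" ..
  have [measurable]: "Measurable.pred M (\<lambda>\<omega>. \<omega> \<in> E)"
    unfolding E_def by simp
  have fin: "a < \<top>"
    unfolding a_def step_weight_def
  proof (intro ennreal_mult_less_top[THEN iffD2] disjI2 conjI)
    have "ennreal (step_prob (z m) (k m) (z (Suc m))) *
        (emeasure (sojourn_law (z m)) {t m<..} * emeasure (claim_law (k m)) {y m<..}) < \<top>"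
      if m: "m \<in> {Suc n..<N}" for m
    proof -
      interpret Sm: prob_space "sojourn_law (z m)" using z m by (intro prob_space_sojourn_law) auto
      interpret Cm: prob_space "claim_law (k m)" by (rule prob_space_claim_law)
      show ?thesis
        by (simp add: ennreal_mult_less_top Sm.emeasure_eq_measure Cm.emeasure_eq_measure)
    qed
    then show "(\<Prod>m\<in>{Suc n..<N}. ennreal (step_prob (z m) (k m) (z (Suc m))) *
      (emeasure (sojourn_law (z m)) {t m<..} * emeasure (claim_law (k m)) {y m<..})) < \<top>"
      by (rule prod_less_top_ennreal)
  qed simp
  have joint: "(\<integral>\<^sup>+\<omega>. discount i n \<omega> * indicator E \<omega> * indicator A (killed b x n \<omega>) *
      indicator {t'<..} (T n \<omega>) * indicator {y'<..} (claim_after n \<omega>) \<partial>M) =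
    a * (emeasure (state_law b x i n z') A * emeasure (sojourn_law z') {t'<..} * emeasure (claim_law k') {y'<..})"
    (is "?J = _") if A: "A \<in> sets borel" for A t' y'
  proof -
    let ?X = "\<lambda>\<omega>. discount i n \<omega> * indicator E \<omega> * indicator A (killed b x n \<omega>) *
      indicator {t'<..} (T n \<omega>) * indicator {y'<..} (claim_after n \<omega>)"
    \<comment> \<open>Overwriting entry \<open>n\<close> turns the current transition with its two
      thresholds into the first step of a cylinder starting at \<open>n\<close>.\<close>
    let ?z = "z(n := z')" and ?k = "k(n := k')" and ?t = "t(n := t')" and ?y = "y(n := y')"
    have split: "indicator {\<omega>. Z n \<omega> = ?z n} \<omega> * indicator (future ?z ?k ?t ?y n N) \<omega> =
        indicator E \<omega> * indicator {t'<..} (T n \<omega>) * (indicator {y'<..} (claim_after n \<omega>) :: ennreal)" for \<omega>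
    proof -
      have "{n..<N} = insert n {Suc n..<N}" using N by auto
      then have "\<omega> \<in> future ?z ?k ?t ?y n N \<longleftrightarrow> t' < T n \<omega> \<and> K n \<omega> = k' \<and> Z (Suc n) \<omega> = z (Suc n) \<and>
          y' < claim_after n \<omega> \<and> \<omega> \<in> future z k t y (Suc n) N"
        by (auto simp: future_def)
      then show ?thesis by (auto simp: indicator_def E_def)
    qed
    have "?J =       (\<integral>\<^sup>+\<omega>. discount i n \<omega> * indicator {\<omega>. Z n \<omega> = ?z n} \<omega> * indicator A (killed b x n \<omega>) *
        indicator (future ?z ?k ?t ?y n N) \<omega> \<partial>M)"
      (is "nn_integral _ ?lhs = nn_integral _ ?rhs")
    proof (rule nn_integral_cong)
      fix \<omega>
      have "?X \<omega> =
        discount i n \<omega> * indicator A (killed b x n \<omega>) *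
          (indicator E \<omega> * indicator {t'<..} (T n \<omega>) * indicator {y'<..} (claim_after n \<omega>))"
        by (simp only: mult_ac)
      also have "\<dots> = discount i n \<omega> * indicator {\<omega>. Z n \<omega> = ?z n} \<omega> * indicator A (killed b x n \<omega>) *
        indicator (future ?z ?k ?t ?y n N) \<omega>"
        unfolding split[symmetric] by (simp only: mult_ac)
      finally show "?lhs \<omega> = ?rhs \<omega>" .
    qed
    also have "\<dots> = (\<Prod>m\<in>{n..<N}. step_weight ?z ?k ?t ?y m) * emeasure (state_law b x i n (?z n)) A"
    proof -
      have "\<forall>m\<in>{n..N}. ?z m \<in> {1,2}" "\<forall>m\<in>{n..<N}. ?k m \<in> {1,2,3}"
        using assms(2,3) z k by auto
      then show ?thesis
        using markov N A unfolding markov_at_def by (meson Suc_leD)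
    qed
    also have "(\<Prod>m\<in>{n..<N}. step_weight ?z ?k ?t ?y m) =
        step_weight ?z ?k ?t ?y n * (\<Prod>m\<in>{Suc n..<N}. step_weight ?z ?k ?t ?y m)"
      using N by (intro prod.atLeast_Suc_lessThan) auto
    also have "(\<Prod>m\<in>{Suc n..<N}. step_weight ?z ?k ?t ?y m) = (\<Prod>m\<in>{Suc n..<N}. step_weight z k t y m)"
      by (intro prod.cong) (auto simp: step_weight_def)
    finally show ?thesis
      by (simp add: a_def step_weight_def mult_ac)
  qed
  \<comment> \<open>The product law is identified one coordinate at a time: surplus and sojourn with
    the claim tail frozen, and afterwards the claim.\<close>
  have pairs: "distr (density M (\<lambda>\<omega>. discount i n \<omega> * indicator E \<omega> * indicator {y'<..} (claim_after n \<omega>)))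
      (borel \<Otimes>\<^sub>M borel) (\<lambda>\<omega>. (killed b x n \<omega>, T n \<omega>)) =
    scale_measure (a * emeasure (claim_law k') {y'<..}) (state_law b x i n z' \<Otimes>\<^sub>M sojourn_law z')"
    (is "?N y' = _") for y'
  proof (rule pair_measure_eqI_greaterThan)
    show "a * emeasure (claim_law k') {y'<..} < \<top>"
      using fin by (simp add: ennreal_mult_less_top C.emeasure_eq_measure)
    fix A u assume A: "A \<in> sets (state_law b x i n z')"
    then have [measurable]: "A \<in> sets borel" by simp
    have "emeasure (?N y') (A \<times> {u<..}) = (\<integral>\<^sup>+\<omega>. discount i n \<omega> * indicator E \<omega> * indicator A (killed b x n \<omega>) *
      indicator {u<..} (T n \<omega>) * indicator {y'<..} (claim_after n \<omega>) \<partial>M)"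
      by (subst emeasure_distr, simp_all, subst emeasure_density, simp_all)
        (auto intro!: nn_integral_cong simp: indicator_def)
    also have "\<dots> = a * emeasure (claim_law k') {y'<..} * (emeasure (state_law b x i n z') A * emeasure (sojourn_law z') {u<..})"
      by (subst joint) (simp_all add: mult_ac)
    finally show "emeasure (?N y') (A \<times> {u<..}) = \<dots>" .
  qed (auto simp: P.finite_measure_axioms S.finite_measure_axioms cong: sets_pair_measure_cong)
  show ?thesis
  proof (rule pair_measure_eqI_greaterThan)
    show "finite_measure (state_law b x i n z' \<Otimes>\<^sub>M sojourn_law z')"
      by (intro finite_measure_pair_measure P.finite_measure_axioms S.finite_measure_axioms)
    let ?L = "distr (density M (\<lambda>\<omega>. discount i n \<omega> * indicator E \<omega>)) ((borel \<Otimes>\<^sub>M borel) \<Otimes>\<^sub>M borel)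
      (\<lambda>\<omega>. ((killed b x n \<omega>, T n \<omega>), claim_after n \<omega>))"
    fix A u assume A: "A \<in> sets (state_law b x i n z' \<Otimes>\<^sub>M sojourn_law z')"
    then have [measurable]: "A \<in> sets (borel \<Otimes>\<^sub>M borel)" by (simp cong: sets_pair_measure_cong)
    have "emeasure ?L (A \<times> {u<..}) = emeasure (?N u) A"
      by (simp add: emeasure_distr emeasure_density)
        (auto intro!: nn_integral_cong simp: indicator_def)
    also have "\<dots> = a * (emeasure (state_law b x i n z' \<Otimes>\<^sub>M sojourn_law z') A * emeasure (claim_law k') {u<..})"
      unfolding pairs by (simp add: mult_ac)
    finally show "emeasure ?L (A \<times> {u<..}) = \<dots>" .
  qed (auto simp: fin C.finite_measure_axioms cong: sets_pair_measure_cong)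
qed

end

section \<open>Integrals over a single transition\<close>

lemma sojourn_dividends_measurable [measurable]:
  assumes [measurable]: "x \<in> borel_measurable N" "t \<in> borel_measurable N"
  shows "(\<lambda>\<omega>. sojourn_dividends c \<delta> \<eta> (x \<omega>) (t \<omega>)) \<in> borel_measurable N"
  unfolding sojourn_dividends_def indicator_def by measurable

text \<open>Discounting at rate \<open>d\<close> raises the decay rate of the exponential clock from
  \<open>l\<close> to \<open>l + d\<close>; this is the origin of the rate
  \<open>total_intensity lam z + \<delta>\<close> in the profiles.\<close>

lemma nn_integral_exponential_discount:
  assumes l: "0 < l" "0 \<le> d" and [measurable]: "f \<in> borel_measurable borel"
  shows "(\<integral>\<^sup>+t. ennreal (exp (- d * t)) * f t \<partial>density lborel (exponential_density l)) =
    (\<integral>\<^sup>+t. ennreal (l * exp (- (l + d) * t)) * indicator {0..} t * f t \<partial>lborel)"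
    (is "?L = _")
proof -
  have "?L =
      (\<integral>\<^sup>+t. ennreal (exponential_density l t) * (ennreal (exp (- d * t)) * f t) \<partial>lborel)"
    by (rule nn_integral_density) measurable
  also have "\<dots> = (\<integral>\<^sup>+t. ennreal (l * exp (- (l + d) * t)) * indicator {0..} t * f t \<partial>lborel)"
    (is "nn_integral _ ?lhs = nn_integral _ ?rhs")
  proof (rule nn_integral_cong)
    fix t :: real
    have "l * exp (- (l + d) * t) = l * exp (- t * l) * exp (- d * t)"
      by (simp add: exp_add[symmetric] algebra_simps)
    then show "?lhs t = ?rhs t"
      using l by (simp add: exponential_density_def ennreal_mult mult.assoc indicator_def)
  qed
  finally show ?thesis .
qed

lemma nn_integral_exp_atLeast:
  assumes "0 < a"
  shows "(\<integral>\<^sup>+t. ennreal (exp (- a * t)) * indicator {h..} t \<partial>lborel) = ennreal (exp (- a * h) / a)"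
    (is "?L = _")
proof -
  have a: "a \<noteq> 0" using less_imp_neq[OF assms] by (rule not_sym)
  have "?L = ennreal (0 - (- exp (- a * h) / a))"
  proof (rule nn_integral_FTC_atLeast)
    show "((\<lambda>t. - exp (- a * t) / a) has_real_derivative exp (- a * t)) (at t)" for t
      using a by (auto intro!: derivative_eq_intros)
    have "filterlim (\<lambda>t. a * t) at_top at_top"
      by (rule filterlim_tendsto_pos_mult_at_top[OF tendsto_const assms filterlim_ident])
    then have "((\<lambda>t. exp (- (a * t))) \<longlongrightarrow> 0) at_top"
      by (intro filterlim_compose[OF exp_at_bot]) (simp add: filterlim_uminus_at_top)
    then have "((\<lambda>t. - exp (- (a * t)) / a) \<longlongrightarrow> - 0 / a) at_top"
      using a by (intro tendsto_intros)
    then show "((\<lambda>t. - exp (- a * t) / a) \<longlongrightarrow> 0) at_top" by simp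
  qed auto
  then show ?thesis by simp
qed

context phase_type_risk_model
begin

lemma markov_at_step_integral:
  fixes z k :: "nat \<Rightarrow> nat" and t y :: "nat \<Rightarrow> real"
  assumes "markov_at b x i n" "z' \<in> {1,2}" "k' \<in> {1,2,3}" "Suc n \<le> N"
    and "\<forall>m\<in>{Suc n..N}. z m \<in> {1,2}" "\<forall>m\<in>{Suc n..<N}. k m \<in> {1,2,3}"
    and [measurable]: "f \<in> borel_measurable ((borel \<Otimes>\<^sub>M borel) \<Otimes>\<^sub>M borel)"
  shows "(\<integral>\<^sup>+\<omega>. discount i n \<omega> * indicator {\<omega>. Z n \<omega> = z' \<and> K n \<omega> = k' \<and> Z (Suc n) \<omega> = z (Suc n) \<and>
        \<omega> \<in> future z k t y (Suc n) N} \<omega> * f ((killed b x n \<omega>, T n \<omega>), claim_after n \<omega>) \<partial>M) =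
    ennreal (step_prob z' k' (z (Suc n))) * (\<Prod>m\<in>{Suc n..<N}. step_weight z k t y m) *
    (\<integral>\<^sup>+r. \<integral>\<^sup>+t. \<integral>\<^sup>+y. f ((r, t), y) \<partial>claim_law k' \<partial>sojourn_law z' \<partial>state_law b x i n z')"
proof -
  interpret S: prob_space "sojourn_law z'" using assms by (intro prob_space_sojourn_law) auto
  interpret C: prob_space "claim_law k'" by (rule prob_space_claim_law)
  let ?E = "{\<omega>. Z n \<omega> = z' \<and> K n \<omega> = k' \<and> Z (Suc n) \<omega> = z (Suc n) \<and> \<omega> \<in> future z k t y (Suc n) N}"
  have [measurable]: "Measurable.pred M (\<lambda>\<omega>. \<omega> \<in> ?E)" by simp
  let ?D = "distr (density M (\<lambda>\<omega>. discount i n \<omega> * indicator ?E \<omega>)) ((borel \<Otimes>\<^sub>M borel) \<Otimes>\<^sub>M borel)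
      (\<lambda>\<omega>. ((killed b x n \<omega>, T n \<omega>), claim_after n \<omega>))"
  have "(\<integral>\<^sup>+\<omega>. discount i n \<omega> * indicator ?E \<omega> * f ((killed b x n \<omega>, T n \<omega>), claim_after n \<omega>) \<partial>M) =
      (\<integral>\<^sup>+p. f p \<partial>?D)"
    by (simp add: nn_integral_distr nn_integral_density)
  also have "\<dots> = ennreal (step_prob z' k' (z (Suc n))) * (\<Prod>m\<in>{Suc n..<N}. step_weight z k t y m) *
      (\<integral>\<^sup>+p. f p \<partial>((state_law b x i n z' \<Otimes>\<^sub>M sojourn_law z') \<Otimes>\<^sub>M claim_law k'))"
    unfolding markov_at_step_law[OF assms(1-6)] by (rule nn_integral_scale_measure) simp
  also have "(\<integral>\<^sup>+p. f p \<partial>((state_law b x i n z' \<Otimes>\<^sub>M sojourn_law z') \<Otimes>\<^sub>M claim_law k')) =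
    (\<integral>\<^sup>+p. \<integral>\<^sup>+y. f (p, y) \<partial>claim_law k' \<partial>(state_law b x i n z' \<Otimes>\<^sub>M sojourn_law z'))"
    by (rule C.nn_integral_fst[symmetric]) simp
  also have "\<dots> = (\<integral>\<^sup>+r. \<integral>\<^sup>+t. \<integral>\<^sup>+y. f ((r, t), y) \<partial>claim_law k' \<partial>sojourn_law z' \<partial>state_law b x i n z')"
    by (rule S.nn_integral_fst[symmetric]) simp
  finally show ?thesis .
qed

text \<open>The surplus at \<open>Suc n\<close> is a function of surplus, sojourn and claim at
  \<open>n\<close>. Summing over the current phase and the entered state leaves the weight of the
  future times a factor free of the future.\<close>

lemma markov_at_Suc:
  assumes markov: "markov_at b x i n"
  shows "markov_at b x i (Suc n)"
proof -
  define f where "f A z' = (\<lambda>((r, t), y). ennreal (exp (- \<delta> * t)) * indicator A (surplus_step c (b z') r t y))"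
    for A :: "real set" and z'
  define J where "J A z' k' = (\<integral>\<^sup>+r. \<integral>\<^sup>+t. \<integral>\<^sup>+y. f A z' ((r, t), y) \<partial>claim_law k' \<partial>sojourn_law z' \<partial>state_law b x i n z')"
    for A z' k'
  define G where "G A j = (\<Sum>z'\<in>{1,2}. \<Sum>k'\<in>{1,2,3}. ennreal (step_prob z' k' j) * J A z' k')" for A j
  let ?L = "\<lambda>z k t y N A. \<integral>\<^sup>+\<omega>. discount i (Suc n) \<omega> * indicator {\<omega>. Z (Suc n) \<omega> = z (Suc n)} \<omega> *
        indicator A (killed b x (Suc n) \<omega>) * indicator (future z k t y (Suc n) N) \<omega> \<partial>M"
  have step: "?L z k t y N A =
      (\<Prod>m\<in>{Suc n..<N}. step_weight z k t y m) * G A (z (Suc n))"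
    if N: "Suc n \<le> N" "\<forall>m\<in>{Suc n..N}. z m \<in> {1,2}" "\<forall>m\<in>{Suc n..<N}. k m \<in> {1,2,3}"
      and [measurable]: "A \<in> sets borel" for z k t y N A
  proof -
    have f[measurable]: "f A z' \<in> borel_measurable ((borel \<Otimes>\<^sub>M borel) \<Otimes>\<^sub>M borel)" for z'
      unfolding f_def case_prod_beta by measurable
    let ?E = "\<lambda>z' k'. {\<omega>. Z n \<omega> = z' \<and> K n \<omega> = k' \<and> Z (Suc n) \<omega> = z (Suc n) \<and> \<omega> \<in> future z k t y (Suc n) N}"
    have [measurable]: "Measurable.pred M (\<lambda>\<omega>. \<omega> \<in> ?E z' k')" for z' k' by simp
    have "?L z k t y N A =
      (\<integral>\<^sup>+\<omega>. (\<Sum>z'\<in>{1,2}. \<Sum>k'\<in>{1,2,3}. discount i n \<omega> * indicator (?E z' k') \<omega> *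
        f A z' ((killed b x n \<omega>, T n \<omega>), claim_after n \<omega>)) \<partial>M)"
      (is "nn_integral _ ?lhs = nn_integral _ ?rhs")
    proof (rule nn_integral_cong_AE)
      show "AE \<omega> in M. ?lhs \<omega> = ?rhs \<omega>"
        using AE_regular
      proof eventually_elim
        case (elim \<omega>)
        then have "Z n \<omega> = 1 \<or> Z n \<omega> = 2" "K n \<omega> = 1 \<or> K n \<omega> = 2 \<or> K n \<omega> = 3" by auto
        then show ?case
          by (elim disjE) (simp_all add: discount_Suc killed_Suc f_def indicator_def mult_ac)
      qed
    qed
    also have "\<dots> = (\<Sum>z'\<in>{1,2}. \<Sum>k'\<in>{1,2,3}. \<integral>\<^sup>+\<omega>. discount i n \<omega> * indicator (?E z' k') \<omega> *
        f A z' ((killed b x n \<omega>, T n \<omega>), claim_after n \<omega>) \<partial>M)"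
      by (subst nn_integral_sum, measurable, intro sum.cong refl nn_integral_sum) measurable
    also have "\<dots> = (\<Sum>z'\<in>{1,2}. \<Sum>k'\<in>{1,2,3}. ennreal (step_prob z' k' (z (Suc n))) *
        (\<Prod>m\<in>{Suc n..<N}. step_weight z k t y m) * J A z' k')"
      unfolding J_def using N by (intro sum.cong[OF refl] markov_at_step_integral[OF markov] f)
    finally show ?thesis
      by (simp only: G_def sum_distrib_left mult_ac)
  qed
  show ?thesis
    unfolding markov_at_def
  proof (intro allI impI)
    fix z k :: "nat \<Rightarrow> nat" and t y :: "nat \<Rightarrow> real" and N and A :: "real set"
    assume N: "Suc n \<le> N" "\<forall>m\<in>{Suc n..N}. z m \<in> {1,2}" "\<forall>m\<in>{Suc n..<N}. k m \<in> {1,2,3}"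
      and A: "A \<in> sets borel"
    \<comment> \<open>The case \<open>N = Suc n\<close>, with empty future, identifies that factor
      as the mass of the state law.\<close>
    have "emeasure (state_law b x i (Suc n) (z (Suc n))) A = G A (z (Suc n))"
      unfolding emeasure_state_law[OF A] using step[of "Suc n" z k A t y] N A by (simp add: future_def)
    then show "?L z k t y N A =
      (\<Prod>m\<in>{Suc n..<N}. step_weight z k t y m) * emeasure (state_law b x i (Suc n) (z (Suc n))) A"
      using step[OF N A] by simp
  qed
qed

lemma markov_at_all: "markov_at b x i n"
  by (induction n) (simp_all add: markov_at_0 markov_at_Suc)

text \<open>The test function may depend on the sojourn and on the claim themselves; this is needed
  for the dividends paid during the sojourn.\<close>

lemma one_step:
  assumes f[measurable]: "\<And>z k j. f z k j \<in> borel_measurable ((borel \<Otimes>\<^sub>M borel) \<Otimes>\<^sub>M borel)"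
  shows "(\<integral>\<^sup>+\<omega>. discount i n \<omega> * f (Z n \<omega>) (K n \<omega>) (Z (Suc n) \<omega>) ((killed b x n \<omega>, T n \<omega>), claim_after n \<omega>) \<partial>M) =
    (\<Sum>z\<in>{1,2}. \<integral>\<^sup>+r. (\<Sum>k\<in>{1,2,3}. \<Sum>j\<in>{1,2}. ennreal (step_prob z k j) *
      (\<integral>\<^sup>+t. \<integral>\<^sup>+y. f z k j ((r, t), y) \<partial>claim_law k \<partial>sojourn_law z)) \<partial>state_law b x i n z)"
proof -
  let ?I = "\<lambda>z k j r. \<integral>\<^sup>+t. \<integral>\<^sup>+y. f z k j ((r, t), y) \<partial>claim_law k \<partial>sojourn_law z"
  let ?E = "\<lambda>z k j. {\<omega>. Z n \<omega> = z \<and> K n \<omega> = k \<and> Z (Suc n) \<omega> = j}"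
  let ?f = "\<lambda>z k j \<omega>. f z k j ((killed b x n \<omega>, T n \<omega>), claim_after n \<omega>)"
  have [measurable]: "Measurable.pred M (\<lambda>\<omega>. \<omega> \<in> ?E z k j)" for z k j by simp
  have "(\<integral>\<^sup>+\<omega>. discount i n \<omega> * ?f (Z n \<omega>) (K n \<omega>) (Z (Suc n) \<omega>) \<omega> \<partial>M) =
    (\<integral>\<^sup>+\<omega>. (\<Sum>z\<in>{1,2}. \<Sum>k\<in>{1,2,3}. \<Sum>j\<in>{1,2}. discount i n \<omega> * indicator (?E z k j) \<omega> * ?f z k j \<omega>) \<partial>M)"
    (is "nn_integral _ ?lhs = nn_integral _ ?rhs")
  proof (rule nn_integral_cong_AE)
    show "AE \<omega> in M. ?lhs \<omega> = ?rhs \<omega>"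
      using AE_regular
    proof eventually_elim
      case (elim \<omega>)
      then have "Z n \<omega> = 1 \<or> Z n \<omega> = 2" "K n \<omega> = 1 \<or> K n \<omega> = 2 \<or> K n \<omega> = 3"
        "Z (Suc n) \<omega> = 1 \<or> Z (Suc n) \<omega> = 2" by auto
      then show ?case
        by (elim disjE) (simp_all add: indicator_def)
    qed
  qed
  also have "\<dots> = (\<Sum>z\<in>{1,2}. \<Sum>k\<in>{1,2,3}. \<Sum>j\<in>{1,2}. \<integral>\<^sup>+\<omega>. discount i n \<omega> * indicator (?E z k j) \<omega> * ?f z k j \<omega> \<partial>M)"
    by (subst nn_integral_sum, measurable, intro sum.cong refl,
        subst nn_integral_sum, measurable, intro sum.cong refl nn_integral_sum) measurable
  also have "\<dots> = (\<Sum>z\<in>{1,2}. \<Sum>k\<in>{1,2,3}. \<Sum>j\<in>{1,2}. ennreal (step_prob z k j) *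
      (\<integral>\<^sup>+r. ?I z k j r \<partial>state_law b x i n z))"
  proof (intro sum.cong refl)
    fix z k j assume "z \<in> {1,2::nat}" "k \<in> {1,2,3::nat}" "j \<in> {1,2::nat}"
    then show "(\<integral>\<^sup>+\<omega>. discount i n \<omega> * indicator (?E z k j) \<omega> * ?f z k j \<omega> \<partial>M) = ennreal (step_prob z k j) *
      (\<integral>\<^sup>+r. ?I z k j r \<partial>state_law b x i n z)"
      using markov_at_step_integral[OF markov_at_all, of z k n "Suc n" "\<lambda>_. j" "\<lambda>_. 1" "f z k j" i "\<lambda>_. 0" "\<lambda>_. 0" b x]
      by (simp add: future_def)
  qed
  also have "\<dots> = (\<Sum>z\<in>{1,2}. \<integral>\<^sup>+r. (\<Sum>k\<in>{1,2,3}. \<Sum>j\<in>{1,2}. ennreal (step_prob z k j) *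
      ?I z k j r) \<partial>state_law b x i n z)"
  proof (rule sum.cong[OF refl])
    fix z :: nat assume "z \<in> {1,2}"
    then interpret S: prob_space "sojourn_law z" by (rule prob_space_sojourn_law)
    have [measurable]: "?I z k j \<in> borel_measurable borel" for k j
    proof -
      interpret C: prob_space "claim_law k" by (rule prob_space_claim_law)
      show ?thesis by measurable
    qed
    show "(\<Sum>k\<in>{1,2,3}. \<Sum>j\<in>{1,2}. ennreal (step_prob z k j) *
      (\<integral>\<^sup>+r. ?I z k j r \<partial>state_law b x i n z)) =
      (\<integral>\<^sup>+r. (\<Sum>k\<in>{1,2,3}. \<Sum>j\<in>{1,2}. ennreal (step_prob z k j) *
      ?I z k j r) \<partial>state_law b x i n z)"
      by (subst nn_integral_sum, measurable, intro sum.cong refl,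
          subst nn_integral_sum, measurable, intro sum.cong refl nn_integral_cmult[symmetric]) measurable
  qed
  finally show ?thesis .
qed

end

section \<open>The value as a Neumann series\<close>

context phase_type_risk_model
begin

text \<open>The discounted one-step operator of the chain. A negative surplus is mapped to itself,
  so functions that vanish there ignore ruined paths.\<close>

definition transfer :: "(nat \<Rightarrow> real) \<Rightarrow> (nat \<Rightarrow> real \<Rightarrow> ennreal) \<Rightarrow> nat \<Rightarrow> real \<Rightarrow> ennreal" where
  "transfer b h z r = (\<Sum>k\<in>{1,2,3}. \<Sum>j\<in>{1,2}. ennreal (step_prob z k j) *
     (\<integral>\<^sup>+t. \<integral>\<^sup>+y. ennreal (exp (- \<delta> * t)) * h j (surplus_step c (b z) r t y) \<partial>claim_law k \<partial>sojourn_law z))"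

definition sojourn_gain :: "(nat \<Rightarrow> real) \<Rightarrow> nat \<Rightarrow> real \<Rightarrow> ennreal" where
  "sojourn_gain b z r = (if 0 \<le> r then \<integral>\<^sup>+t. sojourn_dividends c \<delta> (b z) r t \<partial>sojourn_law z else 0)"

lemma sigma_finite_sojourn_law: "sigma_finite_measure (sojourn_law z)"
  unfolding sojourn_law_def
  by (subst sigma_finite_measure.sigma_finite_iff_density_finite[OF lborel.sigma_finite_measure_axioms]) auto

lemma transfer_measurable:
  assumes [measurable]: "\<And>j. h j \<in> borel_measurable borel"
  shows "transfer b h z \<in> borel_measurable borel"
proof -
  interpret S: sigma_finite_measure "sojourn_law z" by (rule sigma_finite_sojourn_law)
  have [measurable]: "(\<lambda>r. \<integral>\<^sup>+t. \<integral>\<^sup>+y. ennreal (exp (- \<delta> * t)) * h j (surplus_step c (b z) r t y)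
      \<partial>claim_law k \<partial>sojourn_law z) \<in> borel_measurable borel" for k j
  proof -
    interpret C: prob_space "claim_law k" by (rule prob_space_claim_law)
    show ?thesis by measurable
  qed
  show ?thesis unfolding transfer_def[abs_def] by measurable
qed

lemma sojourn_gain_measurable: "sojourn_gain b z \<in> borel_measurable borel"
proof -
  interpret S: sigma_finite_measure "sojourn_law z" by (rule sigma_finite_sojourn_law)
  show ?thesis unfolding sojourn_gain_def[abs_def] by measurable
qed

lemma transfer_funpow_measurable:
  assumes "\<And>j. h j \<in> borel_measurable borel"
  shows "(transfer b ^^ n) h z \<in> borel_measurable borel"
  using assms by (induction n arbitrary: z) (auto intro: transfer_measurable)

lemma expect_state:
  assumes [measurable]: "\<And>j. h j \<in> borel_measurable borel"
  shows "(\<integral>\<^sup>+\<omega>. discount i n \<omega> * h (Z n \<omega>) (killed b x n \<omega>) \<partial>M) =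
    (\<Sum>z\<in>{1,2}. \<integral>\<^sup>+r. h z r \<partial>state_law b x i n z)"
    (is "?L = _")
proof -
  have "?L =
    (\<integral>\<^sup>+\<omega>. (\<Sum>z\<in>{1,2}. discount i n \<omega> * indicator {\<omega>. Z n \<omega> = z} \<omega> * h z (killed b x n \<omega>)) \<partial>M)"
    (is "nn_integral _ ?lhs = nn_integral _ ?rhs")
  proof (rule nn_integral_cong_AE)
    show "AE \<omega> in M. ?lhs \<omega> = ?rhs \<omega>"
      using AE_regular
    proof eventually_elim
      case (elim \<omega>)
      then have "Z n \<omega> = 1 \<or> Z n \<omega> = 2" by auto
      then show ?case by (elim disjE) (simp_all add: indicator_def)
    qed
  qed
  also have "\<dots> = (\<Sum>z\<in>{1,2}. \<integral>\<^sup>+r. h z r \<partial>state_law b x i n z)"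
    by (subst nn_integral_sum, measurable, intro sum.cong refl nn_integral_state_law[symmetric]) measurable
  finally show ?thesis .
qed

lemma expect_Suc:
  assumes [measurable]: "\<And>j. h j \<in> borel_measurable borel"
  shows "(\<integral>\<^sup>+\<omega>. discount i (Suc n) \<omega> * h (Z (Suc n) \<omega>) (killed b x (Suc n) \<omega>) \<partial>M) =
    (\<integral>\<^sup>+\<omega>. discount i n \<omega> * transfer b h (Z n \<omega>) (killed b x n \<omega>) \<partial>M)"
    (is "?L = _")
proof -
  let ?f = "\<lambda>z k j ((r, t), y). ennreal (exp (- \<delta> * t)) * h j (surplus_step c (b z) r t y)"
  have "?L =
    (\<integral>\<^sup>+\<omega>. discount i n \<omega> * ?f (Z n \<omega>) (K n \<omega>) (Z (Suc n) \<omega>) ((killed b x n \<omega>, T n \<omega>), claim_after n \<omega>) \<partial>M)"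
    by (simp add: discount_Suc killed_Suc mult.assoc)
  also have "\<dots> = (\<Sum>z\<in>{1,2}. \<integral>\<^sup>+r. transfer b h z r \<partial>state_law b x i n z)"
  proof -
    have "?f z k j \<in> borel_measurable ((borel \<Otimes>\<^sub>M borel) \<Otimes>\<^sub>M borel)" for z k :: nat and j
      unfolding case_prod_beta by measurable
    from one_step[where f="?f", OF this] show ?thesis
      unfolding transfer_def by (simp only: prod.case)
  qed
  also have "\<dots> = (\<integral>\<^sup>+\<omega>. discount i n \<omega> * transfer b h (Z n \<omega>) (killed b x n \<omega>) \<partial>M)"
    by (intro expect_state[symmetric] transfer_measurable assms)
  finally show ?thesis .
qed

text \<open>Induction over all \<open>h\<close>: the last transition is absorbed into the test
  function, so the operator acts backwards while the chain runs forwards.\<close>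

lemma expect_eq_transfer:
  assumes "\<And>j. h j \<in> borel_measurable borel"
  shows "(\<integral>\<^sup>+\<omega>. discount i n \<omega> * h (Z n \<omega>) (killed b x n \<omega>) \<partial>M) =
    (transfer b ^^ n) h i x * emeasure M (start_event i)"
  using assms
proof (induction n arbitrary: h)
  case 0
  have "(\<integral>\<^sup>+\<omega>. discount i 0 \<omega> * h (Z 0 \<omega>) (killed b x 0 \<omega>) \<partial>M) =
    (\<integral>\<^sup>+\<omega>. h i x * indicator (start_event i) \<omega> \<partial>M)"
    by (rule nn_integral_cong) (auto simp: discount_0 killed_0 indicator_def)
  then show ?case
    by (simp add: nn_integral_cmult_indicator)
next
  case (Suc n)
  have "(\<integral>\<^sup>+\<omega>. discount i (Suc n) \<omega> * h (Z (Suc n) \<omega>) (killed b x (Suc n) \<omega>) \<partial>M) =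
    (\<integral>\<^sup>+\<omega>. discount i n \<omega> * transfer b h (Z n \<omega>) (killed b x n \<omega>) \<partial>M)"
    by (rule expect_Suc[OF Suc.prems])
  also have "\<dots> = (transfer b ^^ n) (transfer b h) i x * emeasure M (start_event i)"
    by (rule Suc.IH[OF transfer_measurable[OF Suc.prems]])
  finally show ?case
    by (simp add: funpow_swap1)
qed

lemma sum_ennreal_step_prob:
  assumes z: "z \<in> {1,2}"
  shows "(\<Sum>k\<in>{1,2,3}. \<Sum>j\<in>{1,2}. ennreal (step_prob z k j)) = 1"
    (is "?L = _")
proof -
  have "(\<Sum>j\<in>{1,2}. ennreal (step_prob z k j)) = ennreal (\<Sum>j\<in>{1,2}. step_prob z k j)" if "k \<in> {1,2,3}" for k
    by (rule sum_ennreal) (rule step_prob_nonneg[OF z that])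
  then have "?L = (\<Sum>k\<in>{1,2,3}. ennreal (\<Sum>j\<in>{1,2}. step_prob z k j))"
    by (rule sum.cong[OF refl])
  also have "\<dots> = ennreal (\<Sum>k\<in>{1,2,3}. \<Sum>j\<in>{1,2}. step_prob z k j)"
    by (rule sum_ennreal) (intro sum_nonneg step_prob_nonneg z)
  finally show ?thesis by (simp only: sum_step_prob[OF z]) simp
qed

text \<open>The dividends of a sojourn depend neither on its claim nor on the next phase, so these
  integrate to 1 and leave \<open>sojourn_gain\<close>.\<close>

lemma expect_gain:
  "(\<integral>\<^sup>+\<omega>. discount i n \<omega> * (if 0 \<le> killed b x n \<omega>
      then sojourn_dividends c \<delta> (b (Z n \<omega>)) (killed b x n \<omega>) (T n \<omega>) else 0) \<partial>M) =
    (transfer b ^^ n) (sojourn_gain b) i x * emeasure M (start_event i)"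
    (is "?L = _")
proof -
  let ?f = "\<lambda>z (k::nat) (j::nat) ((r, t), y::real). if 0 \<le> r then sojourn_dividends c \<delta> (b z) r t else 0"
  let ?I = "\<lambda>z k j r. \<integral>\<^sup>+t. \<integral>\<^sup>+y. ?f z k j ((r, t), y) \<partial>claim_law k \<partial>sojourn_law z"
  have "?L =
    (\<integral>\<^sup>+\<omega>. discount i n \<omega> * ?f (Z n \<omega>) (K n \<omega>) (Z (Suc n) \<omega>) ((killed b x n \<omega>, T n \<omega>), claim_after n \<omega>) \<partial>M)"
    by simp
  also have "\<dots> = (\<Sum>z\<in>{1,2}. \<integral>\<^sup>+r. (\<Sum>k\<in>{1,2,3}. \<Sum>j\<in>{1,2}. ennreal (step_prob z k j) *
      ?I z k j r) \<partial>state_law b x i n z)"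
    by (rule one_step) (unfold case_prod_beta, measurable)
  also have "\<dots> = (\<Sum>z\<in>{1,2}. \<integral>\<^sup>+r. sojourn_gain b z r \<partial>state_law b x i n z)"
  proof (intro sum.cong refl nn_integral_cong)
    fix z r assume z: "z \<in> {1,2::nat}"
    have "?I z k j r = sojourn_gain b z r" for k j
      using prob_space.emeasure_space_1[OF prob_space_claim_law[of k]]
      by (simp add: sojourn_gain_def)
    moreover have "(\<Sum>k\<in>{1,2,3}. \<Sum>j\<in>{1,2}. ennreal (step_prob z k j) * sojourn_gain b z r) = sojourn_gain b z r"
      unfolding sum_distrib_right[symmetric] sum_ennreal_step_prob[OF z] by simp
    ultimately show "(\<Sum>k\<in>{1,2,3}. \<Sum>j\<in>{1,2}. ennreal (step_prob z k j) *
      ?I z k j r) = sojourn_gain b z r"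
      by (simp only:)
  qed
  also have "\<dots> = (\<integral>\<^sup>+\<omega>. discount i n \<omega> * sojourn_gain b (Z n \<omega>) (killed b x n \<omega>) \<partial>M)"
    by (intro expect_state[symmetric] sojourn_gain_measurable)
  also have "\<dots> = (transfer b ^^ n) (sojourn_gain b) i x * emeasure M (start_event i)"
    by (intro expect_eq_transfer sojourn_gain_measurable)
  finally show ?thesis .
qed

text \<open>The discount factor picked up during one sojourn, in the worst phase.\<close>

definition contraction :: real where
  "contraction = max (total_intensity lam 1 / (total_intensity lam 1 + \<delta>)) (total_intensity lam 2 / (total_intensity lam 2 + \<delta>))"

lemma contraction_bounds: "0 \<le> contraction" "contraction < 1"
  using total_intensity_pos[of 1] total_intensity_pos[of 2] \<delta>_pos
  by (auto simp: contraction_def divide_simps le_max_iff_disj)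

lemma nn_integral_discount_sojourn_le:
  assumes z: "z \<in> {1,2}"
  shows "(\<integral>\<^sup>+t. ennreal (exp (- \<delta> * t)) \<partial>sojourn_law z) \<le> ennreal contraction"
proof -
  let ?l = "total_intensity lam z"
  have pos: "0 < ?l" "0 < ?l + \<delta>"
    using total_intensity_pos[OF z] \<delta>_pos by auto
  have "(\<integral>\<^sup>+t. ennreal (exp (- \<delta> * t)) \<partial>sojourn_law z) =
      (\<integral>\<^sup>+t. ennreal ?l * (ennreal (exp (- (?l + \<delta>) * t)) * indicator {0..} t) \<partial>lborel)"
    unfolding sojourn_law_def
    using nn_integral_exponential_discount[of ?l \<delta> "\<lambda>_. 1"] pos \<delta>_pos
    by (simp add: ennreal_mult mult.assoc)
  also have "\<dots> = ennreal ?l * ennreal (1 / (?l + \<delta>))"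
    by (subst nn_integral_cmult, measurable, subst nn_integral_exp_atLeast[OF pos(2)]) simp
  also have "\<dots> = ennreal (?l / (?l + \<delta>))"
    using pos by (simp add: ennreal_mult[symmetric])
  also have "\<dots> \<le> ennreal contraction"
    using z by (auto simp: contraction_def intro!: ennreal_leI)
  finally show ?thesis .
qed

lemma transfer_mono:
  assumes "\<And>j t y. j \<in> {1,2} \<Longrightarrow> h j (surplus_step c (b z) r t y) \<le> h' j (surplus_step c (b z) r t y)"
  shows "transfer b h z r \<le> transfer b h' z r"
  unfolding transfer_def by (intro sum_mono mult_left_mono nn_integral_mono assms) auto

lemma transfer_const_le:
  assumes z: "z \<in> {1,2}"
  shows "transfer b (\<lambda>_ _. C) z r \<le> ennreal contraction * C"
proof -
  have "(\<integral>\<^sup>+t. \<integral>\<^sup>+y. ennreal (exp (- \<delta> * t)) * C \<partial>claim_law k \<partial>sojourn_law z) \<le> ennreal contraction * C" for k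
    using prob_space.emeasure_space_1[OF prob_space_claim_law[of k]] nn_integral_discount_sojourn_le[OF z]
    by (simp add: nn_integral_multc mult_right_mono)
  then have "transfer b (\<lambda>_ _. C) z r \<le> (\<Sum>k\<in>{1,2,3}. \<Sum>j\<in>{1,2}. ennreal (step_prob z k j) * (ennreal contraction * C))"
    unfolding transfer_def by (intro sum_mono mult_left_mono) auto
  also have "\<dots> = ennreal contraction * C"
    unfolding sum_distrib_right[symmetric] sum_ennreal_step_prob[OF z] by simp
  finally show ?thesis .
qed

lemma transfer_funpow_const_le:
  assumes "z \<in> {1,2}"
  shows "(transfer b ^^ n) (\<lambda>_ _. C) z r \<le> ennreal (contraction ^ n) * C"
  using assms
proof (induction n arbitrary: z r)
  case (Suc n)
  have "(transfer b ^^ Suc n) (\<lambda>_ _. C) z r \<le> transfer b (\<lambda>_ _. ennreal (contraction ^ n) * C) z r"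
    unfolding funpow.simps comp_def using Suc.IH by (intro transfer_mono) auto
  also have "\<dots> \<le> ennreal contraction * (ennreal (contraction ^ n) * C)"
    by (rule transfer_const_le[OF Suc.prems])
  finally show ?case
    using contraction_bounds by (simp add: ennreal_mult mult.assoc)
qed simp

text \<open>The expected discount factors are at most \<open>contraction ^ n\<close>, hence their
  sum is almost surely finite and the discount factors tend to 0, which excludes explosion.\<close>

lemma AE_epoch_at_top:
  assumes i: "i \<in> {1,2}"
  shows "AE \<omega> in M. Z 0 \<omega> = i \<longrightarrow> filterlim (epoch (\<lambda>m. T m \<omega>)) at_top sequentially"
proof -
  have "(\<integral>\<^sup>+\<omega>. discount i n \<omega> \<partial>M) \<le> ennreal (contraction ^ n)" for n
  proof -
    \<comment> \<open>The test function is constantly 1; zero barriers and surplus 0 are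
      placeholders.\<close>
    have "(\<integral>\<^sup>+\<omega>. discount i n \<omega> \<partial>M) = (transfer (\<lambda>_. 0) ^^ n) (\<lambda>_ _. 1) i 0 * emeasure M (start_event i)"
      using expect_eq_transfer[of "\<lambda>_ _. 1" i n "\<lambda>_. 0" 0] by simp
    also have "\<dots> \<le> ennreal (contraction ^ n) * 1"
      using transfer_funpow_const_le[OF i, of n "\<lambda>_. 0" 1 0] by (intro mult_mono emeasure_le_1) auto
    finally show ?thesis by simp
  qed
  then have "(\<Sum>n. \<integral>\<^sup>+\<omega>. discount i n \<omega> \<partial>M) \<le> (\<Sum>n. ennreal (contraction ^ n))"
    by (intro suminf_le) auto
  also have "\<dots> < \<top>"
    using contraction_bounds by (subst suminf_ennreal2) (auto intro!: summable_geometric)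
  finally have "(\<integral>\<^sup>+\<omega>. (\<Sum>n. discount i n \<omega>) \<partial>M) < \<top>"
    by (subst nn_integral_suminf) auto
  then have "AE \<omega> in M. (\<Sum>n. discount i n \<omega>) \<noteq> \<infinity>"
    by (intro nn_integral_PInf_AE) auto
  then show ?thesis
  proof eventually_elim
    case (elim \<omega>)
    show ?case
    proof
      assume "Z 0 \<omega> = i"
      let ?S = "epoch (\<lambda>m. T m \<omega>)"
      have "(\<Sum>n. ennreal (exp (- \<delta> * ?S n))) \<noteq> \<top>"
        using elim \<open>Z 0 \<omega> = i\<close> by (simp add: discount_def)
      then have "summable (\<lambda>n. exp (- \<delta> * ?S n))"
        by (intro summable_suminf_not_top) auto
      then have lim: "(\<lambda>n. exp (- \<delta> * ?S n)) \<longlonglongrightarrow> 0"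
        by (rule summable_LIMSEQ_zero)
      show "filterlim ?S at_top sequentially"
        unfolding filterlim_at_top
      proof
        fix B
        have "eventually (\<lambda>n. exp (- \<delta> * ?S n) < exp (- \<delta> * B)) sequentially"
          by (rule order_tendstoD(2)[OF lim]) simp
        then show "eventually (\<lambda>n. B \<le> ?S n) sequentially"
          by eventually_elim (use \<delta>_pos in simp)
      qed
    qed
  qed
qed

text \<open>Regularity and absence of explosion make the path identity valid almost surely on the
  start event. Monotone convergence moves the expectation into the series, and the probability of
  the start event cancels.\<close>

theorem barrier_value_eq:
  assumes i: "i \<in> {1,2}" and b: "b \<in> barriers"
  shows "barrier_value M c \<delta> Z K T Y b i x = (\<Sum>n. (transfer b ^^ n) (sojourn_gain b) i x)"
proof -
  let ?A = "start_event i"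
  let ?D = "\<lambda>\<omega>. discounted_dividends c \<delta> (\<lambda>n. K n \<omega>) (\<lambda>n. T n \<omega>) (\<lambda>k. Y k \<omega>)
        (dividends c (\<lambda>n. Z n \<omega>) (\<lambda>n. K n \<omega>) (\<lambda>n. T n \<omega>) (\<lambda>k. Y k \<omega>) b x) x"
  let ?g = "\<lambda>n \<omega>. if 0 \<le> killed b x n \<omega> then sojourn_dividends c \<delta> (b (Z n \<omega>)) (killed b x n \<omega>) (T n \<omega>) else 0"
  let ?d = "\<lambda>n \<omega>. ennreal (exp (- \<delta> * epoch (\<lambda>m. T m \<omega>) n)) * ?g n \<omega>"
  have [measurable]: "?g n \<in> borel_measurable M" for n
  proof -
    have [measurable]: "(\<lambda>\<omega>. sojourn_dividends c \<delta> (b (Z n \<omega>)) (killed b x n \<omega>) (T n \<omega>)) \<in> borel_measurable M"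
      by (rule measurable_compose_countable[OF _ Z_measurable[of n], where f="\<lambda>z \<omega>. sojourn_dividends c \<delta> (b z) (killed b x n \<omega>) (T n \<omega>)"]) measurable
    show ?thesis by measurable
  qed
  have P: "emeasure M ?A \<noteq> 0" "emeasure M ?A \<noteq> \<top>"
    using initial_phase_pos[OF i] by (auto simp: emeasure_eq_measure)
  have "AE \<omega> in M. \<omega> \<in> ?A \<longrightarrow>
      ?D \<omega> = (\<Sum>n. ?d n \<omega>)"
    using AE_regular AE_epoch_at_top[OF i]
  proof eventually_elim
    case (elim \<omega>)
    show ?case
    proof
      assume "\<omega> \<in> ?A"
      then interpret barrier_path c \<delta> "\<lambda>n. Z n \<omega>" "\<lambda>n. K n \<omega>" "\<lambda>n. T n \<omega>" "\<lambda>k. Y k \<omega>" b x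
      proof unfold_locales
        fix n
        have "Z n \<omega> \<in> {1,2}" using elim by blast
        then show "0 \<le> b (Z n \<omega>)" using b unfolding barriers_def by blast
      qed (use elim c_pos \<open>\<omega> \<in> ?A\<close> in auto)
      show "?D \<omega> = (\<Sum>n. ?d n \<omega>)"
        unfolding discounted_dividends_eq_suminf killed_def ..
    qed
  qed
  then have "barrier_value M c \<delta> Z K T Y b i x = (\<integral>\<^sup>+\<omega>. (\<Sum>n. ?d n \<omega>) \<partial>uniform_measure M ?A)"
    unfolding barrier_value_def by (intro nn_integral_cong_AE AE_uniform_measureI) auto
  also have "\<dots> = (\<integral>\<^sup>+\<omega>. (\<Sum>n. ?d n \<omega>) * indicator ?A \<omega> \<partial>M) / emeasure M ?A"
    by (rule nn_integral_uniform_measure) measurable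
  also have "(\<integral>\<^sup>+\<omega>. (\<Sum>n. ?d n \<omega>) * indicator ?A \<omega> \<partial>M) = (\<integral>\<^sup>+\<omega>. (\<Sum>n. discount i n \<omega> * ?g n \<omega>) \<partial>M)"
    by (intro nn_integral_cong) (auto simp: discount_def indicator_def)
  also have "\<dots> = (\<Sum>n. \<integral>\<^sup>+\<omega>. discount i n \<omega> * ?g n \<omega> \<partial>M)"
    by (rule nn_integral_suminf) measurable
  also have "\<dots> = (\<Sum>n. (transfer b ^^ n) (sojourn_gain b) i x) * emeasure M ?A"
    unfolding expect_gain by (rule ennreal_suminf_multc)
  also have "\<dots> / emeasure M ?A = (\<Sum>n. (transfer b ^^ n) (sojourn_gain b) i x)"
    by (rule mult_divide_eq_ennreal[OF P])
  finally show ?thesis .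
qed

end

section \<open>The value function: fixed point, growth and comparison\<close>

context phase_type_risk_model
begin

definition value_fun :: "(nat \<Rightarrow> real) \<Rightarrow> nat \<Rightarrow> real \<Rightarrow> ennreal" where
  "value_fun b z r = (\<Sum>n. (transfer b ^^ n) (sojourn_gain b) z r)"

lemma value_fun_measurable: "value_fun b z \<in> borel_measurable borel"
proof -
  have [measurable]: "(transfer b ^^ n) (sojourn_gain b) z \<in> borel_measurable borel" for n
    by (intro transfer_funpow_measurable sojourn_gain_measurable)
  show ?thesis unfolding value_fun_def[abs_def] by measurable
qed

lemma transfer_sum:
  assumes [measurable]: "\<And>n j. h n j \<in> borel_measurable borel"
  shows "transfer b (\<lambda>j r. \<Sum>n. h n j r) z r = (\<Sum>n. transfer b (h n) z r)"
proof -
  interpret S: sigma_finite_measure "sojourn_law z" by (rule sigma_finite_sojourn_law)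
  have "(\<integral>\<^sup>+t. \<integral>\<^sup>+y. ennreal (exp (- \<delta> * t)) * (\<Sum>n. h n j (surplus_step c (b z) r t y)) \<partial>claim_law k \<partial>sojourn_law z) =
    (\<Sum>n. \<integral>\<^sup>+t. \<integral>\<^sup>+y. ennreal (exp (- \<delta> * t)) * h n j (surplus_step c (b z) r t y) \<partial>claim_law k \<partial>sojourn_law z)" for k j
  proof -
    interpret C: prob_space "claim_law k" by (rule prob_space_claim_law)
    show ?thesis
      unfolding ennreal_suminf_cmult[symmetric]
      by (subst nn_integral_suminf, measurable, subst nn_integral_suminf, measurable)
  qed
  then show ?thesis
    unfolding transfer_def by (simp add: suminf_add[symmetric])
qed

text \<open>Splitting off the first term of the Neumann series; \<open>transfer_sum\<close> lets the
  operator pass through the rest.\<close>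

lemma value_fun_fixed_point: "value_fun b z r = sojourn_gain b z r + transfer b (value_fun b) z r"
proof -
  have "value_fun b z r = (\<Sum>n. (transfer b ^^ Suc n) (sojourn_gain b) z r) + (transfer b ^^ 0) (sojourn_gain b) z r"
    unfolding value_fun_def
    using suminf_offset[of "\<lambda>n. (transfer b ^^ n) (sojourn_gain b) z r" "Suc 0"] by simp
  also have "(\<Sum>n. (transfer b ^^ Suc n) (sojourn_gain b) z r) = transfer b (value_fun b) z r"
    unfolding value_fun_def[abs_def]
    by (subst transfer_sum) (auto intro: transfer_funpow_measurable sojourn_gain_measurable)
  finally show ?thesis by (simp add: add.commute)
qed

lemma AE_claim_law_nonneg: "AE y in claim_law k. 0 \<le> y"
  unfolding claim_law_def
  by (cases "k = 3") (auto simp: AE_density AE_return exponential_density_def intro!: AE_I2 split: if_splits)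

lemma AE_sojourn_law_nonneg: "AE t in sojourn_law z. 0 \<le> t"
  unfolding sojourn_law_def
  by (auto simp: AE_density exponential_density_def intro!: AE_I2 split: if_splits)

text \<open>After a sojourn the surplus is negative or at most \<open>B\<close>, so a bound for
  \<open>h\<close> on \<open>[0, B]\<close> is enough. This makes the contraction usable for
  functions of linear growth.\<close>

lemma transfer_bounded:
  assumes z: "z \<in> {1,2}" and B: "b z \<le> B"
    and h: "\<And>j r. j \<in> {1,2} \<Longrightarrow> r < 0 \<Longrightarrow> h j r = 0" "\<And>j r. j \<in> {1,2} \<Longrightarrow> 0 \<le> r \<Longrightarrow> r \<le> B \<Longrightarrow> h j r \<le> C"
  shows "transfer b h z r \<le> ennreal contraction * C"
proof -
  have inner: "(\<integral>\<^sup>+y. ennreal (exp (- \<delta> * t)) * h j (surplus_step c (b z) r t y) \<partial>claim_law k) \<le>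
      (\<integral>\<^sup>+y. ennreal (exp (- \<delta> * t)) * C \<partial>claim_law k)" if j: "j \<in> {1,2}" for k j t
  proof (rule nn_integral_mono_AE)
    show "AE y in claim_law k. ennreal (exp (- \<delta> * t)) * h j (surplus_step c (b z) r t y) \<le> ennreal (exp (- \<delta> * t)) * C"
      using AE_claim_law_nonneg
    proof eventually_elim
      case (elim y)
      let ?r = "surplus_step c (b z) r t y"
      have "?r < 0 \<or> ?r \<le> B"
        using B elim by (auto simp: surplus_step_def)
      then have "h j ?r \<le> C"
        using h(1)[OF j, of ?r] h(2)[OF j, of ?r] by (cases "?r < 0") auto
      then show ?case by (rule mult_left_mono) simp
    qed
  qed
  have "transfer b h z r \<le> transfer b (\<lambda>_ _. C) z r"
    unfolding transfer_def
  proof (intro sum_mono mult_left_mono)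
    fix k j :: nat assume j: "j \<in> {1,2}"
    show "(\<integral>\<^sup>+t. \<integral>\<^sup>+y. ennreal (exp (- \<delta> * t)) * h j (surplus_step c (b z) r t y) \<partial>claim_law k \<partial>sojourn_law z) \<le>
      (\<integral>\<^sup>+t. \<integral>\<^sup>+y. ennreal (exp (- \<delta> * t)) * C \<partial>claim_law k \<partial>sojourn_law z)"
      by (rule nn_integral_mono) (rule inner[OF j])
  qed simp
  also have "\<dots> \<le> ennreal contraction * C"
    by (rule transfer_const_le[OF z])
  finally show ?thesis .
qed

lemma transfer_neg:
  assumes "r < 0" "\<And>j. j \<in> {1,2} \<Longrightarrow> h j r = 0"
  shows "transfer b h z r = 0"
  using assms by (simp add: transfer_def surplus_step_def)

lemma transfer_funpow_neg:
  assumes "r < 0" "\<And>j. j \<in> {1,2} \<Longrightarrow> h j r = 0" "z \<in> {1,2}"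
  shows "(transfer b ^^ n) h z r = 0"
  using assms(3) by (induction n arbitrary: z) (auto intro!: transfer_neg assms)

text \<open>The power is \<open>Suc n\<close> because one sojourn must pass before the surplus is at
  most \<open>B\<close>; the starting surplus \<open>r\<close> is arbitrary.\<close>

lemma transfer_funpow_bounded:
  assumes z: "z \<in> {1,2}" and B: "\<And>z. z \<in> {1,2} \<Longrightarrow> b z \<le> B"
    and h: "\<And>j r. j \<in> {1,2} \<Longrightarrow> r < 0 \<Longrightarrow> h j r = 0" "\<And>j r. j \<in> {1,2} \<Longrightarrow> 0 \<le> r \<Longrightarrow> r \<le> B \<Longrightarrow> h j r \<le> C"
  shows "(transfer b ^^ Suc n) h z r \<le> ennreal (contraction ^ Suc n) * C"
  using z
proof (induction n arbitrary: z r)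
  case 0
  have "transfer b h z r \<le> ennreal contraction * C"
    by (rule transfer_bounded[where b=b and z=z and B=B, OF 0 B[OF 0]]) (use h in auto)
  then show ?case by simp
next
  case (Suc n)
  have "transfer b ((transfer b ^^ Suc n) h) z r \<le> ennreal contraction * (ennreal (contraction ^ Suc n) * C)"
  proof (rule transfer_bounded[where b=b and z=z and B=B, OF Suc.prems B[OF Suc.prems]])
    fix j :: nat and r :: real assume j: "j \<in> {1,2}"
    show "r < 0 \<Longrightarrow> (transfer b ^^ Suc n) h j r = 0"
      using transfer_funpow_neg[of r h j "Suc n" b] h(1) j by blast
    show "(transfer b ^^ Suc n) h j r \<le> ennreal (contraction ^ Suc n) * C"
      by (rule Suc.IH[OF j])
  qed
  then show ?case
    using contraction_bounds by (simp add: ennreal_mult mult.assoc)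
qed

lemma sojourn_gain_neg: "r < 0 \<Longrightarrow> sojourn_gain b z r = 0"
  by (simp add: sojourn_gain_def)

text \<open>A perpetual payment at rate \<open>c\<close> is worth \<open>c / \<delta>\<close>, and
  the lump sum is at most \<open>r\<close>.\<close>

lemma sojourn_gain_le:
  assumes z: "z \<in> {1,2}" and b: "0 \<le> b z" and r: "0 \<le> r"
  shows "sojourn_gain b z r \<le> ennreal (r + c / \<delta>)"
proof -
  interpret S: prob_space "sojourn_law z" by (rule prob_space_sojourn_law[OF z])
  have "sojourn_dividends c \<delta> (b z) r t \<le> ennreal (r + c / \<delta>)" for t
  proof -
    have "(\<integral>\<^sup>+s. ennreal (c * exp (- \<delta> * s)) * indicator {s. 0 \<le> s \<and> s \<le> t \<and> b z \<le> r + c * s} s \<partial>lborel) \<le>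
        (\<integral>\<^sup>+s. ennreal c * (ennreal (exp (- \<delta> * s)) * indicator {0..} s) \<partial>lborel)"
      using c_pos by (intro nn_integral_mono) (auto simp: indicator_def ennreal_mult)
    also have "\<dots> = ennreal c * ennreal (exp (- \<delta> * 0) / \<delta>)"
      by (subst nn_integral_cmult, measurable, subst nn_integral_exp_atLeast[OF \<delta>_pos]) simp
    also have "\<dots> = ennreal (c / \<delta>)"
      using c_pos \<delta>_pos by (simp add: ennreal_mult[symmetric])
    finally have "sojourn_dividends c \<delta> (b z) r t \<le> ennreal (max 0 (r - b z)) + ennreal (c / \<delta>)"
      unfolding sojourn_dividends_def by (rule add_left_mono)
    also have "\<dots> = ennreal (max 0 (r - b z) + c / \<delta>)"
      using c_pos \<delta>_pos by (intro ennreal_plus[symmetric]) auto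
    also have "\<dots> \<le> ennreal (r + c / \<delta>)"
      using b r by (intro ennreal_leI) auto
    finally show ?thesis .
  qed
  then have "sojourn_gain b z r \<le> (\<integral>\<^sup>+t. ennreal (r + c / \<delta>) \<partial>sojourn_law z)"
    using r by (simp add: sojourn_gain_def nn_integral_mono del: nn_integral_const)
  then show ?thesis
    using S.emeasure_space_1 by simp
qed

lemma value_fun_neg: "r < 0 \<Longrightarrow> z \<in> {1,2} \<Longrightarrow> value_fun b z r = 0"
  unfolding value_fun_def using transfer_funpow_neg[of r "sojourn_gain b" z _ b] sojourn_gain_neg by simp

text \<open>Only the gain of the first sojourn grows with the initial surplus, with slope at most 1;
  the later terms are dominated by a geometric series.\<close>

lemma value_fun_le:
  assumes b: "b \<in> barriers"
  obtains C where "0 \<le> C" "\<And>z r. z \<in> {1,2} \<Longrightarrow> 0 \<le> r \<Longrightarrow> value_fun b z r \<le> ennreal (r + C)"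
proof -
  define B where "B = max (b 1) (b 2)"
  have B: "b z \<le> B" if "z \<in> {1,2}" for z using that by (auto simp: B_def)
  have b0: "0 \<le> b z" if "z \<in> {1,2}" for z using b that by (auto simp: barriers_def)
  have "0 \<le> B" using b0[of 1] B[of 1] by simp
  \<comment> \<open>A bound for the gain of one sojourn that starts in
    \<open>[0, B]\<close>.\<close>
  define C where "C = B + c / \<delta>"
  have "0 \<le> C" using \<open>0 \<le> B\<close> c_pos \<delta>_pos by (simp add: C_def)
  have "value_fun b z r \<le> ennreal (r + (c / \<delta> + C * (contraction / (1 - contraction))))"
    if z: "z \<in> {1,2}" and r: "0 \<le> r" for z r
  proof -
    have "value_fun b z r = (\<Sum>n. (transfer b ^^ Suc n) (sojourn_gain b) z r) + sojourn_gain b z r"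
      unfolding value_fun_def using suminf_offset[of "\<lambda>n. (transfer b ^^ n) (sojourn_gain b) z r" "Suc 0"] by simp
    also have "\<dots> \<le> (\<Sum>n. ennreal (contraction ^ Suc n) * ennreal C) + ennreal (r + c / \<delta>)"
    proof (intro add_mono suminf_le sojourn_gain_le z b0 r)
      show "(transfer b ^^ Suc n) (sojourn_gain b) z r \<le> ennreal (contraction ^ Suc n) * ennreal C" for n
      proof (rule transfer_funpow_bounded[OF z B])
        fix j :: nat and r :: real assume j: "j \<in> {1,2}" "0 \<le> r" "r \<le> B"
        have "sojourn_gain b j r \<le> ennreal (r + c / \<delta>)"
          by (rule sojourn_gain_le[where b=b and z=j, OF j(1) b0[OF j(1)] j(2)])
        also have "\<dots> \<le> ennreal C" using j by (intro ennreal_leI) (simp add: C_def)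
        finally show "sojourn_gain b j r \<le> ennreal C" .
      qed (auto simp: sojourn_gain_neg)
    qed auto
    also have "(\<Sum>n. ennreal (contraction ^ Suc n) * ennreal C) = ennreal (C * (contraction / (1 - contraction)))"
    proof -
      have "(\<lambda>n. C * contraction ^ Suc n) sums (C * (contraction * (1 / (1 - contraction))))"
        unfolding power_Suc using contraction_bounds by (intro sums_mult geometric_sums) simp
      then have "(\<Sum>n. ennreal (C * contraction ^ Suc n)) = ennreal (C * (contraction * (1 / (1 - contraction))))"
        using contraction_bounds \<open>0 \<le> C\<close> by (intro suminf_ennreal_eq) auto
      then show ?thesis
        using contraction_bounds \<open>0 \<le> C\<close> by (simp add: ennreal_mult[symmetric] mult.commute del: ennreal_suminf_multc)
    qed
    also have "\<dots> + ennreal (r + c / \<delta>) = ennreal (r + (c / \<delta> + C * (contraction / (1 - contraction))))"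
      using contraction_bounds \<open>0 \<le> C\<close> c_pos \<delta>_pos r
      by (subst ennreal_plus[symmetric]) (auto simp: algebra_simps)
    finally show ?thesis .
  qed
  moreover have "0 \<le> c / \<delta> + C * (contraction / (1 - contraction))"
    using contraction_bounds \<open>0 \<le> C\<close> c_pos \<delta>_pos by simp
  ultimately show ?thesis using that by blast
qed

text \<open>Iterating the inequality \<open>n\<close> times leaves a remainder of order \<open>contraction ^ n\<close>, because \<open>h\<close> is
  bounded on the surplus levels that can be reached after one sojourn.\<close>

lemma subsolution_le_value_fun:
  assumes b: "b \<in> barriers" and z: "z \<in> {1,2}" and C: "0 \<le> C"
    and meas: "\<And>j. h j \<in> borel_measurable borel"
    and neg: "\<And>j r. j \<in> {1,2} \<Longrightarrow> r < 0 \<Longrightarrow> h j r = 0"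
    and le: "\<And>j r. j \<in> {1,2} \<Longrightarrow> 0 \<le> r \<Longrightarrow> h j r \<le> ennreal (r + C)"
    and sub: "\<And>j r. j \<in> {1,2} \<Longrightarrow> 0 \<le> r \<Longrightarrow> h j r \<le> sojourn_gain b j r + transfer b h j r"
  shows "h z r \<le> value_fun b z r"
proof -
  define B where "B = max (b 1) (b 2)"
  have B: "b z \<le> B" if "z \<in> {1,2}" for z using that by (auto simp: B_def)
  have sub': "h j r \<le> sojourn_gain b j r + transfer b h j r" if "j \<in> {1,2}" for j r
    using sub[OF that] neg[OF that] by (cases "0 \<le> r") auto
  have iter: "h z r \<le> (\<Sum>m<n. (transfer b ^^ m) (sojourn_gain b) z r) + (transfer b ^^ n) h z r" if "z \<in> {1,2}" for z r n
    using that
  proof (induction n arbitrary: z r)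
    case (Suc n)
    have "(transfer b ^^ n) h z r \<le> (transfer b ^^ n) (\<lambda>j r. sojourn_gain b j r + transfer b h j r) z r"
      using Suc.prems by (induction n arbitrary: z r) (auto intro!: transfer_mono sub')
    also have "\<dots> = (transfer b ^^ n) (sojourn_gain b) z r + (transfer b ^^ n) (transfer b h) z r"
    proof -
      have add: "transfer b (\<lambda>j r. f j r + g j r) z r = transfer b f z r + transfer b g z r"
        if [measurable]: "\<And>j. f j \<in> borel_measurable borel" "\<And>j. g j \<in> borel_measurable borel" for f g z r
      proof -
        interpret S: sigma_finite_measure "sojourn_law z" by (rule sigma_finite_sojourn_law)
        have "(\<integral>\<^sup>+t. \<integral>\<^sup>+y. ennreal (exp (- \<delta> * t)) * (f j (surplus_step c (b z) r t y) + g j (surplus_step c (b z) r t y)) \<partial>claim_law k \<partial>sojourn_law z) =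
          (\<integral>\<^sup>+t. \<integral>\<^sup>+y. ennreal (exp (- \<delta> * t)) * f j (surplus_step c (b z) r t y) \<partial>claim_law k \<partial>sojourn_law z) +
          (\<integral>\<^sup>+t. \<integral>\<^sup>+y. ennreal (exp (- \<delta> * t)) * g j (surplus_step c (b z) r t y) \<partial>claim_law k \<partial>sojourn_law z)" for k j
        proof -
          interpret C: prob_space "claim_law k" by (rule prob_space_claim_law)
          show ?thesis
            unfolding distrib_left
            by (subst nn_integral_add, measurable, subst nn_integral_add, measurable)
        qed
        then show ?thesis
          unfolding transfer_def by (simp only: distrib_left sum.distrib)
      qed
      have "(transfer b ^^ n) (\<lambda>j r. f j r + g j r) = (\<lambda>z r. (transfer b ^^ n) f z r + (transfer b ^^ n) g z r)"
        if "\<And>j. f j \<in> borel_measurable borel" "\<And>j. g j \<in> borel_measurable borel" for f g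
      proof (induction n)
        case (Suc n)
        have "(transfer b ^^ Suc n) (\<lambda>j r. f j r + g j r) =
            transfer b (\<lambda>z r. (transfer b ^^ n) f z r + (transfer b ^^ n) g z r)"
          by (simp add: Suc)
        also have "\<dots> = (\<lambda>z r. (transfer b ^^ Suc n) f z r + (transfer b ^^ Suc n) g z r)"
          by (simp add: fun_eq_iff add transfer_funpow_measurable that)
        finally show ?case .
      qed simp
      then show ?thesis
        using sojourn_gain_measurable transfer_measurable[OF meas] by simp
    qed
    finally have "(transfer b ^^ n) h z r \<le> (transfer b ^^ n) (sojourn_gain b) z r + (transfer b ^^ Suc n) h z r"
      by (simp add: funpow_swap1)
    then show ?case
      using Suc.IH[OF Suc.prems, of r] by (simp add: add.assoc) (meson add_left_mono order_trans)
  qed simp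
  have "h z r \<le> value_fun b z r + ennreal (contraction ^ Suc n * (max 0 B + C))" for n
  proof -
    have "(transfer b ^^ Suc n) h z r \<le> ennreal (contraction ^ Suc n) * ennreal (max 0 B + C)"
    proof (rule transfer_funpow_bounded[OF z B neg])
      fix j :: nat and r :: real assume j: "j \<in> {1,2}" "0 \<le> r" "r \<le> B"
      show "h j r \<le> ennreal (max 0 B + C)"
        using le[OF j(1,2)] by (rule order_trans) (use j in \<open>auto intro!: ennreal_leI\<close>)
    qed
    moreover have "(\<Sum>m<Suc n. (transfer b ^^ m) (sojourn_gain b) z r) \<le> value_fun b z r"
      unfolding value_fun_def by (intro sum_le_suminf) auto
    ultimately show ?thesis
      using iter[OF z, of r "Suc n"] contraction_bounds C
      by (simp only: ennreal_mult'[symmetric] zero_le_power) (meson add_mono order_trans)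
  qed
  moreover have "(\<lambda>n. value_fun b z r + ennreal (contraction ^ Suc n * (max 0 B + C))) \<longlonglongrightarrow> value_fun b z r + ennreal (0 * (max 0 B + C))"
    using contraction_bounds by (intro tendsto_intros tendsto_ennrealI LIMSEQ_Suc LIMSEQ_realpow_zero) auto
  ultimately show ?thesis
    by (intro tendsto_lowerbound[of _ "value_fun b z r" sequentially "h z r"]) auto
qed

end

section \<open>One sojourn with a fixed continuation value\<close>

text \<open>Below the barrier this is the integral over the sojourn time after substituting
  \<open>u = x + c * t\<close>; the last summand is everything after reaching \<open>\<eta>\<close>,
  worth \<open>(c + H \<eta>) / a\<close> at that moment. It is the solution of
  \<open>c * P' = a * P - H\<close> with this boundary value.\<close>

definition barrier_profile :: "real \<Rightarrow> real \<Rightarrow> (real \<Rightarrow> real) \<Rightarrow> real \<Rightarrow> real \<Rightarrow> real" where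
  "barrier_profile c a H \<eta> x =
     (if x \<le> \<eta> then exp (a * x / c) * (integral {x..\<eta>} (\<lambda>u. exp (- a * u / c) * H u / c) + exp (- a * \<eta> / c) * (c + H \<eta>) / a)
      else x - \<eta> + (c + H \<eta>) / a)"

lemma
  fixes f :: "real \<Rightarrow> real"
  assumes [measurable]: "f \<in> borel_measurable borel"
    and f: "\<And>x. x \<in> {p..q} \<Longrightarrow> 0 \<le> f x \<and> f x \<le> B"
  shows integrable_on_bounded: "f integrable_on {p..q}"
    and nn_integral_bounded: "(\<integral>\<^sup>+x. ennreal (f x) * indicator {p..q} x \<partial>lborel) = ennreal (integral {p..q} f)"
proof -
  have "integrable lborel (\<lambda>x. indicator {p..q} x *\<^sub>R f x)"
    using f by (intro integrableI_bounded_set_indicator[where B=B]) (auto intro!: AE_I2 simp: emeasure_lborel_Icc_eq)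
  then have "set_integrable lborel {p..q} f"
    by (simp add: set_integrable_def)
  then show int: "f integrable_on {p..q}"
    by (rule set_borel_integral_eq_integral)
  let ?g = "\<lambda>x. if x \<in> {p..q} then f x else 0"
  have "(?g has_integral integral {p..q} f) UNIV"
    unfolding has_integral_restrict_UNIV using int by (rule integrable_integral)
  then have "(\<integral>\<^sup>+x. ?g x \<partial>lborel) = ennreal (integral {p..q} f)"
    using f by (intro nn_integral_has_integral_lborel) auto
  moreover have "(\<integral>\<^sup>+x. ?g x \<partial>lborel) = (\<integral>\<^sup>+x. ennreal (f x) * indicator {p..q} x \<partial>lborel)"
    by (intro nn_integral_cong) (auto simp: indicator_def)
  ultimately show "(\<integral>\<^sup>+x. ennreal (f x) * indicator {p..q} x \<partial>lborel) = ennreal (integral {p..q} f)"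
    by simp
qed

text \<open>The expected discounted dividends and continuation value of one sojourn with barrier \<open>\<eta>\<close>.\<close>

lemma nn_integral_barrier_profile:
  assumes c: "0 < c" and a: "0 < a" and r: "0 \<le> r"
    and [measurable]: "H \<in> borel_measurable borel" and H: "\<And>u. 0 \<le> u \<Longrightarrow> u \<le> \<eta> \<Longrightarrow> 0 \<le> H u \<and> H u \<le> B" and \<eta>: "0 \<le> \<eta>"
  shows "ennreal (max 0 (r - \<eta>)) + (\<integral>\<^sup>+t. ennreal (c * exp (- a * t)) * indicator {t. 0 \<le> t \<and> \<eta> \<le> r + c * t} t \<partial>lborel) +
      (\<integral>\<^sup>+t. ennreal (exp (- a * t) * H (min (r + c * t) \<eta>)) * indicator {0..} t \<partial>lborel) =
    ennreal (barrier_profile c a H \<eta> r)"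
proof -
  let ?f = "\<lambda>t. ennreal (exp (- a * t) * H (min (r + c * t) \<eta>))"
  \<comment> \<open>The time at which the barrier is reached, 0 if the surplus starts above it; from
    \<open>h\<close> on the surplus rests at \<open>\<eta>\<close>.\<close>
  define h where "h = max 0 ((\<eta> - r) / c)"
  have "0 \<le> h" by (simp add: h_def)
  have H\<eta>: "0 \<le> H \<eta>" using H \<eta> by auto
  have h: "0 \<le> t \<and> \<eta> \<le> r + c * t \<longleftrightarrow> h \<le> t" for t
    using c by (auto simp: h_def field_simps)
  have 1: "(\<integral>\<^sup>+t. ennreal (c * exp (- a * t)) * indicator {t. 0 \<le> t \<and> \<eta> \<le> r + c * t} t \<partial>lborel) =
      ennreal (c * (exp (- a * h) / a))"
  proof -
    have "(\<integral>\<^sup>+t. ennreal (c * exp (- a * t)) * indicator {t. 0 \<le> t \<and> \<eta> \<le> r + c * t} t \<partial>lborel) =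
        (\<integral>\<^sup>+t. ennreal c * (ennreal (exp (- a * t)) * indicator {h..} t) \<partial>lborel)"
      using c h by (intro nn_integral_cong) (auto simp: indicator_def ennreal_mult)
    also have "\<dots> = ennreal c * ennreal (exp (- a * h) / a)"
      by (subst nn_integral_cmult, measurable, subst nn_integral_exp_atLeast[OF a]) simp
    also have "\<dots> = ennreal (c * (exp (- a * h) / a))"
      using c a by (simp add: ennreal_mult[symmetric])
    finally show ?thesis .
  qed
  have 2: "(\<integral>\<^sup>+t. ?f t * indicator {h..} t \<partial>lborel) =
      ennreal (H \<eta> * (exp (- a * h) / a))"
  proof -
    have "(\<integral>\<^sup>+t. ?f t * indicator {h..} t \<partial>lborel) =
        (\<integral>\<^sup>+t. ennreal (H \<eta>) * (ennreal (exp (- a * t)) * indicator {h..} t) \<partial>lborel)"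
      (is "nn_integral _ ?lhs = nn_integral _ ?rhs")
    proof (rule nn_integral_cong)
      fix t
      show "?lhs t = ?rhs t"
      proof (cases "h \<le> t")
        case True
        then have "min (r + c * t) \<eta> = \<eta>" using h[of t] by simp
        then show ?thesis using H\<eta> by (simp add: ennreal_mult mult_ac)
      qed simp
    qed
    also have "\<dots> = ennreal (H \<eta>) * ennreal (exp (- a * h) / a)"
      by (subst nn_integral_cmult, measurable, subst nn_integral_exp_atLeast[OF a]) simp
    also have "\<dots> = ennreal (H \<eta> * (exp (- a * h) / a))"
      using H\<eta> a by (simp add: ennreal_mult[symmetric])
    finally show ?thesis .
  qed
  have split: "(\<integral>\<^sup>+t. ?f t * indicator {0..} t \<partial>lborel) =
      (\<integral>\<^sup>+t. ?f t * indicator {0..<h} t \<partial>lborel) +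
      (\<integral>\<^sup>+t. ?f t * indicator {h..} t \<partial>lborel)"
    using \<open>0 \<le> h\<close> by (subst nn_integral_add[symmetric]) (auto intro!: nn_integral_cong split: split_indicator)
  show ?thesis
  proof (cases "r \<le> \<eta>")
    case False
    then have "h = 0" using c by (simp add: h_def field_simps)
    then show ?thesis
      unfolding split 1 2 using False c a H\<eta>
      by (simp add: barrier_profile_def ennreal_plus[symmetric] add_divide_distrib del: ennreal_plus)
  next
    case True
    then have h_eq: "h = (\<eta> - r) / c" using c by (simp add: h_def field_simps)
    let ?F = "\<lambda>u. exp (- a * u / c) * H u / c"
    have F_bound: "0 \<le> ?F u \<and> ?F u \<le> B / c" if "u \<in> {r..\<eta>}" for u
    proof -
      have "0 \<le> H u" "H u \<le> B" "0 \<le> u" using H[of u] that r by auto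
      then have "exp (- a * u / c) * H u \<le> 1 * B"
        using a c by (intro mult_mono) (auto simp: field_simps)
      then show ?thesis using c \<open>0 \<le> H u\<close> by (auto intro: divide_right_mono)
    qed
    have F: "?F integrable_on {r..\<eta>}" "(\<integral>\<^sup>+u. ennreal (?F u) * indicator {r..\<eta>} u \<partial>lborel) = ennreal (integral {r..\<eta>} ?F)"
      using integrable_on_bounded[OF _ F_bound] nn_integral_bounded[OF _ F_bound] by simp_all
    define I where "I = integral {r..\<eta>} ?F"
    have F_nonneg: "0 \<le> I"
      unfolding I_def using F(1) H r c by (intro integral_nonneg) auto
    have "(\<integral>\<^sup>+t. ?f t * indicator {0..<h} t \<partial>lborel) =
        ennreal (1 / c) * (\<integral>\<^sup>+u. ?f (- r / c + 1 / c * u) *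
          indicator {0..<h} (- r / c + 1 / c * u) \<partial>lborel)"
      using c by (subst nn_integral_real_affine[where c="1/c" and t="- r / c"]) auto
    also have "\<dots> = ennreal (1 / c) * (\<integral>\<^sup>+u. ennreal (exp (a * r / c) * c) * (ennreal (?F u) * indicator {r..\<eta>} u) \<partial>lborel)"
    proof (intro arg_cong2[where f="(*)"] refl nn_integral_cong_AE)
      show "AE u in lborel. ?f (- r / c + 1 / c * u) *
          indicator {0..<h} (- r / c + 1 / c * u) =
        ennreal (exp (a * r / c) * c) * (ennreal (?F u) * indicator {r..\<eta>} u)"
        using AE_lborel_singleton[of \<eta>]
      proof eventually_elim
        case (elim u)
        have ind: "- r / c + 1 / c * u \<in> {0..<h} \<longleftrightarrow> u \<in> {r..\<eta>}"
          using c elim by (auto simp: h_eq field_simps)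
        have arg: "r + c * (- r / c + 1 / c * u) = u"
          using c by (simp add: field_simps)
        have e: "exp (- a * (- r / c + 1 / c * u)) = exp (a * r / c) * exp (- a * u / c)"
          by (simp add: exp_add[symmetric] algebra_simps)
        show ?case
        proof (cases "u \<in> {r..\<eta>}")
          case True
          then have "0 \<le> H u" "min u \<eta> = u" using H[of u] r by auto
          moreover have "exp (a * r / c) * exp (- a * u / c) * H u = exp (a * r / c) * c * ?F u"
            using c by simp
          ultimately show ?thesis
            using True c unfolding arg e by (simp only: ind indicator_simps mult_1_right) (simp add: ennreal_mult[symmetric])
        next
          case False
          then show ?thesis unfolding indicator_def ind by auto
        qed
      qed
    qed
    also have "\<dots> = ennreal (1 / c) * (ennreal (exp (a * r / c) * c) * ennreal (integral {r..\<eta>} ?F))"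
      by (subst nn_integral_cmult, measurable) (simp only: F(2))
    also have "\<dots> = ennreal (1 / c * (exp (a * r / c) * c * I))"
      unfolding I_def[symmetric] using F_nonneg
      by (simp only: ennreal_mult less_imp_le[OF c] exp_ge_zero zero_le_divide_1_iff mult_nonneg_nonneg mult.assoc)
    also have "1 / c * (exp (a * r / c) * c * I) = exp (a * r / c) * I"
      using c by simp
    finally have 3: "(\<integral>\<^sup>+t. ?f t * indicator {0..<h} t \<partial>lborel) =
      ennreal (exp (a * r / c) * I)" .
    have e: "exp (- a * h) = exp (a * r / c) * exp (- a * \<eta> / c)"
      using c by (simp add: h_eq exp_add[symmetric] field_simps)
    have "c * (exp (- a * h) / a) + (exp (a * r / c) * I + H \<eta> * (exp (- a * h) / a)) =
        barrier_profile c a H \<eta> r"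
      unfolding barrier_profile_def e I_def[symmetric] using True
      by (simp add: distrib_left add_divide_distrib algebra_simps)
    then show ?thesis
      unfolding split 1 2 3 using True c a H\<eta> F_nonneg
      by (simp add: ennreal_plus[symmetric] del: ennreal_plus)
  qed
qed

section \<open>The one-step operator expressed by barrier profiles\<close>

context phase_type_risk_model
begin

abbreviation claim_integrand :: "(nat \<Rightarrow> real \<Rightarrow> real) \<Rightarrow> real \<Rightarrow> real \<Rightarrow> real" where
  "claim_integrand v y u \<equiv> (\<pi> 1 * v 1 u + \<pi> 2 * v 2 u) * (\<beta> * exp (- \<beta> * (y - u)))"

text \<open>\<open>claim_mean v y\<close> is the mean value of the state after a claim at surplus \<open>y\<close>.\<close>

definition claim_mean :: "(nat \<Rightarrow> real \<Rightarrow> real) \<Rightarrow> real \<Rightarrow> real" where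
  "claim_mean v y = enn2real (\<integral>\<^sup>+u. ennreal (claim_integrand v y u) *
     indicator {0..y} u \<partial>lborel)"

text \<open>Weights are intensities rather than jump probabilities, because the factor
  \<open>total_intensity lam z\<close> of the sojourn density cancels the normalisation.
  \<open>3 - z\<close> is the other phase.\<close>

definition jump_rate_mean :: "(nat \<Rightarrow> real \<Rightarrow> real) \<Rightarrow> nat \<Rightarrow> real \<Rightarrow> real" where
  "jump_rate_mean v z y = lam z (3 - z) * v (3 - z) y + lam z 3 * claim_mean v y"

text \<open>The class that contains all values of barrier vectors: zero after ruin, and finite with
  a bound of slope 1.\<close>

definition linear_growth :: "(nat \<Rightarrow> real \<Rightarrow> real) \<Rightarrow> real \<Rightarrow> bool" where
  "linear_growth v C \<longleftrightarrow> (\<forall>z\<in>{1,2}. v z \<in> borel_measurable borel \<and> (\<forall>r. 0 \<le> v z r) \<and> (\<forall>r<0. v z r = 0) \<and>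
     (\<forall>r\<ge>0. v z r \<le> r + C))"

lemma other_phase: "z \<in> {1,2} \<Longrightarrow> 3 - z \<in> {1,2::nat}"
  by auto

context
  fixes v :: "nat \<Rightarrow> real \<Rightarrow> real" and C :: real
  assumes v: "linear_growth v C"
begin

lemma v_measurable: "z \<in> {1,2} \<Longrightarrow> v z \<in> borel_measurable borel"
  and v_nonneg: "z \<in> {1,2} \<Longrightarrow> 0 \<le> v z r"
  and v_neg: "z \<in> {1,2} \<Longrightarrow> r < 0 \<Longrightarrow> v z r = 0"
  and v_le: "z \<in> {1,2} \<Longrightarrow> 0 \<le> r \<Longrightarrow> v z r \<le> r + C"
  using v unfolding linear_growth_def by blast+

lemma v12_measurable [measurable]: "v 1 \<in> borel_measurable borel" "v 2 \<in> borel_measurable borel"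
  using v_measurable by auto

lemma claim_mean_integrand:
  assumes "u \<in> {0..y}"
  shows "0 \<le> claim_integrand v y u \<and>
    claim_integrand v y u \<le> (y + C) * \<beta>"
proof
  have "0 \<le> \<pi> 1 * v 1 u + \<pi> 2 * v 2 u"
    using restart_nonneg v_nonneg by simp
  then show "0 \<le> claim_integrand v y u"
    using \<beta>_pos by simp
  have "\<pi> 1 * v 1 u + \<pi> 2 * v 2 u \<le> \<pi> 1 * (y + C) + \<pi> 2 * (y + C)"
    using assms restart_nonneg v_le[of 1 u] v_le[of 2 u] by (intro add_mono mult_left_mono) auto
  also have "\<dots> = y + C"
    using restart_sum by (simp add: distrib_right[symmetric])
  finally have "\<pi> 1 * v 1 u + \<pi> 2 * v 2 u \<le> y + C" .
  moreover have "\<beta> * exp (- \<beta> * (y - u)) \<le> \<beta> * 1"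
    using assms \<beta>_pos by (intro mult_left_mono) auto
  ultimately show "claim_integrand v y u \<le> (y + C) * \<beta>"
    using \<open>0 \<le> \<pi> 1 * v 1 u + \<pi> 2 * v 2 u\<close> \<beta>_pos by (intro mult_mono) auto
qed

lemma claim_mean_nn_integral:
  "ennreal (claim_mean v y) = (\<integral>\<^sup>+u. ennreal (claim_integrand v y u) *
     indicator {0..y} u \<partial>lborel)"
  and claim_mean_integral: "claim_mean v y = integral {0..y} (\<lambda>u. claim_integrand v y u)"
  and claim_mean_integrable: "(\<lambda>u. claim_integrand v y u) integrable_on {0..y}"
proof -
  let ?f = "claim_integrand v y"
  have eq: "(\<integral>\<^sup>+u. ennreal (?f u) * indicator {0..y} u \<partial>lborel) = ennreal (integral {0..y} ?f)"
    by (rule nn_integral_bounded[OF _ claim_mean_integrand]) measurable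
  show int: "?f integrable_on {0..y}"
    by (rule integrable_on_bounded[OF _ claim_mean_integrand]) measurable
  have "0 \<le> integral {0..y} ?f"
    using claim_mean_integrand by (intro integral_nonneg int) auto
  then show "claim_mean v y = integral {0..y} ?f"
    unfolding claim_mean_def eq by simp
  then show "ennreal (claim_mean v y) = (\<integral>\<^sup>+u. ennreal (?f u) * indicator {0..y} u \<partial>lborel)"
    by (simp only: eq)
qed

lemma claim_mean_nonneg: "0 \<le> claim_mean v y"
  by (simp add: claim_mean_def)

lemma claim_mean_measurable [measurable]: "claim_mean v \<in> borel_measurable borel"
  unfolding claim_mean_def[abs_def] indicator_def atLeastAtMost_iff by measurable

lemma claim_mean_le:
  assumes "0 \<le> y"
  shows "claim_mean v y \<le> y * ((y + C) * \<beta>)"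
proof -
  have "claim_mean v y \<le> integral {0..y} (\<lambda>u. (y + C) * \<beta>)"
    unfolding claim_mean_integral using claim_mean_integrand by (intro integral_le claim_mean_integrable) auto
  then show ?thesis using assms by (simp add: mult_ac)
qed

lemma jump_rate_mean_measurable: "z \<in> {1,2} \<Longrightarrow> jump_rate_mean v z \<in> borel_measurable borel"
  unfolding jump_rate_mean_def[abs_def] using v_measurable[OF other_phase] by measurable

lemma intensities_nonneg: "z \<in> {1,2} \<Longrightarrow> 0 \<le> lam z (3 - z)" "z \<in> {1,2} \<Longrightarrow> 0 \<le> lam z 3"
  by (rule intensity_nonneg; auto)+

lemma jump_rate_mean_bounds:
  assumes z: "z \<in> {1,2}" and y: "0 \<le> y" "y \<le> B"
  shows "0 \<le> jump_rate_mean v z y \<and> jump_rate_mean v z y \<le> lam z (3 - z) * (B + C) + lam z 3 * (B * ((B + C) * \<beta>))"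
proof
  show "0 \<le> jump_rate_mean v z y"
    unfolding jump_rate_mean_def
    using intensities_nonneg[OF z] v_nonneg[OF other_phase[OF z]] claim_mean_nonneg by simp
  have "0 \<le> v 1 y" "v 1 y \<le> y + C" using v_nonneg v_le y by auto
  then have "0 \<le> y + C" by simp
  have "v (3 - z) y \<le> B + C" using v_le[OF other_phase[OF z] y(1)] y by simp
  moreover have "claim_mean v y \<le> B * ((B + C) * \<beta>)"
    using claim_mean_le[OF y(1)]
    by (rule order_trans) (use y \<open>0 \<le> y + C\<close> \<beta>_pos in \<open>auto intro!: mult_mono\<close>)
  ultimately show "jump_rate_mean v z y \<le> lam z (3 - z) * (B + C) + lam z 3 * (B * ((B + C) * \<beta>))"
    unfolding jump_rate_mean_def using intensities_nonneg[OF z] by (intro add_mono mult_left_mono)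
qed

text \<open>Substituting \<open>u = m - y\<close>: the density cuts off \<open>u > m\<close>, and
  \<open>v j\<close> vanishes for negative surplus, so ruin contributes nothing and the integral
  stops at 0.\<close>

lemma nn_integral_claim_law_3:
  assumes "j \<in> {1,2}" "0 \<le> m"
  shows "(\<integral>\<^sup>+y. ennreal (v j (m - y)) \<partial>claim_law 3) =
    (\<integral>\<^sup>+u. ennreal (v j u * (\<beta> * exp (- \<beta> * (m - u)))) * indicator {0..m} u \<partial>lborel)"
    (is "?L = _")
proof -
  have [measurable]: "v j \<in> borel_measurable borel" by (rule v_measurable[OF assms(1)])
  have "?L =
      (\<integral>\<^sup>+y. ennreal (exponential_density \<beta> y) * ennreal (v j (m - y)) \<partial>lborel)"
    unfolding claim_law_def by (simp add: nn_integral_density)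
  also have "\<dots> = (\<integral>\<^sup>+u. ennreal (exponential_density \<beta> (m + - 1 * u)) * ennreal (v j (m - (m + - 1 * u))) \<partial>lborel)"
    by (subst nn_integral_real_affine[where c="-1" and t=m]) auto
  also have "\<dots> = (\<integral>\<^sup>+u. ennreal (v j u * (\<beta> * exp (- \<beta> * (m - u)))) * indicator {0..m} u \<partial>lborel)"
    (is "nn_integral _ ?lhs = nn_integral _ ?rhs")
  proof (rule nn_integral_cong)
    fix u
    show "?lhs u = ?rhs u"
    proof (cases "u \<in> {0..m}")
      case True
      then have "exponential_density \<beta> (m + - 1 * u) = \<beta> * exp (- \<beta> * (m - u))"
        by (simp add: exponential_density_def algebra_simps)
      then show ?thesis
        using True v_nonneg[OF assms(1), of u] \<beta>_pos by (simp add: ennreal_mult[symmetric] mult.commute)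
    next
      case False
      then have "exponential_density \<beta> (m + - 1 * u) = 0 \<or> v j u = 0"
        using v_neg[OF assms(1), of u] by (auto simp: exponential_density_def)
      then show ?thesis using False by auto
    qed
  qed
  finally show ?thesis .
qed

text \<open>A direct move keeps the surplus, as its claim is a point mass at 0, and leads to the
  other phase; a claim averages over restart phase and size.\<close>

lemma sum_jump_mean:
  assumes z: "z \<in> {1,2}" and m: "0 \<le> m"
  shows "(\<Sum>k\<in>{1,2,3}. \<Sum>j\<in>{1,2}. ennreal (step_prob z k j) * (\<integral>\<^sup>+y. ennreal (v j (m - y)) \<partial>claim_law k)) =
    ennreal (jump_rate_mean v z m / total_intensity lam z)"
    (is "?L = _")
proof -
  let ?e = "\<lambda>u. \<beta> * exp (- \<beta> * (m - u))"
  let ?l = "total_intensity lam z"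
  have l: "0 < ?l" by (rule total_intensity_pos[OF z])
  have 3: "(\<Sum>j\<in>{1,2}. ennreal (step_prob z 3 j) * (\<integral>\<^sup>+y. ennreal (v j (m - y)) \<partial>claim_law 3)) =
      ennreal (lam z 3 / ?l * claim_mean v m)"
  proof -
    define p where "p = lam z 3 / ?l"
    have step: "step_prob z 3 j = p * \<pi> j" for j
      using z by (auto simp: step_prob_def jump_prob_def restart_prob_def p_def)
    have p: "0 \<le> p" using intensities_nonneg[OF z] l by (simp add: p_def)
    let ?I = "\<lambda>j. \<integral>\<^sup>+u. ennreal (v j u * ?e u) * indicator {0..m} u \<partial>lborel"
    have "(\<Sum>j\<in>{1,2}. ennreal (step_prob z 3 j) * (\<integral>\<^sup>+y. ennreal (v j (m - y)) \<partial>claim_law 3)) =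
        ennreal p * (ennreal (\<pi> 1) * ?I 1 + ennreal (\<pi> 2) * ?I 2)"
      using p restart_nonneg by (simp add: step nn_integral_claim_law_3[OF _ m] ennreal_mult distrib_left mult.assoc)
    also have "ennreal (\<pi> 1) * ?I 1 + ennreal (\<pi> 2) * ?I 2 =
        (\<integral>\<^sup>+u. ennreal (\<pi> 1) * (ennreal (v 1 u * ?e u) * indicator {0..m} u) +
          ennreal (\<pi> 2) * (ennreal (v 2 u * ?e u) * indicator {0..m} u) \<partial>lborel)"
      by (subst nn_integral_add, measurable, subst (1 2) nn_integral_cmult, measurable)
    also have "\<dots> = (\<integral>\<^sup>+u. ennreal ((\<pi> 1 * v 1 u + \<pi> 2 * v 2 u) * ?e u) * indicator {0..m} u \<partial>lborel)"
      (is "nn_integral _ ?lhs = nn_integral _ ?rhs")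
    proof (rule nn_integral_cong)
      fix u
      have "0 \<le> v 1 u * ?e u" "0 \<le> v 2 u * ?e u"
        using v_nonneg \<beta>_pos by auto
      then have "ennreal (\<pi> 1) * ennreal (v 1 u * ?e u) +
          ennreal (\<pi> 2) * ennreal (v 2 u * ?e u) =
          ennreal (\<pi> 1 * (v 1 u * ?e u) + \<pi> 2 * (v 2 u * ?e u))"
        using restart_nonneg by (simp only: ennreal_mult ennreal_plus mult_nonneg_nonneg)
      also have "\<pi> 1 * (v 1 u * ?e u) + \<pi> 2 * (v 2 u * ?e u) =
          (\<pi> 1 * v 1 u + \<pi> 2 * v 2 u) * ?e u"
        by (simp add: algebra_simps)
      finally show "?lhs u = ?rhs u"
        by (simp only: mult.assoc[symmetric] distrib_right[symmetric])
    qed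
    also have "ennreal p * \<dots> = ennreal (p * claim_mean v m)"
      unfolding claim_mean_nn_integral[symmetric] using p claim_mean_nonneg by (simp only: ennreal_mult)
    finally show ?thesis unfolding p_def .
  qed
  have k: "(\<Sum>j\<in>{1,2}. ennreal (step_prob z k j) * (\<integral>\<^sup>+y. ennreal (v j (m - y)) \<partial>claim_law k)) =
      ennreal (jump_prob lam z k * v k m)" if "k \<in> {1,2}" for k
  proof -
    have "k \<noteq> 3" using that by auto
    then have "(\<integral>\<^sup>+y. ennreal (v j (m - y)) \<partial>claim_law k) = ennreal (v j m)" if "j \<in> {1,2}" for j
    proof -
      have [measurable]: "v j \<in> borel_measurable borel" by (rule v_measurable[OF that])
      show ?thesis using \<open>k \<noteq> 3\<close> by (simp add: claim_law_def nn_integral_return)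
    qed
    moreover have "0 \<le> jump_prob lam z k" using that z by (intro jump_prob_nonneg) auto
    ultimately show ?thesis
      using that v_nonneg by (auto simp: step_prob_def restart_prob_def ennreal_mult)
  qed
  have "?L =
      ennreal (jump_prob lam z 1 * v 1 m) + (ennreal (jump_prob lam z 2 * v 2 m) + ennreal (lam z 3 / ?l * claim_mean v m))"
  proof -
    have sum3: "(\<Sum>k\<in>{1,2,3}. F k) = F 1 + (F 2 + F 3)" for F :: "nat \<Rightarrow> ennreal" by simp
    show ?thesis unfolding sum3 3 by (simp only: k insertI1 insertI2 singletonI)
  qed
  also have "\<dots> = ennreal (jump_rate_mean v z m / ?l)"
  proof -
    have pos: "0 \<le> lam z (3 - z) / ?l * v (3 - z) m" "0 \<le> lam z 3 / ?l * claim_mean v m"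
      using intensities_nonneg[OF z] v_nonneg[OF other_phase[OF z], of m] claim_mean_nonneg[of m] l by auto
    have "ennreal (jump_prob lam z 1 * v 1 m) + (ennreal (jump_prob lam z 2 * v 2 m) + ennreal (lam z 3 / ?l * claim_mean v m)) =
        ennreal (lam z (3 - z) / ?l * v (3 - z) m) + ennreal (lam z 3 / ?l * claim_mean v m)"
      using z by (auto simp: jump_prob_def One_nat_def)
    also have "\<dots> = ennreal (lam z (3 - z) / ?l * v (3 - z) m + lam z 3 / ?l * claim_mean v m)"
      using pos by (rule ennreal_plus[symmetric])
    finally show ?thesis by (simp add: jump_rate_mean_def add_divide_distrib)
  qed
  finally show ?thesis .
qed

lemma transfer_eq:
  assumes z: "z \<in> {1,2}" and r: "0 \<le> r" and b: "0 \<le> b z"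
  shows "transfer b (\<lambda>j r. ennreal (v j r)) z r =
    (\<integral>\<^sup>+t. ennreal (exp (- (total_intensity lam z + \<delta>) * t) * jump_rate_mean v z (min (r + c * t) (b z))) * indicator {0..} t \<partial>lborel)"
proof -
  let ?H = "\<lambda>t. jump_rate_mean v z (min (r + c * t) (b z))"
  let ?l = "total_intensity lam z"
  have l: "0 < ?l" by (rule total_intensity_pos[OF z])
  interpret S: prob_space "sojourn_law z" by (rule prob_space_sojourn_law[OF z])
  note [measurable] = jump_rate_mean_measurable[OF z]
  let ?J = "\<lambda>k j t. \<integral>\<^sup>+y. ennreal (v j (surplus_step c (b z) r t y)) \<partial>claim_law k"
  have J[measurable]: "?J k j \<in> borel_measurable borel" if "j \<in> {1,2}" for k j
  proof -
    interpret C: prob_space "claim_law k" by (rule prob_space_claim_law)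
    have [measurable]: "v j \<in> borel_measurable borel" by (rule v_measurable[OF that])
    show ?thesis by measurable
  qed
  have "transfer b (\<lambda>j r. ennreal (v j r)) z r = (\<Sum>k\<in>{1,2,3}. \<Sum>j\<in>{1,2}.
      (\<integral>\<^sup>+t. ennreal (exp (- \<delta> * t)) * (ennreal (step_prob z k j) * ?J k j t) \<partial>sojourn_law z))"
    unfolding transfer_def
  proof (intro sum.cong refl)
    fix k j assume j: "j \<in> {1,2::nat}"
    let ?K = "\<integral>\<^sup>+t. \<integral>\<^sup>+y. ennreal (exp (- \<delta> * t)) * ennreal (v j (surplus_step c (b z) r t y)) \<partial>claim_law k \<partial>sojourn_law z"
    have [measurable]: "v j \<in> borel_measurable borel" by (rule v_measurable[OF j])
    have [measurable]: "?J k j \<in> borel_measurable borel" by (rule J[OF j])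
    have "(\<integral>\<^sup>+y. ennreal (exp (- \<delta> * t)) * ennreal (v j (surplus_step c (b z) r t y)) \<partial>claim_law k) =
        ennreal (exp (- \<delta> * t)) * ?J k j t" for t
      by (rule nn_integral_cmult) measurable
    then have "ennreal (step_prob z k j) * ?K =
        ennreal (step_prob z k j) * (\<integral>\<^sup>+t. ennreal (exp (- \<delta> * t)) * ?J k j t \<partial>sojourn_law z)"
      by simp
    also have "\<dots> = (\<integral>\<^sup>+t. ennreal (step_prob z k j) * (ennreal (exp (- \<delta> * t)) * ?J k j t) \<partial>sojourn_law z)"
      by (rule nn_integral_cmult[symmetric]) measurable
    finally show "ennreal (step_prob z k j) * ?K =
        (\<integral>\<^sup>+t. ennreal (exp (- \<delta> * t)) * (ennreal (step_prob z k j) * ?J k j t) \<partial>sojourn_law z)"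
      by (simp only: mult.left_commute)
  qed
  also have "\<dots> = (\<integral>\<^sup>+t. (\<Sum>k\<in>{1,2,3}. \<Sum>j\<in>{1,2}. ennreal (exp (- \<delta> * t)) * (ennreal (step_prob z k j) * ?J k j t)) \<partial>sojourn_law z)"
    using J by (simp add: nn_integral_add)
  also have "\<dots> = (\<integral>\<^sup>+t. ennreal (exp (- \<delta> * t)) * ennreal (?H t / ?l) \<partial>sojourn_law z)"
    (is "nn_integral _ ?lhs = nn_integral _ ?rhs")
  proof (rule nn_integral_cong_AE)
    show "AE t in sojourn_law z. ?lhs t = ?rhs t"
      using AE_sojourn_law_nonneg
    proof eventually_elim
      case (elim t)
      have m: "0 \<le> min (r + c * t) (b z)" using elim r b c_pos by simp
      have "?J k j t = (\<integral>\<^sup>+y. ennreal (v j (min (r + c * t) (b z) - y)) \<partial>claim_law k)" for k j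
        using r by (simp add: surplus_step_def)
      then show ?case
        by (simp only: sum_distrib_left[symmetric] sum_jump_mean[OF z m])
    qed
  qed
  also have "\<dots> = (\<integral>\<^sup>+t. ennreal (?l * exp (- (?l + \<delta>) * t)) * indicator {0..} t * ennreal (?H t / ?l) \<partial>lborel)"
    unfolding sojourn_law_def using l \<delta>_pos by (intro nn_integral_exponential_discount) auto
  also have "\<dots> = (\<integral>\<^sup>+t. ennreal (exp (- (?l + \<delta>) * t) * ?H t) * indicator {0..} t \<partial>lborel)"
    (is "nn_integral _ ?lhs = nn_integral _ ?rhs")
  proof (rule nn_integral_cong)
    fix t
    show "?lhs t = ?rhs t"
    proof (cases "0 \<le> t")
      case True
      then have "0 \<le> min (r + c * t) (b z)" using r b c_pos by simp
      then have "0 \<le> ?H t / ?l"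
        using jump_rate_mean_bounds[OF z _ order_refl] l by auto
      moreover have "?l * exp (- (?l + \<delta>) * t) * (?H t / ?l) =
          exp (- (?l + \<delta>) * t) * ?H t"
        using l by simp
      ultimately show ?thesis
        using True l by (simp only: indicator_simps atLeast_iff mult_1_right) (simp only: ennreal_mult'[symmetric] mult_nonneg_nonneg less_imp_le exp_ge_zero)
    qed simp
  qed
  finally show ?thesis .
qed

text \<open>By Fubini, premium paid at time \<open>s\<close> of the sojourn counts only if the
  sojourn lasts until \<open>s\<close>; this exponential survival probability adds the total
  intensity to the discount rate.\<close>

lemma sojourn_gain_eq:
  assumes z: "z \<in> {1,2}" and r: "0 \<le> r"
  shows "sojourn_gain b z r = ennreal (max 0 (r - b z)) +
    (\<integral>\<^sup>+t. ennreal (c * exp (- (total_intensity lam z + \<delta>) * t)) * indicator {t. 0 \<le> t \<and> b z \<le> r + c * t} t \<partial>lborel)"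
proof -
  let ?l = "total_intensity lam z"
  have l: "0 < ?l" by (rule total_intensity_pos[OF z])
  interpret S: prob_space "sojourn_law z" by (rule prob_space_sojourn_law[OF z])
  interpret P: pair_sigma_finite lborel "sojourn_law z" ..
  let ?B = "{t. 0 \<le> t \<and> b z \<le> r + c * t}"
  let ?f = "\<lambda>t s. ennreal (c * exp (- \<delta> * s)) * indicator {s. 0 \<le> s \<and> s \<le> t \<and> b z \<le> r + c * s} s"
  have meas: "(\<lambda>(s, t). ?f t s) \<in> borel_measurable (lborel \<Otimes>\<^sub>M sojourn_law z)"
    unfolding indicator_def mem_Collect_eq by measurable
  have "(\<integral>\<^sup>+t. \<integral>\<^sup>+s. ?f t s \<partial>lborel \<partial>sojourn_law z) = (\<integral>\<^sup>+s. \<integral>\<^sup>+t. ?f t s \<partial>sojourn_law z \<partial>lborel)"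
    by (rule P.Fubini'[OF meas])
  also have "\<dots> = (\<integral>\<^sup>+s. ennreal (c * exp (- (?l + \<delta>) * s)) * indicator ?B s \<partial>lborel)"
    (is "nn_integral _ ?lhs = nn_integral _ ?rhs")
  proof (intro nn_integral_cong_AE)
    show "AE s in lborel. ?lhs s = ?rhs s"
      using AE_lborel_singleton[of 0]
    proof eventually_elim
      case (elim s)
      have "(\<integral>\<^sup>+t. ?f t s \<partial>sojourn_law z) =
          (\<integral>\<^sup>+t. ennreal (c * exp (- \<delta> * s)) * indicator ?B s * indicator {s..} t \<partial>sojourn_law z)"
        by (intro nn_integral_cong) (auto simp: indicator_def)
      also have "\<dots> = ennreal (c * exp (- \<delta> * s)) * indicator ?B s * emeasure (sojourn_law z) {s..}"
        by (rule nn_integral_cmult_indicator) simp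
      also have "\<dots> = ennreal (c * exp (- (?l + \<delta>) * s)) * indicator ?B s"
      proof (cases "s \<in> ?B")
        case True
        have "emeasure (sojourn_law z) {s..} = emeasure (sojourn_law z) {s<..}"
        proof (rule emeasure_eq_AE)
          have "AE t in lborel. t \<noteq> s" by (rule AE_lborel_singleton)
          then have "AE t in sojourn_law z. t \<noteq> s"
            unfolding sojourn_law_def by (subst AE_density) (auto elim!: eventually_mono)
          then show "AE t in sojourn_law z. t \<in> {s..} \<longleftrightarrow> t \<in> {s<..}"
            by eventually_elim auto
        qed auto
        also have "\<dots> = ennreal (exp (- ?l * s))"
          using True unfolding sojourn_law_def by (simp add: emeasure_exponential_greaterThan[OF l])
        finally have "ennreal (c * exp (- \<delta> * s)) * emeasure (sojourn_law z) {s..} = ennreal (c * exp (- \<delta> * s) * exp (- ?l * s))"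
          using c_pos by (simp only: ennreal_mult mult_nonneg_nonneg less_imp_le exp_ge_zero)
        also have "c * exp (- \<delta> * s) * exp (- ?l * s) = c * exp (- (?l + \<delta>) * s)"
          by (simp add: exp_add[symmetric] algebra_simps)
        finally show ?thesis using True by simp
      qed simp
      finally show ?case .
    qed
  qed
  finally show ?thesis
    using r S.emeasure_space_1 unfolding sojourn_gain_def sojourn_dividends_def
    by (simp add: nn_integral_add)
qed

text \<open>This turns the fixed-point equation into an explicit formula, from which continuity and
  slopes of the value are read off.\<close>

theorem renewal_operator_eq:
  assumes z: "z \<in> {1,2}" and r: "0 \<le> r" and b: "0 \<le> b z"
  shows "sojourn_gain b z r + transfer b (\<lambda>j r. ennreal (v j r)) z r =
    ennreal (barrier_profile c (total_intensity lam z + \<delta>) (jump_rate_mean v z) (b z) r)"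
  unfolding sojourn_gain_eq[OF z r] transfer_eq[where b=b and z=z, OF z r b]
  by (rule nn_integral_barrier_profile[OF c_pos _ r jump_rate_mean_measurable[OF z] jump_rate_mean_bounds[OF z] b])
    (use total_intensity_pos[OF z] \<delta>_pos in auto)

end

end

section \<open>Dependence on the barrier and slopes between the barriers\<close>

lemma increasing_if_derivative_pos:
  fixes f f' :: "real \<Rightarrow> real"
  assumes "l < r" and f: "\<And>y. y \<in> {l..r} \<Longrightarrow> (f has_real_derivative f' y) (at y within {l..r})"
    and pos: "\<And>y. l < y \<Longrightarrow> y < r \<Longrightarrow> 0 < f' y"
  shows "f l < f r"
proof (rule DERIV_pos_imp_increasing_open[OF \<open>l < r\<close>])
  show "\<exists>D. (f has_real_derivative D) (at y) \<and> 0 < D" if "l < y" "y < r" for y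
    using f[of y] pos[OF that] that by (auto simp: at_within_Icc_at intro!: exI[of _ "f' y"])
  show "continuous_on {l..r} f"
    using f by (rule DERIV_continuous_on)
qed

lemma antimono_if_derivative_nonpos:
  fixes f f' :: "real \<Rightarrow> real"
  assumes "l \<le> r" and f: "\<And>y. y \<in> {l..r} \<Longrightarrow> (f has_real_derivative f' y) (at y within {l..r})"
    and neg: "\<And>y. y \<in> {l..r} \<Longrightarrow> f' y \<le> 0"
  shows "f r \<le> f l"
proof -
  have "- f l \<le> - f r"
  proof (rule DERIV_nonneg_imp_increasing_open[OF \<open>l \<le> r\<close>])
    show "\<exists>D. ((\<lambda>y. - f y) has_real_derivative D) (at y) \<and> 0 \<le> D" if "l < y" "y < r" for y
      using f[of y] neg[of y] that by (auto simp: at_within_Icc_at intro!: exI[of _ "- f' y"] DERIV_minus)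
    show "continuous_on {l..r} (\<lambda>y. - f y)"
      using DERIV_continuous_on[OF f] by (intro continuous_on_minus) auto
  qed
  then show ?thesis by simp
qed

lemma barrier_profile_at_barrier: "barrier_profile c a H \<eta> \<eta> = (c + H \<eta>) / a"
proof -
  have "exp (a * \<eta> / c) * exp (- a * \<eta> / c) = 1"
    by (simp add: exp_add[symmetric])
  then show ?thesis
    by (simp add: barrier_profile_def)
qed

lemma barrier_profile_above: "\<eta> \<le> x \<Longrightarrow> barrier_profile c a H \<eta> x = x - \<eta> + (c + H \<eta>) / a"
  using barrier_profile_at_barrier[of c a H \<eta>] by (cases "x = \<eta>") (auto simp: barrier_profile_def)

lemma barrier_profile_nonneg:
  assumes "0 < c" "0 < a" "0 \<le> x" "0 \<le> \<eta>" and H: "\<And>u. 0 \<le> u \<Longrightarrow> u \<le> \<eta> \<Longrightarrow> 0 \<le> H u"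
  shows "0 \<le> barrier_profile c a H \<eta> x"
proof -
  have "0 \<le> integral {x..\<eta>} (\<lambda>u. exp (- a * u / c) * H u / c)"
  proof (cases "(\<lambda>u. exp (- a * u / c) * H u / c) integrable_on {x..\<eta>}")
    case True
    then show ?thesis using assms by (intro integral_nonneg) auto
  next
    case False
    show ?thesis unfolding not_integrable_integral[OF False] by simp
  qed
  moreover have "0 \<le> H \<eta>" using assms by auto
  ultimately show ?thesis
    using assms unfolding barrier_profile_def by (auto intro!: mult_nonneg_nonneg add_nonneg_nonneg divide_nonneg_pos)
qed

lemma barrier_profile_continuous_on:
  assumes "c \<noteq> 0" "0 \<le> \<eta>" and int: "(\<lambda>u. exp (- a * u / c) * H u / c) integrable_on {0..\<eta>}"
  shows "continuous_on {0..} (barrier_profile c a H \<eta>)"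
proof -
  have 1: "continuous_on {0..\<eta>} (\<lambda>x. exp (a * x / c) * (integral {x..\<eta>} (\<lambda>u. exp (- a * u / c) * H u / c) + exp (- a * \<eta> / c) * (c + H \<eta>) / a))"
    using assms(1) by (intro continuous_intros indefinite_integral_continuous_1'[OF int] ballI)
  have "continuous_on ({0..\<eta>} \<union> {\<eta>..}) (barrier_profile c a H \<eta>)"
  proof (rule continuous_on_closed_Un)
    show "continuous_on {0..\<eta>} (barrier_profile c a H \<eta>)"
      by (rule continuous_on_eq[OF 1]) (auto simp: barrier_profile_def)
    have "continuous_on {\<eta>..} (\<lambda>x. x - \<eta> + (c + H \<eta>) / a)"
      by (intro continuous_intros)
    then show "continuous_on {\<eta>..} (barrier_profile c a H \<eta>)"
      by (rule continuous_on_eq) (auto simp: barrier_profile_above)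
  qed auto
  moreover have "{0..\<eta>} \<union> {\<eta>..} = {0..}" using \<open>0 \<le> \<eta>\<close> by auto
  ultimately show ?thesis by simp
qed

lemma barrier_profile_derivative:
  assumes c: "c \<noteq> 0" and H: "continuous_on {l..\<eta>} H" and x: "x \<in> {l..\<eta>}"
  shows "(barrier_profile c a H \<eta> has_real_derivative (a * barrier_profile c a H \<eta> x - H x) / c) (at x within {l..\<eta>})"
proof -
  let ?F = "\<lambda>u. exp (- a * u / c) * H u / c"
  let ?k = "exp (- a * \<eta> / c) * (c + H \<eta>) / a"
  have F: "continuous_on {l..\<eta>} ?F"
    using c by (intro continuous_intros H ballI)
  have "exp (a * x / c) * exp (- a * x / c) = 1"
    by (simp add: exp_add[symmetric])
  then have e: "exp (a * x / c) * ?F x = H x / c" by simp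
  define I where "I x = integral {x..\<eta>} ?F" for x
  have I: "(I has_real_derivative - ?F x) (at x within {l..\<eta>})"
    unfolding I_def by (rule integral_has_real_derivative'[OF F x])
  have bp: "barrier_profile c a H \<eta> x = exp (a * x / c) * (I x + ?k)" if "x \<le> \<eta>" for x
    using that by (simp add: barrier_profile_def I_def)
  have "((\<lambda>x. exp (a * x / c) * (I x + ?k)) has_real_derivative
      a / c * exp (a * x / c) * (I x + ?k) + exp (a * x / c) * (- ?F x)) (at x within {l..\<eta>})"
    using c by (auto intro!: derivative_eq_intros I simp: mult_ac)
  also have "a / c * exp (a * x / c) * (I x + ?k) + exp (a * x / c) * (- ?F x) =
      (a * barrier_profile c a H \<eta> x - H x) / c"
    unfolding mult_minus_right e using x by (simp add: bp diff_divide_distrib)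
  finally show ?thesis
    using x by (rule has_field_derivative_transform_within[OF _ zero_less_one]) (auto simp: bp)
qed

text \<open>The derivative of the profile with respect to the barrier has the sign of \<open>H' - a\<close>, whatever the surplus.\<close>

lemma barrier_profile_strict_mono:
  assumes c: "0 < c" and a: "0 < a" and l: "0 \<le> l" "l < r" and x: "0 \<le> x"
    and cont: "continuous_on {0..r} H"
    and H': "\<And>y. y \<in> {l..r} \<Longrightarrow> (H has_real_derivative H' y) (at y within {l..r})"
    and sgn: "\<And>y. y \<in> {l..r} \<Longrightarrow> 0 < \<sigma> * (H' y - a)"
  shows "\<sigma> * barrier_profile c a H l x < \<sigma> * barrier_profile c a H r x"
proof -
  let ?F = "\<lambda>u. exp (- a * u / c) * H u / c"
  \<comment> \<open>For \<open>x\<close> below both barriers the derivative in the barrier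
    \<open>y\<close> is \<open>exp (a * (x - y) / c) * (H' y - a) / a\<close>, since the terms with
    \<open>H y\<close> cancel.\<close>
  have below: "\<sigma> * barrier_profile c a H l' x < \<sigma> * barrier_profile c a H r x" if l': "l \<le> l'" "l' < r" "x \<le> l'" for l'
  proof -
    define I where "I y = integral {x..y} ?F" for y
    define g where "g y = exp (a * x / c) * (I y + exp (- a * y / c) * (c + H y) / a)" for y
    have F: "continuous_on {x..r} ?F"
      using c x by (intro continuous_intros continuous_on_subset[OF cont]) auto
    have "((\<lambda>y. \<sigma> * g y) has_real_derivative \<sigma> * (exp (a * x / c) * exp (- a * y / c) * (H' y - a) / a)) (at y within {l'..r})"
      if y: "y \<in> {l'..r}" for y
    proof -
      have D1: "(I has_real_derivative ?F y) (at y within {l'..r})"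
        unfolding I_def by (rule DERIV_subset[OF integral_has_real_derivative[OF F]]) (use y l' in auto)
      have D2: "(H has_real_derivative H' y) (at y within {l'..r})"
        by (rule DERIV_subset[OF H']) (use y l' in auto)
      have "((\<lambda>y. \<sigma> * g y) has_real_derivative \<sigma> * (exp (a * x / c) *
          (?F y + (- a / c * exp (- a * y / c) * (c + H y) + exp (- a * y / c) * H' y) / a))) (at y within {l'..r})"
        unfolding g_def using c a by (auto intro!: derivative_eq_intros D1 D2 simp: field_simps)
      also have "?F y + (- a / c * exp (- a * y / c) * (c + H y) + exp (- a * y / c) * H' y) / a =
          exp (- a * y / c) * (H' y - a) / a"
        using c a by (simp add: field_simps)
      finally show ?thesis by (simp add: mult.assoc)
    qed
    then have "\<sigma> * g l' < \<sigma> * g r"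
    proof (rule increasing_if_derivative_pos[OF l'(2)])
      fix y assume "l' < y" "y < r"
      then have "0 < \<sigma> * (H' y - a)" using sgn[of y] l' by auto
      moreover have "0 < exp (a * x / c) * exp (- a * y / c) / a"
        using a by simp
      ultimately have "0 < exp (a * x / c) * exp (- a * y / c) / a * (\<sigma> * (H' y - a))"
        by (rule mult_pos_pos[rotated])
      then show "0 < \<sigma> * (exp (a * x / c) * exp (- a * y / c) * (H' y - a) / a)"
        by (simp add: mult_ac)
    qed
    then show ?thesis
      using l' by (simp add: g_def I_def barrier_profile_def)
  qed
  \<comment> \<open>For \<open>x\<close> above both barriers the derivative is
    \<open>(H' y - a) / a\<close>.\<close>
  have above: "\<sigma> * barrier_profile c a H l x < \<sigma> * barrier_profile c a H r' x" if r': "l < r'" "r' \<le> r" "r' \<le> x" for r'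
  proof -
    define g where "g y = x - y + (c + H y) / a" for y
    have "((\<lambda>y. \<sigma> * g y) has_real_derivative \<sigma> * ((H' y - a) / a)) (at y within {l..r'})"
      if y: "y \<in> {l..r'}" for y
    proof -
      have D2: "(H has_real_derivative H' y) (at y within {l..r'})"
        by (rule DERIV_subset[OF H']) (use y r' in auto)
      show ?thesis
        unfolding g_def using a by (auto intro!: derivative_eq_intros D2 simp: field_simps)
    qed
    then have "\<sigma> * g l < \<sigma> * g r'"
    proof (rule increasing_if_derivative_pos[OF r'(1)])
      fix y assume "l < y" "y < r'"
      then have "0 < \<sigma> * (H' y - a)" using sgn[of y] r' by auto
      then show "0 < \<sigma> * ((H' y - a) / a)"
        unfolding times_divide_eq_right using a by (rule divide_pos_pos)
    qed
    then show ?thesis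
      using r' by (simp add: g_def barrier_profile_above)
  qed
  consider "x \<le> l" | "r \<le> x" | "l < x" "x < r" by linarith
  then show ?thesis
  proof cases
    \<comment> \<open>For \<open>x\<close> between the barriers the comparison passes through the
      barrier \<open>x\<close> itself, to which both formulas apply.\<close>
    case 3
    then have "\<sigma> * barrier_profile c a H l x < \<sigma> * barrier_profile c a H x x" by (intro above) auto
    also have "\<dots> < \<sigma> * barrier_profile c a H r x" using 3 by (intro below) auto
    finally show ?thesis .
  qed (use below[of l] above[of r] l in auto)
qed

text \<open>The exponential kernel splits into a factor in \<open>y\<close> and a factor in
  \<open>u\<close>, so the convolution is an exponential times an antiderivative and satisfies a
  first-order equation.\<close>

lemma exponential_convolution_derivative:
  fixes w :: "real \<Rightarrow> real" and \<beta> :: real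
  assumes w: "continuous_on {0..R} w" and y: "y \<in> {0..R}"
  defines "G \<equiv> \<lambda>y. integral {0..y} (\<lambda>u. w u * (\<beta> * exp (- \<beta> * (y - u))))"
  shows "(G has_real_derivative \<beta> * (w y - G y)) (at y within {0..R})"
proof -
  let ?E = "\<lambda>y. integral {0..y} (\<lambda>u. w u * exp (\<beta> * u))"
  have G: "G y = \<beta> * exp (- \<beta> * y) * ?E y" for y
  proof -
    have "(\<lambda>u. w u * (\<beta> * exp (- \<beta> * (y - u)))) = (\<lambda>u. (\<beta> * exp (- \<beta> * y)) * (w u * exp (\<beta> * u)))"
      by (simp add: fun_eq_iff exp_diff exp_minus field_simps)
    then show ?thesis unfolding G_def by simp
  qed
  have "continuous_on {0..R} (\<lambda>u. w u * exp (\<beta> * u))"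
    by (intro continuous_intros w)
  from integral_has_real_derivative[OF this y]
  have "((\<lambda>y. \<beta> * exp (- \<beta> * y) * ?E y) has_real_derivative
      \<beta> * (- \<beta> * exp (- \<beta> * y)) * ?E y + \<beta> * exp (- \<beta> * y) * (w y * exp (\<beta> * y))) (at y within {0..R})"
    by (auto intro!: derivative_eq_intros)
  also have "exp (- \<beta> * y) * exp (\<beta> * y) = 1"
    by (simp add: exp_add[symmetric])
  then have "\<beta> * (- \<beta> * exp (- \<beta> * y)) * ?E y + \<beta> * exp (- \<beta> * y) * (w y * exp (\<beta> * y)) = \<beta> * (w y - G y)"
    unfolding G by (simp add: algebra_simps)
  finally show ?thesis
    unfolding G[abs_def] .
qed

text \<open>Between the barriers \<open>u\<close> is the slope of the value in phase 2 and \<open>g\<close> the slope of the mean value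
  after a claim.  Backwards from \<open>b2\<close> the deviations \<open>p\<close> of \<open>u\<close> and \<open>q\<close> of \<open>g\<close> from the equilibrium
  \<open>(1, 1 + \<delta> / L)\<close> stay in the cone \<open>0 \<le> p \<le> q\<close>.\<close>

lemma slope_comparison:
  fixes u g :: "real \<Rightarrow> real"
  assumes b: "b1 < b2" and pos: "0 < c" "0 < \<beta>" "0 < \<delta>" "0 < L" "0 \<le> M" and \<pi>: "p2 \<le> 1" "p1 + p2 = 1"
    and u: "\<And>x. x \<in> {b1..b2} \<Longrightarrow> (u has_real_derivative ((M + L + \<delta>) * u x - M - L * g x) / c) (at x within {b1..b2})"
    and g: "\<And>x. x \<in> {b1..b2} \<Longrightarrow> (g has_real_derivative \<beta> * (p1 + p2 * u x - g x)) (at x within {b1..b2})"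
    and u_b2: "u b2 = 1" and g_b2: "1 + \<delta> / L \<le> g b2"
  shows "1 \<le> u b1" "g b2 < g b1"
proof -
  define p where "p x = u x - 1" for x
  \<comment> \<open>This is the difference of the deviations of \<open>g\<close> and
    \<open>u\<close>, so the cone is described by \<open>p \<ge> 0\<close> and
    \<open>e \<ge> 0\<close>.\<close>
  define e where "e x = g x - u x - \<delta> / L" for x
  have p1: "p1 = 1 - p2" using \<pi> by simp
  have Lg: "L * (\<delta> / L) = \<delta>" using pos by simp
  have p': "(p has_real_derivative ((M + \<delta>) * p x - L * e x) / c) (at x within {b1..b2})"
    and e': "(e has_real_derivative \<beta> * (- (1 - p2) * p x - e x - \<delta> / L) - ((M + \<delta>) * p x - L * e x) / c) (at x within {b1..b2})"
    and g': "(g has_real_derivative - \<beta> * ((1 - p2) * p x + e x + \<delta> / L)) (at x within {b1..b2})"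
    if "x \<in> {b1..b2}" for x
  proof -
    have 1: "(M + L + \<delta>) * u x - M - L * g x = (M + \<delta>) * p x - L * e x"
      unfolding p_def e_def using Lg by (simp add: algebra_simps)
    have 2: "p1 + p2 * u x - g x = - (1 - p2) * p x - e x - \<delta> / L"
      unfolding p_def e_def p1 by (simp add: algebra_simps)
    note u' = u[OF that, unfolded 1] and g'' = g[OF that, unfolded 2]
    show "(p has_real_derivative ((M + \<delta>) * p x - L * e x) / c) (at x within {b1..b2})"
      unfolding p_def[abs_def] using u' by (auto intro!: derivative_eq_intros simp: p_def)
    have "((\<lambda>x. g x - u x - \<delta> / L) has_real_derivative
        \<beta> * (- (1 - p2) * p x - e x - \<delta> / L) - ((M + \<delta>) * p x - L * e x) / c) (at x within {b1..b2})"
      by (rule DERIV_cong[OF DERIV_diff[OF DERIV_diff[OF g'' u'] DERIV_const]]) simp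
    moreover have "(\<lambda>x. g x - u x - \<delta> / L) = e"
      by (simp add: e_def fun_eq_iff)
    ultimately show "(e has_real_derivative \<beta> * (- (1 - p2) * p x - e x - \<delta> / L) - ((M + \<delta>) * p x - L * e x) / c) (at x within {b1..b2})"
      by (simp only:)
    show "(g has_real_derivative - \<beta> * ((1 - p2) * p x + e x + \<delta> / L)) (at x within {b1..b2})"
      using g'' by (rule DERIV_cong) (simp add: algebra_simps)
  qed
  have e_cont: "continuous_on {b1..b2} e"
    using e' by (rule DERIV_continuous_on)
  \<comment> \<open>While \<open>e \<ge> 0\<close>, the function \<open>p x * exp (- k * x)\<close>
    is nonincreasing, and it ends at \<open>p b2 = 0\<close>.\<close>
  have p_nonneg: "0 \<le> p x" if e: "\<And>y. y \<in> {s..b2} \<Longrightarrow> 0 \<le> e y" and s: "b1 \<le> s" "s \<le> x" "x \<le> b2" for s x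
  proof -
    define k where "k = (M + \<delta>) / c"
    have "p b2 * exp (- k * b2) \<le> p x * exp (- k * x)"
    proof (rule antimono_if_derivative_nonpos[OF s(3)])
      fix y assume y: "y \<in> {x..b2}"
      have D: "(p has_real_derivative ((M + \<delta>) * p y - L * e y) / c) (at y within {x..b2})"
        by (rule DERIV_subset[OF p']) (use y s in auto)
      have "((\<lambda>x. p x * exp (- k * x)) has_real_derivative
        ((M + \<delta>) * p y - L * e y) / c * exp (- k * y) + (- k * exp (- k * y)) * p y) (at y within {x..b2})"
        using D by (auto intro!: derivative_eq_intros)
      also have "((M + \<delta>) * p y - L * e y) / c * exp (- k * y) + (- k * exp (- k * y)) * p y = - (L / c * e y * exp (- k * y))"
        using pos by (simp add: k_def field_simps)
      finally show "((\<lambda>x. p x * exp (- k * x)) has_real_derivative - (L / c * e y * exp (- k * y))) (at y within {x..b2})" .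
      show "- (L / c * e y * exp (- k * y)) \<le> 0"
        using e[of y] y s pos by simp
    qed
    then have "0 \<le> p x * exp (- k * x)" by (simp add: p_def u_b2)
    then show ?thesis by (simp add: zero_le_mult_iff)
  qed
  have e_nonneg: "0 \<le> e x" if x: "x \<in> {b1..b2}" for x
  proof (rule ccontr)
    assume "\<not> 0 \<le> e x"
    \<comment> \<open>The supremum \<open>s\<close> of the violations is the first exit met when
      going left from \<open>b2\<close>; there \<open>e s = 0\<close> and
      \<open>p s \<ge> 0\<close>.\<close>
    define A where "A = {y \<in> {b1..b2}. e y < 0}"
    have "x \<in> A" using x \<open>\<not> 0 \<le> e x\<close> by (simp add: A_def)
    have bdd: "bdd_above A" by (auto simp: A_def)
    define s where "s = Sup A"
    have s: "b1 \<le> s" "s \<le> b2"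
    proof -
      show "s \<le> b2" unfolding s_def using \<open>x \<in> A\<close> by (intro cSup_least) (auto simp: A_def)
      show "b1 \<le> s" unfolding s_def using \<open>x \<in> A\<close> bdd x by (intro order_trans[OF _ cSup_upper[of x]]) auto
    qed
    have right: "0 \<le> e y" if "s < y" "y \<le> b2" for y
      using that s cSup_upper[OF _ bdd, of y] by (force simp: A_def s_def not_less)
    have e_s: "0 \<le> e s"
    proof (cases "s = b2")
      case True
      then show ?thesis using g_b2 by (simp add: e_def u_b2)
    next
      case False
      have "0 \<le> e s"
      proof (rule tendsto_lowerbound)
        show "(e \<longlongrightarrow> e s) (at s within {s<..b2})"
          by (rule tendsto_within_subset[of e _ s "{b1..b2}"])
            (use e_cont s in \<open>auto simp: continuous_on_def\<close>)
        show "eventually (\<lambda>y. 0 \<le> e y) (at s within {s<..b2})"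
          using right by (auto simp: eventually_at_filter)
        show "at s within {s<..b2} \<noteq> bot"
          using False s by (simp add: at_within_eq_bot_iff)
      qed
      then show ?thesis .
    qed
    have p_s: "0 \<le> p s"
      by (rule p_nonneg[of s]) (use right e_s s in \<open>auto simp: le_less\<close>)
    have "\<not> 0 < e s"
    proof
      assume "0 < e s"
      have "s islimpt A \<or> s \<in> A"
        using closure_contains_Sup[OF _ bdd] \<open>x \<in> A\<close> by (auto simp: s_def closure_def)
      moreover have "eventually (\<lambda>y. 0 < e y) (at s within {b1..b2})"
        using e_cont s \<open>0 < e s\<close> by (auto simp: continuous_on_def intro!: order_tendstoD)
      then have "\<not> s islimpt A"
        unfolding islimpt_iff_eventually eventually_at_filter not_not
        by eventually_elim (auto simp: A_def)
      ultimately show False using \<open>0 < e s\<close> by (auto simp: A_def)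
    qed
    then have "e s = 0" using e_s by simp
    \<comment> \<open>At the exit the derivative of \<open>e\<close> is at most
      \<open>- \<beta> * \<delta> / L\<close>, so \<open>e\<close> is positive just to the left of
      \<open>s\<close>, against the choice of \<open>s\<close>.\<close>
    have "\<beta> * (- (1 - p2) * p s - e s - \<delta> / L) - ((M + \<delta>) * p s - L * e s) / c < 0"
    proof -
      have "0 \<le> (1 - p2) * p s" "0 \<le> (M + \<delta>) * p s / c" "0 < \<delta> / L"
        using \<pi> p_s pos by simp_all
      then have "- (1 - p2) * p s - \<delta> / L < 0"
        unfolding mult_minus_left by linarith
      then have "\<beta> * (- (1 - p2) * p s - \<delta> / L) < 0"
        by (rule mult_pos_neg[OF pos(2)])
      then show ?thesis
        using \<open>e s = 0\<close> \<open>0 \<le> (M + \<delta>) * p s / c\<close> by simp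
    qed
    from has_real_derivative_neg_dec_left[OF e' this] s
    obtain d where d: "0 < d" "\<And>h. 0 < h \<Longrightarrow> s - h \<in> {b1..b2} \<Longrightarrow> h < d \<Longrightarrow> e s < e (s - h)"
      by auto
    have "y \<le> s - d" if "y \<in> A" for y
    proof (rule ccontr)
      assume "\<not> y \<le> s - d"
      have "y \<le> s" using cSup_upper[OF that bdd] by (simp add: s_def)
      then have "y < s" using that \<open>e s = 0\<close> by (auto simp: A_def le_less)
      then have "e s < e y" using d(2)[of "s - y"] that \<open>\<not> y \<le> s - d\<close> by (auto simp: A_def)
      then show False using that \<open>e s = 0\<close> by (auto simp: A_def)
    qed
    then have "s \<le> s - d"
      unfolding s_def using \<open>x \<in> A\<close> by (intro cSup_least) auto
    then show False using d(1) by simp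
  qed
  have p_all: "0 \<le> p x" if "x \<in> {b1..b2}" for x
    using p_nonneg[of b1 x] e_nonneg that by auto
  show "1 \<le> u b1"
    using p_all[of b1] b by (simp add: p_def)
  \<comment> \<open>In the cone the derivative of \<open>g\<close> is negative; strictness comes
    from the term \<open>\<delta> / L\<close>.\<close>
  have "- g b1 < - g b2"
  proof (rule increasing_if_derivative_pos[OF b])
    fix y assume "y \<in> {b1..b2}"
    then show "((\<lambda>x. - g x) has_real_derivative \<beta> * ((1 - p2) * p y + e y + \<delta> / L)) (at y within {b1..b2})"
      using DERIV_minus[OF g'[of y]] by simp
  next
    fix y assume "b1 < y" "y < b2"
    then have "0 \<le> (1 - p2) * p y" "0 \<le> e y" using p_all[of y] e_nonneg[of y] \<pi> by auto
    then show "0 < \<beta> * ((1 - p2) * p y + e y + \<delta> / L)"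
      using pos by (intro mult_pos_pos add_nonneg_pos add_nonneg_nonneg divide_pos_pos) auto
  qed
  then show "g b2 < g b1" by simp
qed

section \<open>Optimal barriers\<close>

context phase_type_risk_model
begin

definition real_value :: "(nat \<Rightarrow> real) \<Rightarrow> nat \<Rightarrow> real \<Rightarrow> real" where
  "real_value b z r = enn2real (value_fun b z r)"

lemma linear_growth_real_value:
  assumes b: "b \<in> barriers"
  obtains C where "0 \<le> C" "linear_growth (real_value b) C"
    "\<And>z r. z \<in> {1,2} \<Longrightarrow> value_fun b z r = ennreal (real_value b z r)"
proof -
  obtain C where C: "0 \<le> C" "\<And>z r. z \<in> {1,2} \<Longrightarrow> 0 \<le> r \<Longrightarrow> value_fun b z r \<le> ennreal (r + C)"
    using value_fun_le[OF b] by blast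
  have fin: "value_fun b z r = ennreal (real_value b z r)" if "z \<in> {1,2}" for z r
  proof (cases "0 \<le> r")
    case True
    then have "value_fun b z r < \<top>"
      using C(2)[OF that True] by (simp add: order_le_less_trans)
    then show ?thesis by (simp add: real_value_def)
  next
    case False
    then have "value_fun b z r = 0" using that by (intro value_fun_neg) auto
    then show ?thesis by (simp add: real_value_def)
  qed
  have "linear_growth (real_value b) C"
    unfolding linear_growth_def
  proof (intro ballI conjI allI impI)
    fix z :: nat and r :: real assume z: "z \<in> {1,2}"
    note [measurable] = value_fun_measurable
    show "real_value b z \<in> borel_measurable borel"
      unfolding real_value_def[abs_def] by measurable
    show "0 \<le> real_value b z r" by (simp add: real_value_def)
    show "r < 0 \<Longrightarrow> real_value b z r = 0" by (simp add: real_value_def value_fun_neg[OF _ z])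
    assume "0 \<le> r"
    then have "ennreal (real_value b z r) \<le> ennreal (r + C)"
      using C(2)[OF z] fin[OF z] by simp
    then show "real_value b z r \<le> r + C"
      using \<open>0 \<le> r\<close> C(1) by (simp add: ennreal_le_iff del: ennreal_plus)
  qed
  then show ?thesis using that C(1) fin by blast
qed

abbreviation "killing z \<equiv> total_intensity lam z + \<delta>"

lemma killing_pos: "z \<in> {1,2} \<Longrightarrow> 0 < killing z"
  using total_intensity_pos[of z] \<delta>_pos by simp

text \<open>The hypothesis makes the old value a subsolution for the new barriers, hence at most
  their value. One more application of the operator puts the profile itself below the new value, and
  optimality at surplus 0 returns to the old one.\<close>

lemma no_profile_improvement:
  assumes opt: "optimal_barriers M c \<delta> Z K T Y bs" and b: "b \<in> barriers"
    and le: "\<And>z r. z \<in> {1,2} \<Longrightarrow> 0 \<le> r \<Longrightarrow>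
      real_value bs z r \<le> barrier_profile c (killing z) (jump_rate_mean (real_value bs) z) (b z) r"
    and z: "z \<in> {1,2}"
  shows "barrier_profile c (killing z) (jump_rate_mean (real_value bs) z) (b z) 0 \<le> real_value bs z 0"
proof -
  have bs: "bs \<in> barriers" using opt by (simp add: optimal_barriers_def)
  obtain C where C: "0 \<le> C" "linear_growth (real_value bs) C"
    "\<And>z r. z \<in> {1,2} \<Longrightarrow> value_fun bs z r = ennreal (real_value bs z r)"
    using linear_growth_real_value[OF bs] by blast
  let ?bp = "\<lambda>z r. barrier_profile c (killing z) (jump_rate_mean (real_value bs) z) (b z) r"
  let ?h = "\<lambda>z r. ennreal (real_value bs z r)"
  have b0: "0 \<le> b z" if "z \<in> {1,2}" for z using b that by (auto simp: barriers_def)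
  have op: "sojourn_gain b z r + transfer b ?h z r = ennreal (?bp z r)" if "z \<in> {1,2}" "0 \<le> r" for z r
    by (rule renewal_operator_eq[where b=b and z=z, OF C(2) that b0[OF that(1)]])
  have sub: "?h z r \<le> value_fun b z r" if "z \<in> {1,2}" for z r
  proof (rule subsolution_le_value_fun[where h="?h", OF b that C(1)])
    note lg = C(2)[unfolded linear_growth_def, rule_format]
    show "(\<lambda>r. ennreal (real_value bs j r)) \<in> borel_measurable borel" for j
      unfolding real_value_def using value_fun_measurable[of bs j] by measurable
    show "?h j r = 0" if "j \<in> {1,2}" "r < 0" for j r
      using lg[OF that(1)] that by simp
    show "?h j r \<le> ennreal (r + C)" if "j \<in> {1,2}" "0 \<le> r" for j r
      using lg[OF that(1)] that by (intro ennreal_leI) auto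
    show "?h j r \<le> sojourn_gain b j r + transfer b ?h j r" if "j \<in> {1,2}" "0 \<le> r" for j r
      unfolding op[OF that] using le[OF that] by (rule ennreal_leI)
  qed
  have "ennreal (?bp z 0) = sojourn_gain b z 0 + transfer b ?h z 0"
    using op[OF z order_refl] by simp
  also have "\<dots> \<le> sojourn_gain b z 0 + transfer b (value_fun b) z 0"
    by (intro add_left_mono transfer_mono sub)
  also have "\<dots> = value_fun b z 0"
    by (rule value_fun_fixed_point[symmetric])
  also have "\<dots> = barrier_value M c \<delta> Z K T Y b z 0"
    using barrier_value_eq[OF z b] by (simp add: value_fun_def)
  also have "\<dots> \<le> barrier_value M c \<delta> Z K T Y bs z 0"
  proof -
    have "0 \<in> {0..bs z}" using bs z by (auto simp: barriers_def)
    then have "barrier_value M c \<delta> Z K T Y bs z 0 = (SUP b\<in>barriers. barrier_value M c \<delta> Z K T Y b z 0)"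
      using opt z unfolding optimal_barriers_def by blast
    then show ?thesis using b by (auto intro: SUP_upper)
  qed
  also have "\<dots> = ennreal (real_value bs z 0)"
    using barrier_value_eq[OF z bs] C(3)[OF z] by (simp add: value_fun_def)
  finally show ?thesis
    using v_nonneg[OF C(2) z, of 0] by simp
qed

theorem claim_intensity_less:
  assumes opt: "optimal_barriers M c \<delta> Z K T Y bs" and "0 < bs 1" and less: "bs 1 < bs 2"
  shows "lam 1 3 < lam 2 3"
proof -
  have bs: "bs \<in> barriers" using opt by (simp add: optimal_barriers_def)
  obtain C where C: "0 \<le> C" "linear_growth (real_value bs) C"
    "\<And>z r. z \<in> {1,2} \<Longrightarrow> value_fun bs z r = ennreal (real_value bs z r)"
    using linear_growth_real_value[OF bs] by blast
  define v where "v = real_value bs"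
  define H where "H = jump_rate_mean v"
  define G where "G = claim_mean v"
  let ?P = "\<lambda>z. barrier_profile c (killing z) (H z)"
  define w where "w x = \<pi> 1 * v 1 x + \<pi> 2 * v 2 x" for x
  have lg: "linear_growth v C" using C(2) by (simp add: v_def)
  have bs0: "0 \<le> bs z" if "z \<in> {1,2}" for z using bs that by (auto simp: barriers_def)
  have bp_nonneg: "0 \<le> ?P z (bs z) x" if "z \<in> {1,2}" "0 \<le> x" for z x
    unfolding H_def
    using jump_rate_mean_bounds[OF lg that(1) _ order_refl] that
    by (intro barrier_profile_nonneg c_pos killing_pos bs0) auto
  \<comment> \<open>The fixed-point equation becomes one between finite reals; continuity and slopes
    of \<open>v\<close> come from it.\<close>
  have v_eq: "v z x = ?P z (bs z) x" if z: "z \<in> {1,2}" and x: "0 \<le> x" for z x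
  proof -
    have "ennreal (v z x) = sojourn_gain bs z x + transfer bs (value_fun bs) z x"
      using C(3)[OF z] value_fun_fixed_point[of bs z x] by (simp add: v_def)
    also have "transfer bs (value_fun bs) z x = transfer bs (\<lambda>j r. ennreal (v j r)) z x"
      unfolding transfer_def v_def by (intro sum.cong refl) (simp add: C(3))
    also have "sojourn_gain bs z x + \<dots> = ennreal (?P z (bs z) x)"
      unfolding H_def by (rule renewal_operator_eq[where b=bs and z=z, OF lg z x bs0[OF z]])
    finally show ?thesis
      using bp_nonneg[OF z x] v_nonneg[OF lg z] by simp
  qed
  have v_cont: "continuous_on {0..} (v z)" if z: "z \<in> {1,2}" for z
  proof -
    have int: "(\<lambda>u. exp (- killing z * u / c) * H z u / c) integrable_on {0..bs z}"
    proof (rule integrable_on_bounded)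
      note [measurable] = jump_rate_mean_measurable[OF lg z]
      show "(\<lambda>u. exp (- killing z * u / c) * H z u / c) \<in> borel_measurable borel"
        unfolding H_def by measurable
      let ?B = "lam z (3 - z) * (bs z + C) + lam z 3 * (bs z * ((bs z + C) * \<beta>))"
      show "0 \<le> exp (- killing z * u / c) * H z u / c \<and> exp (- killing z * u / c) * H z u / c \<le> ?B / c"
        if u: "u \<in> {0..bs z}" for u
      proof -
        have Hu: "0 \<le> H z u" "H z u \<le> ?B"
          using jump_rate_mean_bounds[OF lg z, of u "bs z"] u by (auto simp: H_def)
        have "0 \<le> killing z * u / c" using killing_pos[OF z] u c_pos by simp
        then have "exp (- killing z * u / c) \<le> 1"
          by (simp only: exp_le_one_iff mult_minus_left divide_minus_left neg_le_0_iff_le)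
        then have "exp (- killing z * u / c) * H z u \<le> 1 * ?B"
          using Hu by (intro mult_mono) auto
        then show ?thesis using Hu c_pos by (auto intro: divide_right_mono)
      qed
    qed
    have "continuous_on {0..} (?P z (bs z))"
      using c_pos by (intro barrier_profile_continuous_on bs0 z int) auto
    then show ?thesis
      by (rule continuous_on_eq) (simp add: v_eq[OF z])
  qed
  \<comment> \<open>Both barrier shifts below stay in \<open>I\<close>. Derivatives are taken within
    \<open>I\<close>, hence one-sided at the barriers.\<close>
  define I where "I = {bs 1..bs 2}"
  have I_sub: "I \<subseteq> {0..bs 2}" using \<open>0 < bs 1\<close> by (auto simp: I_def)
  have w_cont: "continuous_on {0..bs 2} w"
    unfolding w_def by (intro continuous_intros continuous_on_subset[OF v_cont]) auto
  define g where "g x = \<beta> * (w x - G x)" for x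
  have G_eq: "G = (\<lambda>y. integral {0..y} (\<lambda>u. w u * (\<beta> * exp (- \<beta> * (y - u)))))"
    unfolding G_def w_def by (intro ext claim_mean_integral[OF lg])
  have G': "(G has_real_derivative g x) (at x within {0..bs 2})" if "x \<in> {0..bs 2}" for x
    using exponential_convolution_derivative[OF w_cont that, of \<beta>] unfolding g_def G_eq .
  have G'_I: "(G has_real_derivative g x) (at x within I)" if "x \<in> I" for x
    by (rule DERIV_subset[OF G']) (use that I_sub in auto)
  have H1: "H 1 = (\<lambda>y. lam 1 2 * v 2 y + lam 1 3 * G y)" and H2: "H 2 = (\<lambda>y. lam 2 1 * v 1 y + lam 2 3 * G y)"
    by (simp_all add: H_def G_def jump_rate_mean_def fun_eq_iff One_nat_def)
  have G_cont: "continuous_on {0..bs 2} G"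
    using G' by (rule DERIV_continuous_on)
  have H_cont: "continuous_on {0..bs 2} (H z)" if "z \<in> {1,2}" for z
  proof -
    have "continuous_on {0..bs 2} (H 1)" "continuous_on {0..bs 2} (H 2)"
      unfolding H1 H2 by (intro continuous_intros G_cont continuous_on_subset[OF v_cont]; auto)+
    then show ?thesis using that by auto
  qed
  \<comment> \<open>The slope of \<open>v 2\<close> is written as the right-hand side of the profile
    equation, since in this form it can be differentiated once more.\<close>
  define u where "u x = (killing 2 * v 2 x - H 2 x) / c" for x
  have v1': "(v 1 has_real_derivative 1) (at x within I)" if x: "x \<in> I" for x
  proof -
    have "((\<lambda>y. y - bs 1 + (c + H 1 (bs 1)) / killing 1) has_real_derivative 1) (at x within I)"
      by (auto intro!: derivative_eq_intros)
    then show ?thesis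
      by (rule has_field_derivative_transform_within[OF _ zero_less_one x])
        (use \<open>0 < bs 1\<close> in \<open>auto simp: I_def v_eq barrier_profile_above\<close>)
  qed
  have v2': "(v 2 has_real_derivative u x) (at x within I)" if x: "x \<in> I" for x
  proof -
    have "continuous_on I (H 2)"
      using continuous_on_subset[OF H_cont I_sub] by simp
    then have "(?P 2 (bs 2) has_real_derivative u x) (at x within I)"
      using barrier_profile_derivative[of c "bs 1" "bs 2" "H 2" x "killing 2"] c_pos x \<open>0 < bs 1\<close>
      by (simp add: u_def I_def v_eq)
    then show ?thesis
      by (rule has_field_derivative_transform_within[OF _ zero_less_one x])
        (use \<open>0 < bs 1\<close> in \<open>auto simp: I_def v_eq\<close>)
  qed
  have H1': "(H 1 has_real_derivative lam 1 2 * u x + lam 1 3 * g x) (at x within I)"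
    and H2': "(H 2 has_real_derivative lam 2 1 + lam 2 3 * g x) (at x within I)" if "x \<in> I" for x
    unfolding H1 H2 by (auto intro!: derivative_eq_intros v1' v2' G'_I that)
  have g': "(g has_real_derivative \<beta> * (\<pi> 1 + \<pi> 2 * u x - g x)) (at x within I)" if "x \<in> I" for x
    unfolding g_def[abs_def] w_def
    by (auto intro!: derivative_eq_intros v1' v2' G'_I that) (simp add: g_def w_def)
  have u': "(u has_real_derivative ((lam 2 1 + lam 2 3 + \<delta>) * u x - lam 2 1 - lam 2 3 * g x) / c) (at x within I)"
    if "x \<in> I" for x
    unfolding u_def[abs_def] using c_pos
    by (auto intro!: derivative_eq_intros v2' H2' that) (simp add: total_intensity_2 u_def)
  \<comment> \<open>Smooth fit: the boundary value \<open>(c + H) / killing\<close> of the profile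
    forces slope 1 at the barrier.\<close>
  have u_end: "u (bs 2) = 1"
  proof -
    have "killing 2 * v 2 (bs 2) = c + H 2 (bs 2)"
      using v_eq[of 2 "bs 2"] bs0[of 2] killing_pos[of 2] by (simp add: barrier_profile_at_barrier)
    then show ?thesis using c_pos by (simp add: u_def)
  qed
  \<comment> \<open>Changing one coordinate leaves the profile of the other phase equal to its
    value, so a gain at every surplus in phase \<open>z\<close> meets the hypothesis of
    \<open>no_profile_improvement\<close> and contradicts its conclusion.\<close>
  have impossible: False
    if z: "z \<in> {1,2}" and \<eta>: "\<eta> \<in> I" and better: "\<And>x. 0 \<le> x \<Longrightarrow>
      ?P z (bs z) x < ?P z \<eta> x" for z \<eta>
  proof -
    have "bs(z := \<eta>) \<in> barriers"
      using bs \<eta> \<open>0 < bs 1\<close> by (auto simp: barriers_def I_def)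
    then have "?P z ((bs(z := \<eta>)) z) 0 \<le> v z 0"
      unfolding v_def H_def
    proof (rule no_profile_improvement[OF opt _ _ z])
      fix j r assume "j \<in> {1,2::nat}" "0 \<le> (r::real)"
      then show "real_value bs j r \<le> barrier_profile c (killing j) (jump_rate_mean (real_value bs) j) ((bs(z := \<eta>)) j) r"
        using v_eq[of j r] better[of r] by (auto simp: v_def H_def)
    qed
    then show False
      using better[of 0] v_eq[OF z, of 0] by simp
  qed
  have g_cont: "continuous_on I g" using g' by (rule DERIV_continuous_on)
  have u_cont: "continuous_on I u" using u' by (rule DERIV_continuous_on)
  have b1: "bs 1 \<in> I" and b2: "bs 2 \<in> I" using less by (auto simp: I_def)
  have cond2: "killing 2 \<le> lam 2 1 + lam 2 3 * g (bs 2)"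
  proof (rule ccontr)
    assume "\<not> ?thesis"
    then have "0 < killing 2 - (lam 2 1 + lam 2 3 * g (bs 2))" by simp
    \<comment> \<open>Continuity spreads the strict inequality to the left of \<open>bs 2\<close>,
      since profiles are compared over a whole interval of barriers.\<close>
    moreover have "continuous_on I (\<lambda>x. killing 2 - (lam 2 1 + lam 2 3 * g x))"
      by (intro continuous_intros g_cont)
    ultimately have "eventually (\<lambda>x. 0 < killing 2 - (lam 2 1 + lam 2 3 * g x)) (at (bs 2) within I)"
      using b2 by (intro order_tendstoD) (auto simp: continuous_on_def)
    then obtain d where d: "0 < d" "\<And>x. x \<in> I \<Longrightarrow> x \<noteq> bs 2 \<Longrightarrow> dist x (bs 2) < d \<Longrightarrow> lam 2 1 + lam 2 3 * g x < killing 2"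
      by (auto simp: eventually_at)
    \<comment> \<open>\<open>d / 2\<close> keeps \<open>[\<eta>, bs 2]\<close> within distance less
      than \<open>d\<close> of \<open>bs 2\<close>, and the maximum keeps \<open>\<eta>\<close> in
      \<open>I\<close>.\<close>
    define \<eta> where "\<eta> = max (bs 1) (bs 2 - d / 2)"
    have \<eta>: "bs 1 \<le> \<eta>" "\<eta> < bs 2" using less d(1) by (auto simp: \<eta>_def)
    show False
    proof (rule impossible[of 2 \<eta>])
      fix x :: real assume x: "0 \<le> x"
      have "-1 * ?P 2 \<eta> x < -1 * ?P 2 (bs 2) x"
      proof (rule barrier_profile_strict_mono[OF c_pos _ _ \<eta>(2) x H_cont])
        fix y assume y: "y \<in> {\<eta>..bs 2}"
        then have "y \<in> I" using \<eta> by (auto simp: I_def)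
        show "(H 2 has_real_derivative lam 2 1 + lam 2 3 * g y) (at y within {\<eta>..bs 2})"
          by (rule DERIV_subset[OF H2'[OF \<open>y \<in> I\<close>]]) (use \<eta> in \<open>auto simp: I_def\<close>)
        have "lam 2 1 + lam 2 3 * g y < killing 2"
        proof (cases "y = bs 2")
          case False
          have "bs 2 - d / 2 \<le> y" using y by (simp add: \<eta>_def)
          then show ?thesis
            using d \<open>y \<in> I\<close> False y by (intro d(2)) (auto simp: dist_real_def)
        qed (use \<open>\<not> killing 2 \<le> _\<close> in simp)
        then show "0 < -1 * (lam 2 1 + lam 2 3 * g y - killing 2)" by simp
      qed (use killing_pos[of 2] \<eta> \<open>0 < bs 1\<close> in auto)
      then show "?P 2 (bs 2) x < ?P 2 \<eta> x" by simp
    qed (use \<eta> in \<open>auto simp: I_def\<close>)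
  qed
  have cond1: "lam 1 2 * u (bs 1) + lam 1 3 * g (bs 1) \<le> killing 1"
  proof (rule ccontr)
    assume "\<not> ?thesis"
    then have "0 < lam 1 2 * u (bs 1) + lam 1 3 * g (bs 1) - killing 1" by simp
    moreover have "continuous_on I (\<lambda>x. lam 1 2 * u x + lam 1 3 * g x - killing 1)"
      by (intro continuous_intros g_cont u_cont)
    ultimately have "eventually (\<lambda>x. 0 < lam 1 2 * u x + lam 1 3 * g x - killing 1) (at (bs 1) within I)"
      using b1 by (intro order_tendstoD) (auto simp: continuous_on_def)
    then obtain d where d: "0 < d" "\<And>x. x \<in> I \<Longrightarrow> x \<noteq> bs 1 \<Longrightarrow> dist x (bs 1) < d \<Longrightarrow> killing 1 < lam 1 2 * u x + lam 1 3 * g x"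
      by (auto simp: eventually_at)
    \<comment> \<open>The mirror image to the right of \<open>bs 1\<close>; the minimum keeps
      \<open>\<eta>\<close> in \<open>I\<close>, where the slope of \<open>H 1\<close> is
      available.\<close>
    define \<eta> where "\<eta> = min (bs 2) (bs 1 + d / 2)"
    have \<eta>: "bs 1 < \<eta>" "\<eta> \<le> bs 2" using less d(1) by (auto simp: \<eta>_def)
    show False
    proof (rule impossible[of 1 \<eta>])
      fix x :: real assume x: "0 \<le> x"
      have "1 * ?P 1 (bs 1) x < 1 * ?P 1 \<eta> x"
      proof (rule barrier_profile_strict_mono[OF c_pos _ _ \<eta>(1) x])
        show "continuous_on {0..\<eta>} (H 1)"
          using \<eta> by (intro continuous_on_subset[OF H_cont]) auto
        fix y assume y: "y \<in> {bs 1..\<eta>}"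
        then have "y \<in> I" using \<eta> by (auto simp: I_def)
        show "(H 1 has_real_derivative lam 1 2 * u y + lam 1 3 * g y) (at y within {bs 1..\<eta>})"
          by (rule DERIV_subset[OF H1'[OF \<open>y \<in> I\<close>]]) (use \<eta> in \<open>auto simp: I_def\<close>)
        have "killing 1 < lam 1 2 * u y + lam 1 3 * g y"
        proof (cases "y = bs 1")
          case False
          have "y \<le> bs 1 + d / 2" using y by (simp add: \<eta>_def)
          then show ?thesis
            using d \<open>y \<in> I\<close> False y by (intro d(2)) (auto simp: dist_real_def)
        qed (use \<open>\<not> _ \<le> killing 1\<close> in simp)
        then show "0 < 1 * (lam 1 2 * u y + lam 1 3 * g y - killing 1)" by simp
      qed (use killing_pos[of 1] \<open>0 < bs 1\<close> in auto)
      then show "?P 1 (bs 1) x < ?P 1 \<eta> x" by simp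
    qed (use \<eta> in \<open>auto simp: I_def\<close>)
  qed
  have nonneg: "0 \<le> lam 1 2" "0 \<le> lam 1 3" "0 \<le> lam 2 1" "0 \<le> lam 2 3"
    using intensity_nonneg by auto
  have "lam 2 3 * g (bs 2) \<ge> lam 2 3 + \<delta>"
    using cond2 by (simp add: total_intensity_2)
  \<comment> \<open>For \<open>lam 2 3 = 0\<close> the bound would read
    \<open>\<delta> \<le> 0\<close>.\<close>
  then have "lam 2 3 \<noteq> 0" using \<delta>_pos by auto
  then have pos: "0 < lam 2 3" using nonneg by simp
  have g_end: "1 + \<delta> / lam 2 3 \<le> g (bs 2)"
    using \<open>lam 2 3 * g (bs 2) \<ge> lam 2 3 + \<delta>\<close> pos by (simp add: field_simps)
  have "1 \<le> u (bs 1)" and g_less: "g (bs 2) < g (bs 1)"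
    using slope_comparison[OF less c_pos \<beta>_pos \<delta>_pos pos nonneg(3) _ restart_sum u'[unfolded I_def] g'[unfolded I_def] u_end g_end]
      restart_nonneg restart_sum by auto
  show "lam 1 3 < lam 2 3"
  proof (rule ccontr)
    assume "\<not> lam 1 3 < lam 2 3"
    then have ge: "lam 2 3 \<le> lam 1 3" by simp
    \<comment> \<open>The contribution of phase 2 in \<open>cond1\<close> is at least
      \<open>lam 1 2\<close>, the same summand as in \<open>killing 1\<close>, and cancels.\<close>
    have "lam 1 2 * 1 \<le> lam 1 2 * u (bs 1)"
      using \<open>1 \<le> u (bs 1)\<close> nonneg by (intro mult_left_mono) auto
    then have "lam 1 3 * g (bs 1) \<le> lam 1 3 + \<delta>"
      using cond1 by (simp add: total_intensity_1)
    \<comment> \<open>Division is possible because the assumption to be refuted gives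
      \<open>lam 1 3 \<ge> lam 2 3 > 0\<close>.\<close>
    then have "g (bs 1) \<le> 1 + \<delta> / lam 1 3"
      using pos ge by (simp add: field_simps)
    also have "\<dots> \<le> 1 + \<delta> / lam 2 3"
      using pos ge \<delta>_pos by (intro add_left_mono divide_left_mono) auto
    finally show False using g_end g_less by simp
  qed
qed

end

theorem theorem4p4:
  fixes M :: "'a measure"
    and c \<beta> \<delta> :: real
    and \<pi> :: "nat \<Rightarrow> real"
    and lam :: "nat \<Rightarrow> nat \<Rightarrow> real"
    and Z K :: "nat \<Rightarrow> 'a \<Rightarrow> nat"
    and T Y :: "nat \<Rightarrow> 'a \<Rightarrow> real"
    and bs :: "nat \<Rightarrow> real"
  assumes "phase_type_risk_model M c \<beta> \<delta> \<pi> lam Z K T Y"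
    and "optimal_barriers M c \<delta> Z K T Y bs"
    and "0 < bs 1" and "bs 1 < bs 2"
  shows "lam 2 3 > lam 1 3"
  using assms by (rule phase_type_risk_model.claim_intensity_less)

end
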